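(* Using the order $<_2$ on $\mathcal A$, \[ C_\lambda[X(q-1);q,t]=\sum_{\sigma\ \Phi\text{-trivial}}(-1)^{m(\sigma)}q^{p(\sigma)+\mathrm{maj}(\sigma)}t^{\mathrm{quinv}(\sigma)}x^{|\sigma|} =\sum_{\mu\le\lambda'}d_{\mu\lambda}(q,t)\,m_\mu(X) \] for some $d_{\mu\lambda}(q,t)\in\mathbb Q(q,t)$, where $\lambda'$ is the conjugate partition, $\le$ is dominance order, $m_\mu$ are monomial symmetric functions, and the first sum is over all $\Phi$-trivial super fillings of $\mathrm{dg}(\lambda)$.
   Context: Let $\lambda=(\lambda_1\ge\dots\ge\lambda_k>0)$ be a partition; $\mathrm{dg}(\lambda)=\{(r,i):1\le i\le k,1\le r\le\lambda_i\}$, $(r,i)$ being row $r$ from the bottom and column $i$ from the left (columns bottom-justified of heights $\lambda_i$); $\mathrm{leg}((r,i))=\lambda_i-r$. $C_\lambda(X;q,t)=\sum_\sigma q^{\mathrm{maj}(\sigma)}t^{\mathrm{quinv}(\sigma)}x^\sigma$ over fillings $\sigma:\mathrm{dg}(\lambda)\to\mathbb Z_{>0}$ (the special case of the statistics below with all entries positive); it is a symmetric function, and $f[X(q-1)]$ is the plethysm sending power sums $p_m(X)\mapsto(q^m-1)p_m(X)$. $\mathcal A=\{1,\bar1,2,\bar2,\dots\}$ consists of positive letters $i$ and negative letters $\bar i$, $|i|=|\bar i|=i$, totally ordered by $<_2$: $0<1<2<3<\cdots<\bar3<\bar2<\bar1$. $I(a,b)=1$ if $a>b$ or $a=b$ is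 negative, and $I(a,b)=0$ if $a<b$ or $a=b$ is positive. A super filling is $\sigma:\mathrm{dg}(\lambda)\to\mathcal A$; a cell $u=(r,i)$, $r>1$, is a descent if $I(\sigma(u),\sigma((r-1,i)))=1$, and $\mathrm{maj}(\sigma)=\sum_{\text{descents }u}(\mathrm{leg}(u)+1)$. A triple is either three cells $(r+1,i),(r,i),(r,j)$ with $i<j$, or (degenerate) two cells $(r,i),(r,j)$ with $i<j$ and $\lambda_i=r$; with $a=\sigma((r+1,i))$ ($a=0$ if degenerate), $b=\sigma((r,i))$, $c=\sigma((r,j))$, it is a quinv triple iff exactly one of $I(a,b)=1$, $I(c,b)=0$, $I(a,c)=0$ holds; $\mathrm{quinv}(\sigma)$ is the number of quinv triples. $|\sigma|$ is $u\mapsto|\sigma(u)|$, $x^{|\sigma|}=\prod_u x_{|\sigma(u)|}$; $p(\sigma),m(\sigma)$ are the numbers of positive, resp. negative, entries. A super filling $\sigma$ is $\Phi$-trivial if there is no cell $(r,j)$ with $|\sigma((r,j))|<r$, i.e. every entry in row $r$ has absolute value at least $r$. *)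

theory Defs
  imports "HOL-Library.FuncSet" "HOL-Library.Multiset"
begin

definition is_partition :: "nat list \<Rightarrow> bool" where
  "is_partition lam \<longleftrightarrow> sorted_wrt (\<ge>) lam \<and> (\<forall>x\<in>set lam. 0 < x)"

text \<open>Height of column i (columns indexed 1..k).\<close>
definition col :: "nat list \<Rightarrow> nat \<Rightarrow> nat" where
  "col lam i = lam ! (i - 1)"

text \<open>Cells (r,i): row r from the bottom, column i from the left.\<close>
definition dg :: "nat list \<Rightarrow> (nat \<times> nat) set" where
  "dg lam = {(r, i). 1 \<le> i \<and> i \<le> length lam \<and> 1 \<le> r \<and> r \<le> col lam i}"

definition leg :: "nat list \<Rightarrow> nat \<times> nat \<Rightarrow> nat" where
  "leg lam u = col lam (snd u) - fst u"

definition conj_part :: "nat list \<Rightarrow> nat list" where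
  "conj_part lam = map (\<lambda>j. length (filter (\<lambda>x. j \<le> x) lam)) [1..<foldr max lam 0 + 1]"

definition dominated :: "nat list \<Rightarrow> nat list \<Rightarrow> bool" where
  "dominated mu nu \<longleftrightarrow> sum_list mu = sum_list nu \<and>
     (\<forall>k. sum_list (take k mu) \<le> sum_list (take k nu))"

definition partitions_of :: "nat \<Rightarrow> nat list set" where
  "partitions_of n = {mu. is_partition mu \<and> sum_list mu = n}"

text \<open>Letters are encoded as integers: the positive letter i is the integer i,
  the negative letter bar i is the integer -i, and 0 is the auxiliary letter 0.
  The order <_2 is 0 < 1 < 2 < ... < bar 3 < bar 2 < bar 1.\<close>
definition less2 :: "int \<Rightarrow> int \<Rightarrow> bool" where
  "less2 a b \<longleftrightarrow> (if (0 \<le> a) = (0 \<le> b) then a < b else 0 \<le> a \<and> b < 0)"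

definition Ind :: "int \<Rightarrow> int \<Rightarrow> bool" where
  "Ind a b \<longleftrightarrow> less2 b a \<or> (a = b \<and> a < 0)"

definition is_descent :: "nat list \<Rightarrow> (nat \<times> nat \<Rightarrow> int) \<Rightarrow> nat \<times> nat \<Rightarrow> bool" where
  "is_descent lam \<sigma> u \<longleftrightarrow> u \<in> dg lam \<and> 1 < fst u \<and> Ind (\<sigma> u) (\<sigma> (fst u - 1, snd u))"

definition maj :: "nat list \<Rightarrow> (nat \<times> nat \<Rightarrow> int) \<Rightarrow> nat" where
  "maj lam \<sigma> = (\<Sum>u\<in>{u. is_descent lam \<sigma> u}. leg lam u + 1)"

definition quinv_cond :: "int \<Rightarrow> int \<Rightarrow> int \<Rightarrow> bool" where
  "quinv_cond a b c \<longleftrightarrow>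
     (of_bool (Ind a b) + of_bool (\<not> Ind c b) + of_bool (\<not> Ind a c) :: nat) = 1"

text \<open>Non-degenerate triples (r+1,i),(r,i),(r,j) with i<j and degenerate triples
  (r,i),(r,j) with i<j and lambda_i = r (top letter a = 0).\<close>
definition quinv :: "nat list \<Rightarrow> (nat \<times> nat \<Rightarrow> int) \<Rightarrow> nat" where
  "quinv lam \<sigma> =
     card {(r, i, j). i < j \<and> (r + 1, i) \<in> dg lam \<and> (r, i) \<in> dg lam \<and> (r, j) \<in> dg lam \<and>
            quinv_cond (\<sigma> (r + 1, i)) (\<sigma> (r, i)) (\<sigma> (r, j))}
   + card {(r, i, j). i < j \<and> (r, i) \<in> dg lam \<and> (r, j) \<in> dg lam \<and> col lam i = r \<and>
            quinv_cond 0 (\<sigma> (r, i)) (\<sigma> (r, j))}"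

definition npos :: "nat list \<Rightarrow> (nat \<times> nat \<Rightarrow> int) \<Rightarrow> nat" where
  "npos lam \<sigma> = card {u \<in> dg lam. 0 < \<sigma> u}"

definition nneg :: "nat list \<Rightarrow> (nat \<times> nat \<Rightarrow> int) \<Rightarrow> nat" where
  "nneg lam \<sigma> = card {u \<in> dg lam. \<sigma> u < 0}"

definition Phi_trivial :: "nat list \<Rightarrow> (nat \<times> nat \<Rightarrow> int) \<Rightarrow> bool" where
  "Phi_trivial lam \<sigma> \<longleftrightarrow> (\<forall>u\<in>dg lam. int (fst u) \<le> \<bar>\<sigma> u\<bar>)"

definition has_content :: "nat list \<Rightarrow> (nat \<times> nat \<Rightarrow> int) \<Rightarrow> (nat \<Rightarrow> nat) \<Rightarrow> bool" where
  "has_content lam \<sigma> \<alpha> \<longleftrightarrow> (\<forall>j. \<alpha> j = card {u \<in> dg lam. nat \<bar>\<sigma> u\<bar> = j})"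

text \<open>A formal series in the variables x_1, x_2, ... with coefficients in 'a is
  represented by its coefficient function on exponent vectors alpha :: nat => nat
  (the coefficient of prod_j x_j^(alpha j)); index 0 is not a variable.\<close>

definition C_coeff :: "nat list \<Rightarrow> 'a::comm_ring_1 \<Rightarrow> 'a \<Rightarrow> (nat \<Rightarrow> nat) \<Rightarrow> 'a" where
  "C_coeff lam q t \<alpha> =
     (\<Sum>\<sigma>\<in>{\<sigma>. \<sigma> \<in> dg lam \<rightarrow>\<^sub>E {a. 0 < a} \<and> has_content lam \<sigma> \<alpha>}.
        q ^ maj lam \<sigma> * t ^ quinv lam \<sigma>)"

definition super_coeff :: "nat list \<Rightarrow> 'a::comm_ring_1 \<Rightarrow> 'a \<Rightarrow> (nat \<Rightarrow> nat) \<Rightarrow> 'a" where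
  "super_coeff lam q t \<alpha> =
     (\<Sum>\<sigma>\<in>{\<sigma>. \<sigma> \<in> dg lam \<rightarrow>\<^sub>E {a. a \<noteq> 0} \<and> Phi_trivial lam \<sigma> \<and> has_content lam \<sigma> \<alpha>}.
        (-1) ^ nneg lam \<sigma> * q ^ (npos lam \<sigma> + maj lam \<sigma>) * t ^ quinv lam \<sigma>)"

text \<open>Power sum p_mu = prod_i p_(mu_i): coefficient of x^alpha is the number of ways
  phi assigning to each part i a variable index phi_i >= 1 with
  alpha j = sum of the parts mu_i with phi_i = j.\<close>
definition psum_coeff :: "nat list \<Rightarrow> (nat \<Rightarrow> nat) \<Rightarrow> nat" where
  "psum_coeff mu \<alpha> = card {phi. length phi = length mu \<and> (\<forall>x\<in>set phi. 1 \<le> x) \<and>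
      (\<forall>j. \<alpha> j = (\<Sum>i\<in>{i. i < length mu \<and> phi ! i = j}. mu ! i))}"

definition mono_coeff :: "nat list \<Rightarrow> (nat \<Rightarrow> nat) \<Rightarrow> 'a::comm_ring_1" where
  "mono_coeff mu \<alpha> =
     (if \<alpha> 0 = 0 \<and> finite {j. \<alpha> j \<noteq> 0} \<and> image_mset \<alpha> (mset_set {j. \<alpha> j \<noteq> 0}) = mset mu
      then 1 else 0)"

definition pcomb :: "nat \<Rightarrow> (nat list \<Rightarrow> 'a::comm_ring_1) \<Rightarrow> (nat \<Rightarrow> nat) \<Rightarrow> 'a" where
  "pcomb n c \<alpha> = (\<Sum>mu\<in>partitions_of n. c mu * of_nat (psum_coeff mu \<alpha>))"

text \<open>Image of sum_{mu |- n} c_mu p_mu under the plethysm p_m |-> (q^m - 1) p_m,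
  i.e. f[X(q-1)].\<close>
definition pleth_qm1 :: "'a::comm_ring_1 \<Rightarrow> nat \<Rightarrow> (nat list \<Rightarrow> 'a) \<Rightarrow> (nat \<Rightarrow> nat) \<Rightarrow> 'a" where
  "pleth_qm1 q n c \<alpha> =
     (\<Sum>mu\<in>partitions_of n. c mu * prod_list (map (\<lambda>m. q ^ m - 1) mu) * of_nat (psum_coeff mu \<alpha>))"

end

theory Submission
  imports Defs "HOL-Library.Product_Lexorder" "HOL-Computational_Algebra.Polynomial" "HOL-Combinatorics.Permutations"
begin

text \<open>
  Order the cells row by row from the bottom and from left to right in each row. Every comparison in
  \<open>maj\<close> and \<open>quinv\<close> is of the form \<open>I(\<sigma>(x), \<sigma>(y))\<close> with \<open>x\<close> later than \<open>y\<close>, and a triple \<open>(a, b, c)\<close> is a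
  quinv triple iff \<open>I(c,b) + I(a,c) - I(a,b) = 1\<close>; otherwise this expression is \<open>0\<close>.

  \<^emph>\<open>Symmetry of \<open>C_lambda\<close>.\<close> Up to a fixed power of \<open>t\<close> the weight of a filling is a product over pairs of cells,
  and exchanging two adjacent letters is a statement about two-colourings of the cells carrying them.
  Exposing the first of these cells expresses the two-colour generating function by those of smaller sets of
  cells, with coefficients that are symmetric in the two colours.

  \<^emph>\<open>Plethysm.\<close> If a positive and a negative letter are adjacent in the order and carry the same variable, then
  changing the sign at the first cell containing one of them reverses the sign of the signed weight and keeps all
  comparisons. The same cancellation holds for products of power sums, and these relations determine the signed
  generating function from its values on positive contents.

  \<^emph>\<open>Cancellation of the nontrivial fillings.\<close> Let \<open>a\<close> be the least absolute value of an entry violating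
  \<open>|\<sigma>(r,j)| \<ge> r\<close> and let \<open>r\<close> be the highest row containing \<open>a\<close> or \<open>- a\<close>. If the columns of height exactly \<open>r\<close>
  have no such entry in row \<open>r\<close>, changing the sign of the rightmost one cancels the terms. Otherwise the degenerate
  triples obstruct this. Instead, exchanging the upper parts of neighbouring columns of height \<open>r\<close> shows that
  the sum over the fillings with a prescribed pattern of \<open>a\<close>, \<open>- a\<close> and other letters on top of these columns is, up
  to an explicit monomial, independent of the pattern; the monomials add up to a Gaussian binomial
  coefficient times \<open>(1 - 1)(1 - t)(1 - t^2)\<cdots>\<close>.

  \<^emph>\<open>Dominance.\<close> In a trivial filling the letters of absolute value at most \<open>k\<close> lie in the first \<open>k\<close> rows.
\<close>

text \<open>Among letters of absolute value at least a, the order \<open><_2\<close> makes a the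
  least and - a the greatest. Changing a into - a in row r > 1 creates a descent there, worth leg +
  1, and removes the one just above, worth leg. So \<open>maj\<close> grows by 1 while the number of
  positive entries drops by 1, and q^(p + maj) is kept. Only the sign and the power of t can change,
  the latter only through degenerate triples, since the auxiliary letter 0 on top is below both a
  and - a. With several columns ending in row r such a change need not preserve the power of t,
  which is why a sum over all patterns on these columns is needed; the factor 1 - 1 is the one for j
  = 0 in the product of the 1 - t^j. Several arguments cancel a power of t. They run over an
  integral domain with t nonzero; evaluating an indeterminate then gives every t. For the plethysm,
  the signed generating function by signed content is f[X - Y] for f = C_lambda, positive letters
  marking X and negative letters marking Y. Replacing x_i by q x_i and y_i by x_i turns it into
  f[X(q - 1)].\<close>

declare split_paired_All [simp del] split_paired_Ex [simp del]

section \<open>Two-colourings of a linearly ordered set\<close>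

text \<open>The hybrid products, \<open>f\<close> up to a point and \<open>a\<close> after it, form
  a chain from \<open>prod a A\<close> to \<open>prod f A\<close>; the summand at \<open>j\<close>
  is the difference of two consecutive ones.\<close>

lemma prod_telescope:
  fixes f a :: "'i::linorder \<Rightarrow> 'r::comm_ring_1"
  assumes "finite A"
  shows "prod f A = prod a A +
    (\<Sum>j\<in>A. (f j - a j) * prod f {x \<in> A. x < j} * prod a {x \<in> A. j < x})"
  using assms
proof (induction A rule: finite_linorder_max_induct)
  case empty
  then show ?case by simp
next
  case (insert b A)
  have b: "b \<notin> A" using insert by auto
  have s1: "{x \<in> insert b A. x < b} = A" "{x \<in> insert b A. b < x} = {}"
    using insert by auto
  have s2: "{x \<in> insert b A. x < j} = {x \<in> A. x < j}"
    "{x \<in> insert b A. j < x} = insert b {x \<in> A. j < x}" if "j \<in> A" for j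
    using insert that by auto
  have "(\<Sum>j\<in>insert b A. (f j - a j) * prod f {x \<in> insert b A. x < j} * prod a {x \<in> insert b A. j < x})
    = (f b - a b) * prod f A +
      (\<Sum>j\<in>A. (f j - a j) * prod f {x \<in> A. x < j} * (a b * prod a {x \<in> A. j < x}))"
    unfolding sum.insert[OF insert.hyps(1) b] s1
  proof (intro arg_cong2[of _ _ _ _ "(+)"] sum.cong)
    fix j assume j: "j \<in> A"
    have "b \<notin> {x \<in> A. j < x}" "finite {x \<in> A. j < x}" using insert.hyps b by auto
    then show "(f j - a j) * prod f {x \<in> insert b A. x < j} * prod a {x \<in> insert b A. j < x} =
        (f j - a j) * prod f {x \<in> A. x < j} * (a b * prod a {x \<in> A. j < x})"
      unfolding s2[OF j] by simp
  qed simp_all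
  also have "\<dots> = (f b - a b) * prod f A + a b * (prod f A - prod a A)"
    using insert.IH by (simp add: sum_distrib_left algebra_simps)
  finally show ?case using insert b by (simp add: algebra_simps)
qed

text \<open>\<open>S\<close> is the set of points carrying the larger of two adjacent positive
  letters. The flag passed to \<open>K\<close> is then the comparison \<open>Ind\<close> of the
  later point with the earlier one, which is false on ties.\<close>

definition pair_wt :: "('i::linorder \<Rightarrow> 'i \<Rightarrow> bool \<Rightarrow> 'r::comm_ring_1) \<Rightarrow> 'i set \<Rightarrow> 'i set \<Rightarrow> 'r" where
  "pair_wt K X S = (\<Prod>y\<in>X. \<Prod>x\<in>{x \<in> X. y < x}. K y x (x \<in> S \<and> y \<notin> S))"

definition colour_sum :: "('i::linorder \<Rightarrow> 'i \<Rightarrow> bool \<Rightarrow> 'r::comm_ring_1) \<Rightarrow> 'i set \<Rightarrow> 'r \<Rightarrow> 'r \<Rightarrow> 'r" where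
  "colour_sum K X z w = (\<Sum>S\<in>Pow X. z ^ card S * w ^ card (X - S) * pair_wt K X S)"

lemma pair_wt_insert:
  assumes "finite X" "j \<notin> X"
  shows "pair_wt K (insert j X) S =
    (\<Prod>x\<in>{x \<in> X. x < j}. K x j (j \<in> S \<and> x \<notin> S)) * (\<Prod>x\<in>{x \<in> X. j < x}. K j x (x \<in> S \<and> j \<notin> S))
    * pair_wt K X S"
proof -
  have "(\<Prod>x\<in>{x \<in> insert j X. y < x}. K y x (x \<in> S \<and> y \<notin> S)) =
     (if y < j then K y j (j \<in> S \<and> y \<notin> S) else 1) * (\<Prod>x\<in>{x \<in> X. y < x}. K y x (x \<in> S \<and> y \<notin> S))"
    if "y \<in> X" for y
  proof (cases "y < j")
    case True
    then have "{x \<in> insert j X. y < x} = insert j {x \<in> X. y < x}" by auto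
    then show ?thesis using True assms by simp
  next
    case False
    then have "{x \<in> insert j X. y < x} = {x \<in> X. y < x}" by auto
    then show ?thesis using False by simp
  qed
  moreover have "{x \<in> insert j X. j < x} = {x \<in> X. j < x}" by auto
  moreover have "(\<Prod>y\<in>X. if y < j then K y j (j \<in> S \<and> y \<notin> S) else 1) =
      (\<Prod>x\<in>{x \<in> X. x < j}. K x j (j \<in> S \<and> x \<notin> S))"
    using assms by (simp add: prod.inter_filter)
  ultimately show ?thesis
    using assms by (simp add: pair_wt_def prod.distrib mult_ac)
qed

lemma pair_wt_cong:
  assumes "\<And>x. x \<in> X \<Longrightarrow> x \<in> S \<longleftrightarrow> x \<in> S'"
  shows "pair_wt K X S = pair_wt K X S'"
  unfolding pair_wt_def using assms by (intro prod.cong) auto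

text \<open>Exposing the least point \<open>y\<close>: telescoping its interactions over the set of later points in \<open>S\<close>,
  every point between \<open>y\<close> and \<open>j \<in> S\<close> contributes a factor \<open>t\<close> whatever its colour, so \<open>j\<close> can be deleted.\<close>
lemma colour_sum_recursion:
  fixes K :: "'i::linorder \<Rightarrow> 'i \<Rightarrow> bool \<Rightarrow> 'r::comm_ring_1"
  assumes fin: "finite X" and least: "\<And>x. x \<in> X \<Longrightarrow> y < x"
    and K: "\<And>z x b. z \<in> X \<Longrightarrow> x \<in> X \<Longrightarrow> z < x \<Longrightarrow> K y x True \<noteq> K y x False \<Longrightarrow>
      K y z b = (if b then t else 1) \<and> K z x b = (if b then t else 1)"
  shows "colour_sum K (insert y X) z w =
    (z + w) * (\<Prod>x\<in>X. K y x False) * colour_sum K X z w +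
    z * w * (\<Sum>j\<in>X. (K y j True - K y j False) * t ^ card {x \<in> X. x < j} *
      (\<Prod>x\<in>{x \<in> X. j < x}. K y x False * K j x False) * colour_sum K (X - {j}) z w)"
proof -
  have y: "y \<notin> X" using least by blast
  let ?V = "\<Prod>x\<in>X. K y x False"
  have no: "{x \<in> X. x < y} = {}" "{x \<in> X. y < x} = X" using least by force+
  have w1: "pair_wt K (insert y X) S = (\<Prod>x\<in>X. K y x (x \<in> S)) * pair_wt K X S" if "S \<subseteq> X" for S
  proof -
    have "y \<notin> S" using that y by auto
    then show ?thesis by (subst pair_wt_insert[OF fin y]) (simp add: no)
  qed
  have w2: "pair_wt K (insert y X) (insert y S) = ?V * pair_wt K X S" if "S \<subseteq> X" for S
  proof -
    have "pair_wt K X (insert y S) = pair_wt K X S" by (rule pair_wt_cong) (use y in auto)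
    then show ?thesis by (subst pair_wt_insert[OF fin y]) (simp add: no)
  qed
  have step: "(\<Prod>x\<in>X. K y x (x \<in> S)) * pair_wt K X S = ?V * pair_wt K X S +
      (\<Sum>j\<in>X. if j \<in> S then (K y j True - K y j False) * t ^ card {x \<in> X. x < j} *
      (\<Prod>x\<in>{x \<in> X. j < x}. K y x False * K j x False) * pair_wt K (X - {j}) (S - {j}) else 0)"
    if S: "S \<subseteq> X" for S
  proof -
    have "(K y j (j \<in> S) - K y j False) * (\<Prod>x\<in>{x \<in> X. x < j}. K y x (x \<in> S)) *
        (\<Prod>x\<in>{x \<in> X. j < x}. K y x False) * pair_wt K X S =
      (if j \<in> S then (K y j True - K y j False) * t ^ card {x \<in> X. x < j} *
      (\<Prod>x\<in>{x \<in> X. j < x}. K y x False * K j x False) * pair_wt K (X - {j}) (S - {j}) else 0)"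
      if j: "j \<in> X" for j
    proof (cases "j \<in> S \<and> K y j True \<noteq> K y j False")
      case True
      have X: "X = insert j (X - {j})" using j by auto
      have "pair_wt K X S = (\<Prod>x\<in>{x \<in> X - {j}. x < j}. K x j (j \<in> S \<and> x \<notin> S)) *
          (\<Prod>x\<in>{x \<in> X - {j}. j < x}. K j x (x \<in> S \<and> j \<notin> S)) * pair_wt K (X - {j}) S"
        using pair_wt_insert[of "X - {j}" j K S] fin j by (simp add: insert_absorb)
      also have "pair_wt K (X - {j}) S = pair_wt K (X - {j}) (S - {j})"
        by (rule pair_wt_cong) auto
      also have "{x \<in> X - {j}. x < j} = {x \<in> X. x < j}" by auto
      also have "{x \<in> X - {j}. j < x} = {x \<in> X. j < x}" by auto
      finally have p: "pair_wt K X S = (\<Prod>x\<in>{x \<in> X. x < j}. K x j (x \<notin> S)) *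
          (\<Prod>x\<in>{x \<in> X. j < x}. K j x False) * pair_wt K (X - {j}) (S - {j})"
        using True by simp
      have "(\<Prod>x\<in>{x \<in> X. x < j}. K y x (x \<in> S)) * (\<Prod>x\<in>{x \<in> X. x < j}. K x j (x \<notin> S))
        = (\<Prod>x\<in>{x \<in> X. x < j}. t)"
        unfolding prod.distrib[symmetric]
        by (rule prod.cong) (use K j True in auto)
      then have "(\<Prod>x\<in>{x \<in> X. x < j}. K y x (x \<in> S)) * (\<Prod>x\<in>{x \<in> X. x < j}. K x j (x \<notin> S))
        = t ^ card {x \<in> X. x < j}" by simp
      then show ?thesis using True by (simp add: p prod.distrib mult_ac)
    qed auto
    then show ?thesis
      by (subst prod_telescope[OF fin, of _ "\<lambda>x. K y x False"])
        (simp add: distrib_right sum_distrib_right cong: sum.cong)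
  qed
  have del: "(\<Sum>S\<in>Pow X. if j \<in> S then z ^ card S * w ^ card (X - S) * (c * pair_wt K (X - {j}) (S - {j})) else 0)
      = z * (c * colour_sum K (X - {j}) z w)" if j: "j \<in> X" for j c
  proof -
    have "(\<Sum>S\<in>Pow X. if j \<in> S then z ^ card S * w ^ card (X - S) * (c * pair_wt K (X - {j}) (S - {j})) else 0)
      = (\<Sum>S\<in>{S \<in> Pow X. j \<in> S}. z ^ card S * w ^ card (X - S) * (c * pair_wt K (X - {j}) (S - {j})))"
      using fin by (intro sum.inter_filter[symmetric]) simp
    also have "\<dots> = (\<Sum>S\<in>Pow (X - {j}). z * (c * (z ^ card S * w ^ card (X - {j} - S) * pair_wt K (X - {j}) S)))"
    proof (rule sum.reindex_bij_witness[of _ "insert j" "\<lambda>S. S - {j}"])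
      fix S assume S: "S \<in> {S \<in> Pow X. j \<in> S}"
      then have "finite S" using fin finite_subset by blast
      then have "card S = Suc (card (S - {j}))" using S by (metis card.remove mem_Collect_eq)
      moreover have "X - {j} - (S - {j}) = X - S" using S by auto
      ultimately show "z * (c * (z ^ card (S - {j}) * w ^ card (X - {j} - (S - {j})) * pair_wt K (X - {j}) (S - {j})))
        = z ^ card S * w ^ card (X - S) * (c * pair_wt K (X - {j}) (S - {j}))"
        by (simp add: mult_ac)
    qed (use j in auto)
    finally show ?thesis by (simp add: colour_sum_def sum_distrib_left)
  qed
  have P: "Pow (insert y X) = Pow X \<union> insert y ` Pow X" by (rule Pow_insert)
  have dis: "Pow X \<inter> insert y ` Pow X = {}" using y by auto
  have inj: "inj_on (insert y) (Pow X)" using y by (auto simp: inj_on_def)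
  have c1: "card (insert y X - S) = Suc (card (X - S))" if "S \<subseteq> X" for S
  proof -
    have "insert y X - S = insert y (X - S)" using that y by auto
    then show ?thesis using fin y by simp
  qed
  have c2: "X - insert y S = X - S" for S using y by auto
  have c3: "card (insert y S) = Suc (card S)" if "S \<subseteq> X" for S
    using that y fin finite_subset by (metis card_insert_disjoint subsetD)
  \<comment> \<open>Split by whether \<open>y\<close> lies in \<open>S\<close>. If it does, no flag
    between \<open>y\<close> and a later point is true, so the telescoped product is needed only for
    \<open>y\<close> outside \<open>S\<close>.\<close>
  have "colour_sum K (insert y X) z w =
     (\<Sum>S\<in>Pow X. w * (z ^ card S * w ^ card (X - S) * ((\<Prod>x\<in>X. K y x (x \<in> S)) * pair_wt K X S)))
     + (\<Sum>S\<in>Pow X. z * ?V * (z ^ card S * w ^ card (X - S) * pair_wt K X S))"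
    unfolding colour_sum_def P
    by (subst sum.union_disjoint) (use fin dis in \<open>simp_all add: sum.reindex[OF inj] c1 c2 c3 w1 w2 mult_ac\<close>)
  also have "(\<Sum>S\<in>Pow X. w * (z ^ card S * w ^ card (X - S) * ((\<Prod>x\<in>X. K y x (x \<in> S)) * pair_wt K X S)))
    = w * (?V * colour_sum K X z w) + w * (\<Sum>S\<in>Pow X. \<Sum>j\<in>X. if j \<in> S then z ^ card S * w ^ card (X - S) *
      (((K y j True - K y j False) * t ^ card {x \<in> X. x < j} *
      (\<Prod>x\<in>{x \<in> X. j < x}. K y x False * K j x False)) * pair_wt K (X - {j}) (S - {j})) else 0)"
    unfolding colour_sum_def sum_distrib_left sum.distrib[symmetric]
  proof (rule sum.cong[OF refl])
    fix S assume "S \<in> Pow X"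
    then have S: "S \<subseteq> X" by simp
    show "w * (z ^ card S * w ^ card (X - S) * ((\<Prod>x\<in>X. K y x (x \<in> S)) * pair_wt K X S)) =
      w * (?V * (z ^ card S * w ^ card (X - S) * pair_wt K X S)) +
      (\<Sum>j\<in>X. w * (if j \<in> S then z ^ card S * w ^ card (X - S) *
      (((K y j True - K y j False) * t ^ card {x \<in> X. x < j} *
      (\<Prod>x\<in>{x \<in> X. j < x}. K y x False * K j x False)) * pair_wt K (X - {j}) (S - {j})) else 0))"
      unfolding step[OF S] distrib_left sum_distrib_left
      by (intro arg_cong2[of _ _ _ _ "(+)"] sum.cong) (auto simp: mult_ac)
  qed
  also have "(\<Sum>S\<in>Pow X. \<Sum>j\<in>X. if j \<in> S then z ^ card S * w ^ card (X - S) *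
      (((K y j True - K y j False) * t ^ card {x \<in> X. x < j} *
      (\<Prod>x\<in>{x \<in> X. j < x}. K y x False * K j x False)) * pair_wt K (X - {j}) (S - {j})) else 0)
    = (\<Sum>j\<in>X. z * (((K y j True - K y j False) * t ^ card {x \<in> X. x < j} *
      (\<Prod>x\<in>{x \<in> X. j < x}. K y x False * K j x False)) * colour_sum K (X - {j}) z w))"
    by (subst sum.swap) (simp add: del)
  also have "(\<Sum>S\<in>Pow X. z * ?V * (z ^ card S * w ^ card (X - S) * pair_wt K X S)) =
     z * ?V * colour_sum K X z w"
    by (simp add: colour_sum_def sum_distrib_left)
  finally show ?thesis by (simp add: sum_distrib_left algebra_simps)
qed

text \<open>The condition on \<open>K\<close> concerns triples inside \<open>X\<close>, so it passes
  to the sets obtained by deleting the least point and possibly one more. The recursion reduces to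
  these with the symmetric factors z + w and z * w.\<close>

lemma colour_sum_commute:
  fixes K :: "'i::linorder \<Rightarrow> 'i \<Rightarrow> bool \<Rightarrow> 'r::comm_ring_1"
  assumes "finite X"
    and "\<And>y z x b. y \<in> X \<Longrightarrow> z \<in> X \<Longrightarrow> x \<in> X \<Longrightarrow> y < z \<Longrightarrow> z < x \<Longrightarrow> K y x True \<noteq> K y x False \<Longrightarrow>
      K y z b = (if b then t else 1) \<and> K z x b = (if b then t else 1)"
  shows "colour_sum K X z w = colour_sum K X w z"
  using assms
proof (induction "card X" arbitrary: X rule: less_induct)
  case less
  show ?case
  proof (cases "X = {}")
    case True
    then show ?thesis by (simp add: colour_sum_def)
  next
    case False
    define y where "y = Min X"
    define Y where "Y = X - {y}"
    have yX: "y \<in> X" "\<And>x. x \<in> Y \<Longrightarrow> y < x" 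
      using False less.prems(1) unfolding y_def Y_def by (auto simp: less_le)
    have X: "X = insert y Y" using yX by (auto simp: Y_def)
    have finY: "finite Y" using less.prems by (simp add: Y_def)
    have K: "K y z' b = (if b then t else 1) \<and> K z' x b = (if b then t else 1)"
      if "z' \<in> Y" "x \<in> Y" "z' < x" "K y x True \<noteq> K y x False" for z' x b
      using less.prems(2)[of y z' x b] that yX by (auto simp: Y_def)
    have IH: "colour_sum K Z z w = colour_sum K Z w z" if "Z \<subseteq> Y" for Z
    proof (rule less.hyps)
      have "Z \<subset> X" using that yX by (auto simp: Y_def)
      then show "card Z < card X" using less.prems(1) psubset_card_mono by blast
      show "finite Z" using that finY finite_subset by blast
      fix u v x b assume "u \<in> Z" "v \<in> Z" "x \<in> Z" "u < v" "v < x" "K u x True \<noteq> K u x False"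
      moreover have "Z \<subseteq> X" using that X by auto
      ultimately show "K u v b = (if b then t else 1) \<and> K v x b = (if b then t else 1)"
        by (intro less.prems(2)) auto
    qed
    note rec = colour_sum_recursion[where K = K and y = y and t = t, OF finY yX(2) K]
    have "(\<Sum>j\<in>Y. (K y j True - K y j False) * t ^ card {x \<in> Y. x < j} *
        (\<Prod>x\<in>{x \<in> Y. j < x}. K y x False * K j x False) * colour_sum K (Y - {j}) z w) =
      (\<Sum>j\<in>Y. (K y j True - K y j False) * t ^ card {x \<in> Y. x < j} *
        (\<Prod>x\<in>{x \<in> Y. j < x}. K y x False * K j x False) * colour_sum K (Y - {j}) w z)"
      by (rule sum.cong) (auto simp: IH)
    then show ?thesis
      unfolding X
      by (subst (1 2) rec) (auto simp: IH[of Y] ac_simps)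
  qed
qed

lemma prod_const_poly: "(\<Prod>x\<in>A. [:f x:]) = [:\<Prod>x\<in>A. f x :: 'r::comm_ring_1:]"
  by (induction A rule: infinite_finite_induct) (auto simp: one_pCons)

lemma pair_wt_const_poly:
  "pair_wt (\<lambda>y x b. [:K y x b:]) X S = [:pair_wt K X S:]"
  by (simp add: pair_wt_def prod_const_poly)

text \<open>With z an indeterminate and w = 1, the coefficient of z^k collects the sets of size k.
  With z and w exchanged it collects the sets whose complement has size k, that is the sets of size
  l.\<close>

lemma colour_sum_card_symmetric:
  fixes K :: "'i::linorder \<Rightarrow> 'i \<Rightarrow> bool \<Rightarrow> 'r::comm_ring_1"
  assumes fin: "finite X" and k: "k + l = card X"
    and K: "\<And>y z x b. y \<in> X \<Longrightarrow> z \<in> X \<Longrightarrow> x \<in> X \<Longrightarrow> y < z \<Longrightarrow> z < x \<Longrightarrow> K y x True \<noteq> K y x False \<Longrightarrow>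
      K y z b = (if b then t else 1) \<and> K z x b = (if b then t else 1)"
  shows "(\<Sum>S\<in>{S. S \<subseteq> X \<and> card S = k}. pair_wt K X S) = (\<Sum>S\<in>{S. S \<subseteq> X \<and> card S = l}. pair_wt K X S)"
proof -
  let ?K = "\<lambda>y x b. [:K y x b:]" and ?x = "[:0, 1:] :: 'r poly"
  have x: "?x ^ n * [:c:] = monom c n" for n c
    by (simp add: monom_altdef)
  have "colour_sum ?K X ?x 1 = colour_sum ?K X 1 ?x"
    by (rule colour_sum_commute[where t = "[:t:]"]) (use fin K in \<open>auto simp: one_pCons\<close>)
  then have "coeff (\<Sum>S\<in>Pow X. monom (pair_wt K X S) (card S)) k =
      coeff (\<Sum>S\<in>Pow X. monom (pair_wt K X S) (card (X - S))) k"
    unfolding colour_sum_def pair_wt_const_poly power_one mult_1_right mult_1_left x by simp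
  then have "(\<Sum>S\<in>Pow X. if card S = k then pair_wt K X S else 0) =
      (\<Sum>S\<in>Pow X. if card (X - S) = k then pair_wt K X S else 0)"
    by (simp add: coeff_sum)
  also have "\<dots> = (\<Sum>S\<in>Pow X. if card S = l then pair_wt K X S else 0)"
  proof (rule sum.cong)
    fix S assume "S \<in> Pow X"
    then have "card (X - S) = card X - card S" "card S \<le> card X"
      using fin by (auto simp: card_Diff_subset finite_subset card_mono)
    then show "(if card (X - S) = k then pair_wt K X S else 0) = (if card S = l then pair_wt K X S else 0)"
      using k by auto
  qed simp
  finally show ?thesis
    using fin by (simp add: sum.inter_filter[symmetric])
qed

section \<open>The statistics row by row\<close>

text \<open>The length of row \<open>r\<close>, that is the part with index \<open>r\<close> of the
  conjugate partition. It is 0 above \<open>height lam\<close>, so sums over row r + 1 need no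
  separate case at the top.\<close>

definition rowlen :: "nat list \<Rightarrow> nat \<Rightarrow> nat" where
  "rowlen lam r = length (filter (\<lambda>x. r \<le> x) lam)"

definition height :: "nat list \<Rightarrow> nat" where
  "height lam = foldr max lam 0"

lemma le_height: "x \<in> set lam \<Longrightarrow> x \<le> height lam"
  unfolding height_def by (induction lam) auto

text \<open>In a weakly decreasing list the entries that are at least \<open>r\<close> form a
  prefix. This allows the diagram, given by columns, to be read by rows.\<close>

lemma less_length_filter_sorted:
  "sorted_wrt (\<ge>) l \<Longrightarrow> i < length (filter (\<lambda>x. r \<le> x) l) \<longleftrightarrow> i < length l \<and> (r::nat) \<le> l ! i"
proof (induction l arbitrary: i)
  case (Cons x xs)
  show ?case
  proof (cases "r \<le> x")
    case True
    then show ?thesis using Cons by (cases i) auto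
  next
    case False
    then have "\<forall>y\<in>set xs. \<not> r \<le> y" using Cons.prems by auto
    then have "filter (\<lambda>x. r \<le> x) xs = []" "i < length (x # xs) \<Longrightarrow> \<not> r \<le> (x # xs) ! i"
      using False by (auto simp: filter_empty_conv nth_Cons split: nat.splits)
    then show ?thesis using False by auto
  qed
qed simp

lemma dg_iff:
  assumes "is_partition lam"
  shows "(r, i) \<in> dg lam \<longleftrightarrow> 1 \<le> r \<and> 1 \<le> i \<and> i \<le> rowlen lam r"
  using less_length_filter_sorted[of lam "i - 1" r] assms
  unfolding dg_def rowlen_def is_partition_def col_def by (cases i) auto

lemma rowlen_antimono: "r \<le> s \<Longrightarrow> rowlen lam s \<le> rowlen lam r"
  unfolding rowlen_def by (induction lam) auto

lemma rowlen_height: "height lam < r \<Longrightarrow> rowlen lam r = 0"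
  unfolding rowlen_def using le_height[of _ lam] by (fastforce simp: filter_empty_conv)

lemma dg_eq_Sigma:
  assumes "is_partition lam"
  shows "dg lam = Sigma {1..height lam} (\<lambda>r. {1..rowlen lam r})"
proof -
  have "r \<le> height lam" if "1 \<le> i" "i \<le> rowlen lam r" for r i
    using rowlen_height[of lam r] that by (cases "height lam < r") auto
  then show ?thesis by (auto simp: dg_iff[OF assms])
qed

lemma finite_dg: "is_partition lam \<Longrightarrow> finite (dg lam)"
  by (simp add: dg_eq_Sigma)

text \<open>The columns ending in row \<open>r\<close> form the interval of indices beyond the end
  of row r + 1; this identifies the degenerate triples by row lengths alone.\<close>

lemma col_less_Suc_iff:
  assumes "is_partition lam" "(r, i) \<in> dg lam"
  shows "col lam i = r \<longleftrightarrow> rowlen lam (r + 1) < i"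
proof -
  have "(r + 1, i) \<in> dg lam \<longleftrightarrow> i \<le> rowlen lam (r + 1)"
    using assms dg_iff[OF assms(1)] by auto
  moreover have "(r + 1, i) \<in> dg lam \<longleftrightarrow> r + 1 \<le> col lam i" "r \<le> col lam i"
    using assms(2) unfolding dg_def by auto
  ultimately show ?thesis by auto
qed

section \<open>Comparisons of letters and quinv triples\<close>

lemma Ind_zero [simp]: "\<not> Ind 0 b"
  by (auto simp: Ind_def less2_def)

lemma Ind_antisym: "a \<noteq> b \<Longrightarrow> Ind b a \<longleftrightarrow> \<not> Ind a b"
  by (auto simp: Ind_def less2_def split: if_splits)

definition qd :: "int \<Rightarrow> int \<Rightarrow> int \<Rightarrow> int" where
  "qd a b c = of_bool (Ind c b) + of_bool (Ind a c) - of_bool (Ind a b)"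

text \<open>Of the three conditions defining a quinv triple, 2 - \<open>qd a b c\<close> hold. Two
  transitivity laws of \<open>Ind\<close>, which survive ties, exclude that all or none of them
  hold, so \<open>qd a b c\<close> is 0 or 1.\<close>

lemma quinv_cond_eq_qd: "of_bool (quinv_cond a b c) = qd a b c"
proof -
  have "Ind a b \<Longrightarrow> Ind c b \<or> Ind a c" "Ind c b \<Longrightarrow> Ind a c \<Longrightarrow> Ind a b"
    by (auto simp: Ind_def less2_def split: if_splits)
  then show ?thesis by (auto simp: quinv_cond_def qd_def)
qed

definition col_pairs :: "nat \<Rightarrow> (nat \<times> nat) set" where
  "col_pairs n = {(i, j). 1 \<le> i \<and> i < j \<and> j \<le> n}"

lemma col_pairs_Sigma: "col_pairs n = Sigma {1..n} (\<lambda>i. {i<..n})"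
  by (auto simp: col_pairs_def)

lemma finite_col_pairs [simp]: "finite (col_pairs n)"
  by (simp add: col_pairs_Sigma)

lemma sum_col_pairs: "(\<Sum>(i, j)\<in>col_pairs n. f i j) = (\<Sum>i\<in>{1..n}. \<Sum>j\<in>{i<..n}. f i j)"
  by (simp add: col_pairs_Sigma sum.Sigma)

lemma sum_col_pairs': "(\<Sum>(i, j)\<in>col_pairs n. f i j) = (\<Sum>j\<in>{1..n}. \<Sum>i\<in>{1..<j}. f i j)"
proof -
  have "(\<Sum>j\<in>{1..n}. \<Sum>i\<in>{1..<j}. f i j) = (\<Sum>(j, i)\<in>Sigma {1..n} (\<lambda>j. {1..<j}). f i j)"
    by (simp add: sum.Sigma)
  also have "\<dots> = (\<Sum>(i, j)\<in>col_pairs n. f i j)"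
    by (rule sum.reindex_bij_witness[of _ "\<lambda>(i, j). (j, i)" "\<lambda>(i, j). (j, i)"]) (auto simp: col_pairs_def)
  finally show ?thesis ..
qed

text \<open>The default 0 stands over a column that ends in row \<open>r\<close>, so degenerate
  triples become ordinary ones in the formula for a row.\<close>

definition upper :: "nat list \<Rightarrow> (nat \<times> nat \<Rightarrow> int) \<Rightarrow> nat \<Rightarrow> nat \<Rightarrow> int" where
  "upper lam \<sigma> r i = (if i \<le> rowlen lam (r + 1) then \<sigma> (r + 1, i) else 0)"

definition quinv_row :: "nat \<Rightarrow> (nat \<Rightarrow> int) \<Rightarrow> (nat \<Rightarrow> int) \<Rightarrow> int" where
  "quinv_row n u v = (\<Sum>(i, j)\<in>col_pairs n. qd (u i) (v i) (v j))"

lemma quinv_eq_sum_rows: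
  assumes "is_partition lam"
  shows "int (quinv lam \<sigma>) =
    (\<Sum>r\<in>{1..height lam}. quinv_row (rowlen lam r) (upper lam \<sigma> r) (\<lambda>i. \<sigma> (r, i)))"
proof -
  let ?A = "{(r, i, j). i < j \<and> (r + 1, i) \<in> dg lam \<and> (r, i) \<in> dg lam \<and> (r, j) \<in> dg lam \<and>
            quinv_cond (\<sigma> (r + 1, i)) (\<sigma> (r, i)) (\<sigma> (r, j))}"
  let ?B = "{(r, i, j). i < j \<and> (r, i) \<in> dg lam \<and> (r, j) \<in> dg lam \<and> col lam i = r \<and>
            quinv_cond 0 (\<sigma> (r, i)) (\<sigma> (r, j))}"
  let ?T = "Sigma {1..height lam} (\<lambda>r. col_pairs (rowlen lam r))"
  let ?P = "\<lambda>(r, i, j). quinv_cond (upper lam \<sigma> r i) (\<sigma> (r, i)) (\<sigma> (r, j))"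
  have fin: "finite ?T" by simp
  have T: "(r, i, j) \<in> ?T \<longleftrightarrow> i < j \<and> (r, i) \<in> dg lam \<and> (r, j) \<in> dg lam" for r i j
    using dg_eq_Sigma[OF assms] by (auto simp: col_pairs_def)
  have up: "(r + 1, i) \<in> dg lam \<longleftrightarrow> i \<le> rowlen lam (r + 1)" if "(r, i) \<in> dg lam" for r i
    using that dg_iff[OF assms] by auto
  have AB: "?A \<union> ?B = {x \<in> ?T. ?P x}" "?A \<inter> ?B = {}"
  proof -
    have "x \<in> ?A \<union> ?B \<longleftrightarrow> x \<in> {x \<in> ?T. ?P x}" for x
    proof -
      obtain r i j where x: "x = (r, i, j)" by (cases x) auto
      show ?thesis
      proof (cases "i < j \<and> (r, i) \<in> dg lam \<and> (r, j) \<in> dg lam")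
        case True
        then have "x \<in> ?T" using T[of r i j] unfolding x by blast
        then have "x \<in> {x \<in> ?T. ?P x} \<longleftrightarrow> quinv_cond (upper lam \<sigma> r i) (\<sigma> (r, i)) (\<sigma> (r, j))"
          unfolding x by simp
        moreover have "x \<in> ?A \<union> ?B \<longleftrightarrow> ((r + 1, i) \<in> dg lam \<and> quinv_cond (\<sigma> (r + 1, i)) (\<sigma> (r, i)) (\<sigma> (r, j)))
          \<or> (col lam i = r \<and> quinv_cond 0 (\<sigma> (r, i)) (\<sigma> (r, j)))"
          using True unfolding x by simp
        ultimately show ?thesis
          using True up[of r i] col_less_Suc_iff[OF assms, of r i] by (simp add: upper_def)
      next
        case False
        then have "x \<notin> ?A \<union> ?B" unfolding x by (simp, blast)
        moreover have "x \<notin> ?T" using False T[of r i j] unfolding x by blast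
        ultimately show ?thesis by simp
      qed
    qed
    then show "?A \<union> ?B = {x \<in> ?T. ?P x}" by (rule set_eqI)
    show "?A \<inter> ?B = {}"
    proof (rule ccontr)
      assume "?A \<inter> ?B \<noteq> {}"
      then obtain r i where "(r + 1, i) \<in> dg lam" "(r, i) \<in> dg lam" "col lam i = r" by blast
      then show False using up[of r i] col_less_Suc_iff[OF assms, of r i] by simp
    qed
  qed
  have "finite (?A \<union> ?B)" unfolding AB using fin by simp
  then have "finite ?A" "finite ?B" by auto
  then have "quinv lam \<sigma> = card {x \<in> ?T. ?P x}"
    unfolding quinv_def AB(1)[symmetric] using AB(2) by (intro card_Un_disjoint[symmetric])
  then have "int (quinv lam \<sigma>) = (\<Sum>x\<in>?T. of_bool (?P x))"
    using fin by (simp add: sum_of_bool_eq Int_def)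
  also have "\<dots> = (\<Sum>r\<in>{1..height lam}. \<Sum>x\<in>col_pairs (rowlen lam r). of_bool (?P (r, x)))"
    by (subst sum.Sigma) (simp_all add: split_def del: sum_of_bool_eq)
  also have "\<dots> = (\<Sum>r\<in>{1..height lam}. quinv_row (rowlen lam r) (upper lam \<sigma> r) (\<lambda>i. \<sigma> (r, i)))"
    unfolding quinv_row_def by (intro sum.cong refl) (simp add: split_def quinv_cond_eq_qd)
  finally show ?thesis .
qed

text \<open>Descents are indexed by the lower cell (r, i) instead of the upper one; leg + 1 of the
  cell (r + 1, i) is \<open>col lam i - r\<close>.\<close>

lemma maj_eq_sum_rows:
  assumes "is_partition lam"
  shows "maj lam \<sigma> = (\<Sum>r\<in>{1..height lam}. \<Sum>i\<in>{1..rowlen lam (r + 1)}.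
    if Ind (\<sigma> (r + 1, i)) (\<sigma> (r, i)) then col lam i - r else 0)"
proof -
  let ?T = "Sigma {1..height lam} (\<lambda>r. {1..rowlen lam (r + 1)})"
  have "maj lam \<sigma> = (\<Sum>(r, i)\<in>{x \<in> ?T. case x of (r, i) \<Rightarrow> Ind (\<sigma> (r + 1, i)) (\<sigma> (r, i))}. col lam i - r)"
    unfolding maj_def
  proof (rule sum.reindex_bij_witness[of _ "\<lambda>(r, i). (r + 1, i)" "\<lambda>(r, i). (r - 1, i)"])
    fix u assume u: "u \<in> {u. is_descent lam \<sigma> u}"
    obtain r i where ui: "u = (r, i)" by (cases u)
    have d: "(r, i) \<in> dg lam" "1 < r" "Ind (\<sigma> (r, i)) (\<sigma> (r - 1, i))"
      using u ui by (auto simp: is_descent_def)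
    have "i \<le> rowlen lam r" "1 \<le> i" "r \<le> height lam"
      using d(1) dg_iff[OF assms] dg_eq_Sigma[OF assms] by auto
    then show "(case u of (r, i) \<Rightarrow> (r - 1, i)) \<in> {x \<in> ?T. case x of (r, i) \<Rightarrow> Ind (\<sigma> (r + 1, i)) (\<sigma> (r, i))}"
      using d ui by auto
    show "(case case u of (r, i) \<Rightarrow> (r - 1, i) of (r, i) \<Rightarrow> (r + 1, i)) = u" using d ui by auto
    have "r \<le> col lam i" using d(1) by (auto simp: dg_def)
    then show "(case case u of (r, i) \<Rightarrow> (r - 1, i) of (r, i) \<Rightarrow> col lam i - r) = leg lam u + 1"
      using d ui by (auto simp: leg_def)
  next
    fix b assume "b \<in> {x \<in> ?T. case x of (r, i) \<Rightarrow> Ind (\<sigma> (r + 1, i)) (\<sigma> (r, i))}"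
    then show "(case b of (r, i) \<Rightarrow> (r + 1, i)) \<in> {u. is_descent lam \<sigma> u}"
      using dg_iff[OF assms] by (auto simp: is_descent_def)
  qed auto
  also have "\<dots> = (\<Sum>x\<in>?T. case x of (r, i) \<Rightarrow> if Ind (\<sigma> (r + 1, i)) (\<sigma> (r, i)) then col lam i - r else 0)"
    by (subst sum.inter_filter) (auto intro!: sum.cong)
  also have "\<dots> = (\<Sum>r\<in>{1..height lam}. \<Sum>i\<in>{1..rowlen lam (r + 1)}.
    if Ind (\<sigma> (r + 1, i)) (\<sigma> (r, i)) then col lam i - r else 0)"
    by (simp add: sum.Sigma)
  finally show ?thesis .
qed

text \<open>The pairs whose comparison enters \<open>quinv\<close> with a plus sign: the two lower
  cells of a triple, and its right cell with its top cell. Between a cell and the position above it,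
  in the reading order, lie exactly the cells that it attacks.\<close>

definition attacks :: "nat \<times> nat \<Rightarrow> nat \<times> nat \<Rightarrow> bool" where
  "attacks y x \<longleftrightarrow> fst x = fst y \<and> snd y < snd x \<or> fst x = fst y + 1 \<and> snd x < snd y"

text \<open>A descent at (r + 1, i) is subtracted in \<open>quinv\<close> once for each of the
  \<open>rowlen lam r - i\<close> cells to the right of (r, i), the arm. Instead of giving descents
  a negative power of t, the arm is charged to the vertical pairs that are not descents.\<close>

definition cell_wt :: "nat list \<Rightarrow> 'r::comm_ring_1 \<Rightarrow> 'r \<Rightarrow> nat \<times> nat \<Rightarrow> nat \<times> nat \<Rightarrow> bool \<Rightarrow> 'r" where
  "cell_wt lam q t y x b =
    (if attacks y x then (if b then t else 1)
     else if x = (fst y + 1, snd y) then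
       (if b then q ^ (col lam (snd y) - fst y) else t ^ (rowlen lam (fst y) - snd y))
     else 1)"

text \<open>If the interaction of \<open>y\<close> and \<open>x\<close> depends on its flag,
  \<open>x\<close> comes no later than the cell directly above \<open>y\<close>. A cell between them
  is then attacked by \<open>y\<close> and attacks \<open>x\<close>. This is the condition on
  \<open>K\<close> in \<open>colour_sum_commute\<close>.\<close>

lemma cell_wt_between:
  assumes "y < z" "z < x" "cell_wt lam q t y x True \<noteq> cell_wt lam q t y x False"
  shows "cell_wt lam q t y z b = (if b then t else 1)" "cell_wt lam q t z x b = (if b then t else 1)"
proof -
  have "attacks y x \<or> x = (fst y + 1, snd y)"
    using assms(3) unfolding cell_wt_def by (simp split: if_splits)
  moreover have "fst y < fst z \<or> fst y = fst z \<and> snd y < snd z" "fst z < fst x \<or> fst z = fst x \<and> snd z < snd x"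
    using assms(1,2) by (auto simp: less_prod_def')
  ultimately have "attacks y z" "attacks z x"
    unfolding attacks_def prod_eq_iff fst_conv snd_conv by presburger+
  then show "cell_wt lam q t y z b = (if b then t else 1)" "cell_wt lam q t z x b = (if b then t else 1)"
    by (simp_all add: cell_wt_def)
qed

text \<open>Multiplying by \<open>t ^ total_arm\<close> avoids the negative powers of \<open>t\<close> that the arms of descents would contribute.\<close>
definition total_arm :: "nat list \<Rightarrow> nat" where
  "total_arm lam = (\<Sum>r\<in>{1..height lam}. \<Sum>i\<in>{1..rowlen lam (r + 1)}. rowlen lam r - i)"

lemma prod_later_cells:
  fixes q t :: "'r::comm_ring_1"
  assumes lam: "is_partition lam" and r: "1 \<le> r" and j: "1 \<le> j" "j \<le> rowlen lam r"
  shows "(\<Prod>x\<in>{x \<in> dg lam. (r, j) < x}. cell_wt lam q t (r, j) x (Ind (\<sigma> x) (\<sigma> (r, j)))) =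
    t ^ ((\<Sum>k\<in>{j<..rowlen lam r}. of_bool (Ind (\<sigma> (r, k)) (\<sigma> (r, j)))) +
         (\<Sum>i\<in>{1..<j}. of_bool (Ind (upper lam \<sigma> r i) (\<sigma> (r, j))))) *
    (if j \<le> rowlen lam (r + 1) then
       (if Ind (\<sigma> (r + 1, j)) (\<sigma> (r, j)) then q ^ (col lam j - r) else t ^ (rowlen lam r - j)) else 1)"
proof -
  let ?f = "\<lambda>x. cell_wt lam q t (r, j) x (Ind (\<sigma> x) (\<sigma> (r, j)))"
  let ?n = "rowlen lam r" and ?m = "rowlen lam (r + 1)"
  let ?A = "Pair r ` {j<..?n}" and ?B = "Pair (r + 1) ` {i \<in> {1..<j}. i \<le> ?m}"
    and ?C = "if j \<le> ?m then {(r + 1, j)} else {}"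
  have fin: "finite {x \<in> dg lam. (r, j) < x}" using finite_dg[OF lam] by simp
  have "(\<Prod>x\<in>{x \<in> dg lam. (r, j) < x}. ?f x) = (\<Prod>x\<in>?A \<union> ?B \<union> ?C. ?f x)"
  proof (rule prod.mono_neutral_right[OF fin])
    show "?A \<union> ?B \<union> ?C \<subseteq> {x \<in> dg lam. (r, j) < x}"
      using r j dg_iff[OF lam] by auto
    show "\<forall>x\<in>{x \<in> dg lam. (r, j) < x} - (?A \<union> ?B \<union> ?C). ?f x = 1"
    proof
      fix x assume x: "x \<in> {x \<in> dg lam. (r, j) < x} - (?A \<union> ?B \<union> ?C)"
      obtain s i where xi: "x = (s, i)" by (cases x)
      have i: "1 \<le> i" "i \<le> rowlen lam s" using x xi dg_iff[OF lam] by auto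
      have "\<not> attacks (r, j) x" "x \<noteq> (r + 1, j)"
        using x i unfolding xi attacks_def by (auto split: if_splits)
      then show "?f x = 1" by (simp add: cell_wt_def)
    qed
  qed
  also have "\<dots> = prod ?f ?A * prod ?f ?B * prod ?f ?C"
    by (subst prod.union_disjoint, simp, simp, force, subst prod.union_disjoint) (auto split: if_splits)
  also have "prod ?f ?A = t ^ (\<Sum>k\<in>{j<..?n}. of_bool (Ind (\<sigma> (r, k)) (\<sigma> (r, j))))"
    unfolding power_sum
    by (subst prod.reindex, simp add: inj_on_def, rule prod.cong) (simp_all add: cell_wt_def attacks_def)
  also have "prod ?f ?B = (\<Prod>i\<in>{i \<in> {1..<j}. i \<le> ?m}. t ^ of_bool (Ind (upper lam \<sigma> r i) (\<sigma> (r, j))))"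
    by (subst prod.reindex, simp add: inj_on_def, rule prod.cong)
      (simp_all add: cell_wt_def attacks_def upper_def)
  also have "\<dots> = (\<Prod>i\<in>{1..<j}. t ^ of_bool (Ind (upper lam \<sigma> r i) (\<sigma> (r, j))))"
    by (rule prod.mono_neutral_left) (auto simp: upper_def)
  also have "\<dots> = t ^ (\<Sum>i\<in>{1..<j}. of_bool (Ind (upper lam \<sigma> r i) (\<sigma> (r, j))))"
    by (simp only: power_sum)
  also have "prod ?f ?C = (if j \<le> rowlen lam (r + 1) then
       (if Ind (\<sigma> (r + 1, j)) (\<sigma> (r, j)) then q ^ (col lam j - r) else t ^ (rowlen lam r - j)) else 1)"
    by (simp add: cell_wt_def attacks_def)
  finally show ?thesis by (simp add: power_add)
qed

text \<open>The summand - I(a, b) of \<open>qd\<close> does not involve the third cell, so summing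
  over it multiplies each descent by its arm. With these terms moved to the left, both sides are
  natural numbers.\<close>

lemma quinv_plus_arms:
  assumes "is_partition lam"
  shows "quinv lam \<sigma> + (\<Sum>r\<in>{1..height lam}. \<Sum>i\<in>{1..rowlen lam (r + 1)}.
      if Ind (\<sigma> (r + 1, i)) (\<sigma> (r, i)) then rowlen lam r - i else 0) =
    (\<Sum>r\<in>{1..height lam}. \<Sum>j\<in>{1..rowlen lam r}.
      (\<Sum>k\<in>{j<..rowlen lam r}. of_bool (Ind (\<sigma> (r, k)) (\<sigma> (r, j)))) +
      (\<Sum>i\<in>{1..<j}. of_bool (Ind (upper lam \<sigma> r i) (\<sigma> (r, j)))))" (is "_ = (\<Sum>r\<in>_. ?N r)")
proof -
  have row: "quinv_row (rowlen lam r) (upper lam \<sigma> r) (\<lambda>i. \<sigma> (r, i)) +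
      int (\<Sum>i\<in>{1..rowlen lam (r + 1)}. if Ind (\<sigma> (r + 1, i)) (\<sigma> (r, i)) then rowlen lam r - i else 0) = int (?N r)" for r
  proof -
    let ?n = "rowlen lam r" and ?m = "rowlen lam (r + 1)" and ?u = "upper lam \<sigma> r" and ?v = "\<lambda>i. \<sigma> (r, i)"
    have "quinv_row ?n ?u ?v = (\<Sum>(i, j)\<in>col_pairs ?n. of_bool (Ind (?v j) (?v i)))
        + (\<Sum>(i, j)\<in>col_pairs ?n. of_bool (Ind (?u i) (?v j))) - (\<Sum>(i, j)\<in>col_pairs ?n. of_bool (Ind (?u i) (?v i)))"
      unfolding quinv_row_def qd_def by (simp add: sum.distrib sum_subtractf split_def)
    also have "(\<Sum>(i, j)\<in>col_pairs ?n. of_bool (Ind (?u i) (?v i)) :: int) = (\<Sum>i\<in>{1..?n}. if Ind (?u i) (?v i) then int (?n - i) else 0)"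
      unfolding sum_col_pairs by (intro sum.cong) auto
    also have "\<dots> = (\<Sum>i\<in>{1..?m}. if Ind (?u i) (?v i) then int (?n - i) else 0)"
      using rowlen_antimono[of r "r + 1" lam] by (intro sum.mono_neutral_right) (auto simp: upper_def)
    also have "\<dots> = int (\<Sum>i\<in>{1..?m}. if Ind (\<sigma> (r + 1, i)) (\<sigma> (r, i)) then ?n - i else 0)"
      unfolding of_nat_sum by (intro sum.cong) (auto simp: upper_def)
    finally show ?thesis
      unfolding sum_col_pairs[of "\<lambda>i j. of_bool (Ind (?v j) (?v i))"] sum_col_pairs'[of "\<lambda>i j. of_bool (Ind (?u i) (?v j))"]
      by (simp add: sum.distrib)
  qed
  have "int (quinv lam \<sigma>) + (\<Sum>r\<in>{1..height lam}. int (\<Sum>i\<in>{1..rowlen lam (r + 1)}.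
      if Ind (\<sigma> (r + 1, i)) (\<sigma> (r, i)) then rowlen lam r - i else 0)) = (\<Sum>r\<in>{1..height lam}. int (?N r))"
    unfolding quinv_eq_sum_rows[OF assms] sum.distrib[symmetric] row ..
  then have "int (quinv lam \<sigma> + (\<Sum>r\<in>{1..height lam}. \<Sum>i\<in>{1..rowlen lam (r + 1)}.
      if Ind (\<sigma> (r + 1, i)) (\<sigma> (r, i)) then rowlen lam r - i else 0)) = int (\<Sum>r\<in>{1..height lam}. ?N r)"
    by (simp only: of_nat_add of_nat_sum)
  then show ?thesis by (simp only: of_nat_eq_iff)
qed

text \<open>Every pair of vertical neighbours yields its arm exactly once: through
  \<open>quinv_plus_arms\<close> if it is a descent, through \<open>cell_wt\<close> otherwise. The
  total \<open>total_arm\<close> is the same for all fillings.\<close>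

lemma weight_eq_pair_product:
  fixes q t :: "'r::comm_ring_1"
  assumes "is_partition lam"
  shows "t ^ total_arm lam * (q ^ maj lam \<sigma> * t ^ quinv lam \<sigma>) =
    (\<Prod>y\<in>dg lam. \<Prod>x\<in>{x \<in> dg lam. y < x}. cell_wt lam q t y x (Ind (\<sigma> x) (\<sigma> y)))"
proof -
  let ?D = "\<lambda>r i. Ind (\<sigma> (r + 1, i)) (\<sigma> (r, i))"
  let ?N = "\<lambda>r j. (\<Sum>k\<in>{j<..rowlen lam r}. of_bool (Ind (\<sigma> (r, k)) (\<sigma> (r, j)))) +
      (\<Sum>i\<in>{1..<j}. of_bool (Ind (upper lam \<sigma> r i) (\<sigma> (r, j)))) :: nat"
  let ?V = "\<lambda>r j. if ?D r j then q ^ (col lam j - r) else t ^ (rowlen lam r - j)"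
  have "(\<Prod>y\<in>dg lam. \<Prod>x\<in>{x \<in> dg lam. y < x}. cell_wt lam q t y x (Ind (\<sigma> x) (\<sigma> y))) =
    (\<Prod>r\<in>{1..height lam}. \<Prod>j\<in>{1..rowlen lam r}.
      \<Prod>x\<in>{x \<in> dg lam. (r, j) < x}. cell_wt lam q t (r, j) x (Ind (\<sigma> x) (\<sigma> (r, j))))"
    by (subst (1) dg_eq_Sigma[OF assms], subst prod.Sigma) (auto simp: split_def)
  also have "\<dots> = (\<Prod>r\<in>{1..height lam}. \<Prod>j\<in>{1..rowlen lam r}.
      t ^ ?N r j * (if j \<le> rowlen lam (r + 1) then ?V r j else 1))"
  proof (intro prod.cong refl)
    fix r j assume "r \<in> {1..height lam}" "j \<in> {1..rowlen lam r}"
    then show "(\<Prod>x\<in>{x \<in> dg lam. (r, j) < x}. cell_wt lam q t (r, j) x (Ind (\<sigma> x) (\<sigma> (r, j)))) =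
      t ^ ?N r j * (if j \<le> rowlen lam (r + 1) then ?V r j else 1)"
      by (intro prod_later_cells[OF assms]) auto
  qed
  also have "\<dots> = (\<Prod>r\<in>{1..height lam}. (\<Prod>j\<in>{1..rowlen lam r}. t ^ ?N r j) * (\<Prod>j\<in>{1..rowlen lam (r + 1)}. ?V r j))"
  proof (rule prod.cong[OF refl])
    fix r
    have "(\<Prod>j\<in>{1..rowlen lam r}. if j \<le> rowlen lam (r + 1) then ?V r j else 1) =
      (\<Prod>j\<in>{1..rowlen lam (r + 1)}. ?V r j)"
      using rowlen_antimono[of r "r + 1" lam] by (intro prod.mono_neutral_cong_right) auto
    then show "(\<Prod>j\<in>{1..rowlen lam r}. t ^ ?N r j * (if j \<le> rowlen lam (r + 1) then ?V r j else 1)) =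
      (\<Prod>j\<in>{1..rowlen lam r}. t ^ ?N r j) * (\<Prod>j\<in>{1..rowlen lam (r + 1)}. ?V r j)"
      by (simp only: prod.distrib)
  qed
  also have "\<dots> = t ^ (\<Sum>r\<in>{1..height lam}. \<Sum>j\<in>{1..rowlen lam r}. ?N r j) *
      (\<Prod>r\<in>{1..height lam}. \<Prod>j\<in>{1..rowlen lam (r + 1)}. ?V r j)"
    by (simp only: power_sum prod.distrib)
  also have "t ^ (\<Sum>r\<in>{1..height lam}. \<Sum>j\<in>{1..rowlen lam r}. ?N r j) = t ^ quinv lam \<sigma> *
     (\<Prod>r\<in>{1..height lam}. \<Prod>j\<in>{1..rowlen lam (r + 1)}. t ^ (if ?D r j then rowlen lam r - j else 0))"
    unfolding quinv_plus_arms[OF assms, of \<sigma>, symmetric] power_add by (simp only: power_sum)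
  finally have "(\<Prod>y\<in>dg lam. \<Prod>x\<in>{x \<in> dg lam. y < x}. cell_wt lam q t y x (Ind (\<sigma> x) (\<sigma> y))) =
     t ^ quinv lam \<sigma> * ((\<Prod>r\<in>{1..height lam}. \<Prod>j\<in>{1..rowlen lam (r + 1)}.
      t ^ (if ?D r j then rowlen lam r - j else 0) * ?V r j))"
    by (simp only: prod.distrib mult.assoc)
  also have "(\<Prod>r\<in>{1..height lam}. \<Prod>j\<in>{1..rowlen lam (r + 1)}.
      t ^ (if ?D r j then rowlen lam r - j else 0) * ?V r j) =
    (\<Prod>r\<in>{1..height lam}. \<Prod>j\<in>{1..rowlen lam (r + 1)}. q ^ (if ?D r j then col lam j - r else 0) * t ^ (rowlen lam r - j))"
    by (intro prod.cong refl) auto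
  also have "\<dots> = q ^ maj lam \<sigma> * t ^ total_arm lam"
    unfolding maj_eq_sum_rows[OF assms, of \<sigma>] total_arm_def by (simp only: power_sum prod.distrib)
  finally show ?thesis by (simp add: mult_ac)
qed

section \<open>Symmetry in adjacent letters\<close>

lemma Ind_pos: "0 < a \<Longrightarrow> 0 < b \<Longrightarrow> Ind a b \<longleftrightarrow> b < a"
  by (auto simp: Ind_def less2_def)

text \<open>A single filling of content \<open>\<alpha>\<close> forces finite support of
  \<open>\<alpha>\<close>, and the support bounds the letters of all fillings of this
  content.\<close>

lemma finite_fillings:
  assumes "is_partition lam"
  shows "finite {\<sigma>. \<sigma> \<in> dg lam \<rightarrow>\<^sub>E L \<and> has_content lam \<sigma> \<alpha>}"
proof (cases "{\<sigma>. \<sigma> \<in> dg lam \<rightarrow>\<^sub>E L \<and> has_content lam \<sigma> \<alpha>} = {}")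
  case False
  then obtain \<rho> where \<rho>: "has_content lam \<rho> \<alpha>" by auto
  have nz: "\<alpha> j \<noteq> 0 \<longleftrightarrow> (\<exists>u\<in>dg lam. nat \<bar>\<sigma> u\<bar> = j)" if "has_content lam \<sigma> \<alpha>" for \<sigma> j
  proof -
    have "finite {u \<in> dg lam. nat \<bar>\<sigma> u\<bar> = j}" using finite_dg[OF assms] by simp
    then show ?thesis using that by (auto simp: has_content_def)
  qed
  have "{j. \<alpha> j \<noteq> 0} = (\<lambda>u. nat \<bar>\<rho> u\<bar>) ` dg lam" using nz[OF \<rho>] by auto
  then have fin: "finite {j. \<alpha> j \<noteq> 0}" using finite_dg[OF assms] by simp
  have "{\<sigma>. \<sigma> \<in> dg lam \<rightarrow>\<^sub>E L \<and> has_content lam \<sigma> \<alpha>} \<subseteq>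
    dg lam \<rightarrow>\<^sub>E (int ` {j. \<alpha> j \<noteq> 0} \<union> (\<lambda>j. - int j) ` {j. \<alpha> j \<noteq> 0})"
  proof
    fix \<sigma> assume "\<sigma> \<in> {\<sigma>. \<sigma> \<in> dg lam \<rightarrow>\<^sub>E L \<and> has_content lam \<sigma> \<alpha>}"
    then have \<sigma>: "\<sigma> \<in> extensional (dg lam)" "has_content lam \<sigma> \<alpha>" by (auto simp: PiE_def)
    have "\<sigma> u \<in> int ` {j. \<alpha> j \<noteq> 0} \<union> (\<lambda>j. - int j) ` {j. \<alpha> j \<noteq> 0}" if "u \<in> dg lam" for u
    proof -
      have "\<alpha> (nat \<bar>\<sigma> u\<bar>) \<noteq> 0" using nz[OF \<sigma>(2), of "nat \<bar>\<sigma> u\<bar>"] that by auto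
      moreover have "\<sigma> u = int (nat \<bar>\<sigma> u\<bar>) \<or> \<sigma> u = - int (nat \<bar>\<sigma> u\<bar>)" by auto
      ultimately show ?thesis by blast
    qed
    then show "\<sigma> \<in> dg lam \<rightarrow>\<^sub>E (int ` {j. \<alpha> j \<noteq> 0} \<union> (\<lambda>j. - int j) ` {j. \<alpha> j \<noteq> 0})"
      using \<sigma>(1) by (auto simp: PiE_def)
  qed
  moreover have "finite (dg lam \<rightarrow>\<^sub>E (int ` {j. \<alpha> j \<noteq> 0} \<union> (\<lambda>j. - int j) ` {j. \<alpha> j \<noteq> 0}))"
    using fin finite_dg[OF assms] by (intro finite_PiE) auto
  ultimately show ?thesis using finite_subset by blast
next
  case True
  then show ?thesis by (simp only: finite.emptyI)
qed

text \<open>A filling is encoded by the filling in which a + 1 is merged into a, together with the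
  set \<open>S\<close> of cells that carried a + 1.\<close>

definition paint :: "nat \<Rightarrow> (nat \<times> nat \<Rightarrow> int) \<Rightarrow> (nat \<times> nat) set \<Rightarrow> nat \<times> nat \<Rightarrow> int" where
  "paint a \<sigma> S = (\<lambda>u. if u \<in> S then int a + 1 else \<sigma> u)"

text \<open>No letter lies strictly between a and a + 1, so raising the cells of \<open>S\<close>
  changes only comparisons inside the set \<open>X\<close> of cells carrying a; there the comparison
  is the flag of \<open>pair_wt\<close>.\<close>

lemma pair_product_paint:
  fixes K :: "nat \<times> nat \<Rightarrow> nat \<times> nat \<Rightarrow> bool \<Rightarrow> 'r::comm_ring_1"
  assumes fin: "finite D" and a: "0 < a" and pos: "\<And>u. u \<in> D \<Longrightarrow> 0 < \<sigma> u \<and> \<sigma> u \<noteq> int a + 1"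
    and X: "X = {u \<in> D. \<sigma> u = int a}" and S: "S \<subseteq> X"
  shows "(\<Prod>y\<in>D. \<Prod>x\<in>{x \<in> D. y < x}. K y x (Ind (paint a \<sigma> S x) (paint a \<sigma> S y))) =
    (\<Prod>y\<in>D. \<Prod>x\<in>{x \<in> D. y < x}. if y \<in> X \<and> x \<in> X then 1 else K y x (Ind (\<sigma> x) (\<sigma> y))) * pair_wt K X S"
proof -
  have Ind: "K y x (Ind (paint a \<sigma> S x) (paint a \<sigma> S y)) =
     (if y \<in> X \<and> x \<in> X then 1 else K y x (Ind (\<sigma> x) (\<sigma> y))) *
     (if y \<in> X then if x \<in> X then K y x (x \<in> S \<and> y \<notin> S) else 1 else 1)" if "y \<in> D" "x \<in> D" for y x
  proof -
    have "0 < \<sigma> x \<and> \<sigma> x \<noteq> int a + 1" "0 < \<sigma> y \<and> \<sigma> y \<noteq> int a + 1" using pos that by auto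
    moreover have "x \<in> S \<Longrightarrow> \<sigma> x = int a" "y \<in> S \<Longrightarrow> \<sigma> y = int a" using S X by auto
    moreover have "x \<in> X \<longleftrightarrow> \<sigma> x = int a" "y \<in> X \<longleftrightarrow> \<sigma> y = int a" using X that by auto
    ultimately have "Ind (paint a \<sigma> S x) (paint a \<sigma> S y) =
      (if y \<in> X \<and> x \<in> X then x \<in> S \<and> y \<notin> S else Ind (\<sigma> x) (\<sigma> y))"
      by (auto simp: paint_def Ind_pos)
    then show ?thesis by simp
  qed
  have "(\<Prod>y\<in>D. \<Prod>x\<in>{x \<in> D. y < x}. if y \<in> X then if x \<in> X then K y x (x \<in> S \<and> y \<notin> S) else 1 else 1) =
    (\<Prod>y\<in>D. if y \<in> X then \<Prod>x\<in>{x \<in> D. y < x}. if x \<in> X then K y x (x \<in> S \<and> y \<notin> S) else 1 else 1)"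
    by (intro prod.cong refl) auto
  also have "\<dots> = (\<Prod>y\<in>X. \<Prod>x\<in>{x \<in> D. y < x}. if x \<in> X then K y x (x \<in> S \<and> y \<notin> S) else 1)"
    using fin X by (intro prod.mono_neutral_cong_right) auto
  also have "\<dots> = pair_wt K X S"
    unfolding pair_wt_def using fin X by (intro prod.cong refl prod.mono_neutral_cong_right) auto
  finally have "(\<Prod>y\<in>D. \<Prod>x\<in>{x \<in> D. y < x}. if y \<in> X then if x \<in> X then K y x (x \<in> S \<and> y \<notin> S) else 1 else 1)
    = pair_wt K X S" .
  moreover have "(\<Prod>y\<in>D. \<Prod>x\<in>{x \<in> D. y < x}. K y x (Ind (paint a \<sigma> S x) (paint a \<sigma> S y))) =
    (\<Prod>y\<in>D. \<Prod>x\<in>{x \<in> D. y < x}. (if y \<in> X \<and> x \<in> X then 1 else K y x (Ind (\<sigma> x) (\<sigma> y))) *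
     (if y \<in> X then if x \<in> X then K y x (x \<in> S \<and> y \<notin> S) else 1 else 1))"
    using Ind by (intro prod.cong refl) auto
  ultimately show ?thesis by (simp only: prod.distrib)
qed

lemma sum_fillings_paint:
  fixes f :: "(nat \<times> nat \<Rightarrow> int) \<Rightarrow> 'r::comm_ring_1"
  assumes lam: "is_partition lam" and a: "0 < a"
  shows "(\<Sum>\<sigma>\<in>{\<sigma>. \<sigma> \<in> dg lam \<rightarrow>\<^sub>E {a. 0 < a} \<and> has_content lam \<sigma> \<alpha>}. f \<sigma>) =
   (\<Sum>\<sigma>\<in>{\<sigma>. \<sigma> \<in> dg lam \<rightarrow>\<^sub>E {a. 0 < a} \<and> has_content lam \<sigma> (\<alpha>(a := \<alpha> a + \<alpha> (a + 1), a + 1 := 0))}.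
     \<Sum>S\<in>{S. S \<subseteq> {u \<in> dg lam. \<sigma> u = int a} \<and> card S = \<alpha> (a + 1)}. f (paint a \<sigma> S))"
proof -
  let ?P = "\<lambda>\<alpha>. {\<sigma>. \<sigma> \<in> dg lam \<rightarrow>\<^sub>E {a. 0 < a} \<and> has_content lam \<sigma> \<alpha>}"
  let ?\<beta> = "\<alpha>(a := \<alpha> a + \<alpha> (a + 1), a + 1 := 0)"
  let ?N = "\<lambda>\<sigma>. {S. S \<subseteq> {u \<in> dg lam. \<sigma> u = int a} \<and> card S = \<alpha> (a + 1)}"
  have fin: "finite (dg lam)" by (rule finite_dg[OF lam])
  have nat_eq: "nat \<bar>x\<bar> = j \<longleftrightarrow> x = int j" if "0 < x" for x j using that by auto
  have content: "has_content lam \<sigma> \<gamma> \<longleftrightarrow> (\<forall>j. \<gamma> j = card {u \<in> dg lam. \<sigma> u = int j})"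
    if "\<sigma> \<in> dg lam \<rightarrow>\<^sub>E {a. 0 < a}" for \<sigma> \<gamma>
  proof -
    have "{u \<in> dg lam. nat \<bar>\<sigma> u\<bar> = j} = {u \<in> dg lam. \<sigma> u = int j}" for j
    proof (rule Collect_cong)
      fix u
      show "u \<in> dg lam \<and> nat \<bar>\<sigma> u\<bar> = j \<longleftrightarrow> u \<in> dg lam \<and> \<sigma> u = int j"
        using PiE_mem[OF that, of u] nat_eq[of "\<sigma> u" j] by auto
    qed
    then show ?thesis by (simp add: has_content_def)
  qed
  have "(\<Sum>\<sigma>\<in>?P ?\<beta>. \<Sum>S\<in>?N \<sigma>. f (paint a \<sigma> S)) = (\<Sum>(\<sigma>, S)\<in>Sigma (?P ?\<beta>) ?N. f (paint a \<sigma> S))"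
    using finite_fillings[OF lam] fin by (subst sum.Sigma) auto
  also have "\<dots> = (\<Sum>\<sigma>\<in>?P \<alpha>. f \<sigma>)"
  proof (rule sum.reindex_bij_witness[where j = "\<lambda>(\<sigma>, S). paint a \<sigma> S" and
      i = "\<lambda>\<sigma>. (restrict (\<lambda>u. if \<sigma> u = int a + 1 then int a else \<sigma> u) (dg lam), {u \<in> dg lam. \<sigma> u = int a + 1})"], goal_cases)
    case (1 x)
    then obtain \<sigma> S where x: "x = (\<sigma>, S)" and \<sigma>: "\<sigma> \<in> dg lam \<rightarrow>\<^sub>E {a. 0 < a}" "has_content lam \<sigma> ?\<beta>"
      and S: "S \<subseteq> {u \<in> dg lam. \<sigma> u = int a}" by auto
    have "card {u \<in> dg lam. \<sigma> u = int (a + 1)} = 0"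
      using \<sigma>(2) unfolding content[OF \<sigma>(1)] by (metis fun_upd_same)
    then have "{u \<in> dg lam. \<sigma> u = int (a + 1)} = {}" using fin by simp
    then have no: "\<sigma> u \<noteq> int a + 1" if "u \<in> dg lam" for u
      using that by (metis (mono_tags, lifting) empty_iff mem_Collect_eq of_nat_1 of_nat_add)
    have "restrict (\<lambda>u. if paint a \<sigma> S u = int a + 1 then int a else paint a \<sigma> S u) (dg lam) = \<sigma>"
    proof
      fix u
      show "restrict (\<lambda>u. if paint a \<sigma> S u = int a + 1 then int a else paint a \<sigma> S u) (dg lam) u = \<sigma> u"
        using no[of u] S \<sigma>(1) by (auto simp: paint_def PiE_def extensional_def)
    qed
    moreover have "{u \<in> dg lam. paint a \<sigma> S u = int a + 1} = S"
      using S no by (auto simp: paint_def)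
    ultimately show ?case by (simp only: x prod.case)
  next
    case (2 x)
    then obtain \<sigma> S where x: "x = (\<sigma>, S)" and \<sigma>: "\<sigma> \<in> dg lam \<rightarrow>\<^sub>E {a. 0 < a}" "has_content lam \<sigma> ?\<beta>"
      and S: "S \<subseteq> {u \<in> dg lam. \<sigma> u = int a}" "card S = \<alpha> (a + 1)" by auto
    have p: "paint a \<sigma> S \<in> dg lam \<rightarrow>\<^sub>E {a. 0 < a}"
      using \<sigma>(1) S a by (auto simp: paint_def PiE_def extensional_def Pi_def)
    have c: "card {u \<in> dg lam. \<sigma> u = int j} = ?\<beta> j" for j using \<sigma>(2) unfolding content[OF \<sigma>(1)] by auto
    have finS: "finite S" using S fin finite_subset by fastforce
    have "\<alpha> j = card {u \<in> dg lam. paint a \<sigma> S u = int j}" for j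
    proof (cases "j = a \<or> j = a + 1")
      case True
      then show ?thesis
      proof
        assume j: "j = a"
        have "{u \<in> dg lam. paint a \<sigma> S u = int j} = {u \<in> dg lam. \<sigma> u = int a} - S"
          using S by (auto simp: paint_def j)
        then have "card {u \<in> dg lam. paint a \<sigma> S u = int j} = card {u \<in> dg lam. \<sigma> u = int a} - card S"
          using S finS by (simp add: card_Diff_subset)
        then show ?thesis using c[of a] S j by simp
      next
        assume j: "j = a + 1"
        have "{u \<in> dg lam. \<sigma> u = int (a + 1)} = {}" using c[of "a + 1"] fin by simp
        then have "{u \<in> dg lam. paint a \<sigma> S u = int j} = S"
          using S by (auto simp: paint_def j add.commute)
        then show ?thesis using S j by simp
      qed
    next
      case False
      then have "{u \<in> dg lam. paint a \<sigma> S u = int j} = {u \<in> dg lam. \<sigma> u = int j}"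
        using S by (auto simp: paint_def)
      then show ?thesis using False c[of j] by simp
    qed
    then show ?case using p content[OF p] by (simp add: x)
  next
    case (3 \<sigma>)
    then have "\<sigma> \<in> dg lam \<rightarrow>\<^sub>E {a. 0 < a}" by simp
    then show ?case by (auto simp: paint_def PiE_def extensional_def)
  next
    case (4 \<sigma>)
    then have \<sigma>: "\<sigma> \<in> dg lam \<rightarrow>\<^sub>E {a. 0 < a}" "has_content lam \<sigma> \<alpha>" by auto
    let ?m = "restrict (\<lambda>u. if \<sigma> u = int a + 1 then int a else \<sigma> u) (dg lam)"
    have m: "?m \<in> dg lam \<rightarrow>\<^sub>E {a. 0 < a}" using \<sigma>(1) a by (auto simp: PiE_def Pi_def)
    have c: "card {u \<in> dg lam. \<sigma> u = int j} = \<alpha> j" for j using \<sigma>(2) unfolding content[OF \<sigma>(1)] by auto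
    have "?\<beta> j = card {u \<in> dg lam. ?m u = int j}" for j
    proof (cases "j = a \<or> j = a + 1")
      case True
      then show ?thesis
      proof
        assume j: "j = a"
        have "{u \<in> dg lam. ?m u = int j} = {u \<in> dg lam. \<sigma> u = int a} \<union> {u \<in> dg lam. \<sigma> u = int (a + 1)}"
          by (auto simp: j)
        moreover have "card ({u \<in> dg lam. \<sigma> u = int a} \<union> {u \<in> dg lam. \<sigma> u = int (a + 1)}) = \<alpha> a + \<alpha> (a + 1)"
          using fin unfolding c[symmetric] by (intro card_Un_disjoint) auto
        ultimately show ?thesis by (simp add: j)
      next
        assume j: "j = a + 1"
        have "{u \<in> dg lam. ?m u = int j} = {}" by (auto simp: j)
        then show ?thesis by (simp only: j) simp
      qed
    next
      case False
      then have "{u \<in> dg lam. ?m u = int j} = {u \<in> dg lam. \<sigma> u = int j}" by auto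
      then show ?thesis using False c[of j] by simp
    qed
    moreover have "{u \<in> dg lam. \<sigma> u = int a + 1} \<subseteq> {u \<in> dg lam. ?m u = int a}" by auto
    moreover have "card {u \<in> dg lam. \<sigma> u = int a + 1} = \<alpha> (a + 1)" using c[of "a + 1"] by (simp add: add.commute)
    ultimately show ?case using m content[OF m] by simp
  qed auto
  finally show ?thesis ..
qed

text \<open>The two contents have the same merged content and differ only in the prescribed size of
  \<open>S\<close>. For each merged filling the two sums over \<open>S\<close> agree by the symmetry
  of two-colourings; the common power of t is cancelled at the end.\<close>

lemma C_coeff_transpose_idom:
  fixes q t :: "'r::idom"
  assumes lam: "is_partition lam" and a: "0 < a" and t: "t \<noteq> 0"
  shows "C_coeff lam q t (\<alpha> \<circ> transpose a (a + 1)) = C_coeff lam q t \<alpha>"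
proof -
  let ?K = "cell_wt lam q t" and ?D = "dg lam"
  let ?w = "\<lambda>\<sigma>. \<Prod>y\<in>?D. \<Prod>x\<in>{x \<in> ?D. y < x}. ?K y x (Ind (\<sigma> x) (\<sigma> y))"
  let ?P = "\<lambda>\<alpha>. {\<sigma>. \<sigma> \<in> dg lam \<rightarrow>\<^sub>E {a. 0 < a} \<and> has_content lam \<sigma> \<alpha>}"
  let ?\<beta> = "\<lambda>\<alpha>::nat \<Rightarrow> nat. \<alpha>(a := \<alpha> a + \<alpha> (a + 1), a + 1 := 0)"
  let ?X = "\<lambda>\<sigma>. {u \<in> dg lam. \<sigma> u = int a}"
  let ?\<alpha>' = "\<alpha> \<circ> transpose a (a + 1)"
  have fin: "finite ?D" by (rule finite_dg[OF lam])
  have C: "t ^ total_arm lam * C_coeff lam q t \<gamma> =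
    (\<Sum>\<sigma>\<in>?P (?\<beta> \<gamma>). \<Sum>S\<in>{S. S \<subseteq> ?X \<sigma> \<and> card S = \<gamma> (a + 1)}. ?w (paint a \<sigma> S))" for \<gamma>
  proof -
    have "t ^ total_arm lam * C_coeff lam q t \<gamma> = (\<Sum>\<sigma>\<in>?P \<gamma>. ?w \<sigma>)"
      unfolding C_coeff_def sum_distrib_left weight_eq_pair_product[OF lam] ..
    also have "\<dots> = (\<Sum>\<sigma>\<in>?P (?\<beta> \<gamma>). \<Sum>S\<in>{S. S \<subseteq> ?X \<sigma> \<and> card S = \<gamma> (a + 1)}. ?w (paint a \<sigma> S))"
      by (rule sum_fillings_paint[OF lam a])
    finally show ?thesis .
  qed
  have \<beta>: "?\<beta> ?\<alpha>' = ?\<beta> \<alpha>" by (auto simp: fun_eq_iff transpose_def)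
  have \<alpha>': "?\<alpha>' (a + 1) = \<alpha> a" by simp
  have "(\<Sum>S\<in>{S. S \<subseteq> ?X \<sigma> \<and> card S = \<alpha> a}. ?w (paint a \<sigma> S)) =
      (\<Sum>S\<in>{S. S \<subseteq> ?X \<sigma> \<and> card S = \<alpha> (a + 1)}. ?w (paint a \<sigma> S))" if \<sigma>: "\<sigma> \<in> ?P (?\<beta> \<alpha>)" for \<sigma>
  proof -
    have pos: "0 < \<sigma> u" if "u \<in> ?D" for u using \<sigma> that by auto
    have c: "?\<beta> \<alpha> j = card {u \<in> ?D. \<sigma> u = int j}" for j
    proof -
      have "{u \<in> ?D. nat \<bar>\<sigma> u\<bar> = j} = {u \<in> ?D. \<sigma> u = int j}" using pos by force
      moreover have "?\<beta> \<alpha> j = card {u \<in> ?D. nat \<bar>\<sigma> u\<bar> = j}" using \<sigma> by (simp add: has_content_def)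
      ultimately show ?thesis by simp
    qed
    have "{u \<in> ?D. \<sigma> u = int (a + 1)} = {}" using c[of "a + 1"] fin by simp
    then have no: "\<sigma> u \<noteq> int a + 1" if "u \<in> ?D" for u
      using that by (metis (mono_tags, lifting) empty_iff mem_Collect_eq of_nat_1 of_nat_add)
    have card: "card (?X \<sigma>) = \<alpha> a + \<alpha> (a + 1)" using c[of a] by simp
    let ?c = "\<Prod>y\<in>?D. \<Prod>x\<in>{x \<in> ?D. y < x}. if y \<in> ?X \<sigma> \<and> x \<in> ?X \<sigma> then 1 else ?K y x (Ind (\<sigma> x) (\<sigma> y))"
    have f: "?w (paint a \<sigma> S) = ?c * pair_wt ?K (?X \<sigma>) S" if "S \<subseteq> ?X \<sigma>" for S
      using pos no by (intro pair_product_paint[OF fin a _ refl that]) auto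
    have "(\<Sum>S\<in>{S. S \<subseteq> ?X \<sigma> \<and> card S = k}. ?w (paint a \<sigma> S)) =
        ?c * (\<Sum>S\<in>{S. S \<subseteq> ?X \<sigma> \<and> card S = k}. pair_wt ?K (?X \<sigma>) S)" for k
      unfolding sum_distrib_left using f by (intro sum.cong) auto
    moreover have "(\<Sum>S\<in>{S. S \<subseteq> ?X \<sigma> \<and> card S = \<alpha> a}. pair_wt ?K (?X \<sigma>) S) =
        (\<Sum>S\<in>{S. S \<subseteq> ?X \<sigma> \<and> card S = \<alpha> (a + 1)}. pair_wt ?K (?X \<sigma>) S)"
    proof (rule colour_sum_card_symmetric[where t = t])
      fix y z x b assume "y < z" "z < x" "?K y x True \<noteq> ?K y x False"
      then show "?K y z b = (if b then t else 1) \<and> ?K z x b = (if b then t else 1)"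
        using cell_wt_between by blast
    qed (use fin card in simp_all)
    ultimately show ?thesis by simp
  qed
  then have "t ^ total_arm lam * C_coeff lam q t ?\<alpha>' = t ^ total_arm lam * C_coeff lam q t \<alpha>"
    unfolding C \<beta> unfolding \<alpha>' by (rule sum.cong[OF refl])
  then show ?thesis using t by simp
qed

text \<open>Replacing \<open>t\<close> by an indeterminate covers the case \<open>t = 0\<close>.\<close>
lemma C_coeff_transpose:
  fixes q t :: "'r::idom"
  assumes "is_partition lam" and "0 < a"
  shows "C_coeff lam q t (\<alpha> \<circ> transpose a (a + 1)) = C_coeff lam q t \<alpha>"
proof -
  have "C_coeff lam q t \<gamma> = poly (C_coeff lam [:q:] [:0, 1:] \<gamma>) t" for \<gamma>
    by (simp add: C_coeff_def poly_sum)
  then show ?thesis using C_coeff_transpose_idom[OF assms, of "[:0, 1:] :: 'r poly" "[:q:]" \<alpha>] by simp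
qed

section \<open>Symmetric functions and power sums\<close>

definition exponent :: "nat \<Rightarrow> (nat \<Rightarrow> nat) \<Rightarrow> bool" where
  "exponent n \<alpha> \<longleftrightarrow> \<alpha> 0 = 0 \<and> finite {j. \<alpha> j \<noteq> 0} \<and> (\<Sum>j\<in>{j. \<alpha> j \<noteq> 0}. \<alpha> j) = n"

definition exp_type :: "(nat \<Rightarrow> nat) \<Rightarrow> nat multiset" where
  "exp_type \<alpha> = image_mset \<alpha> (mset_set {j. \<alpha> j \<noteq> 0})"

text \<open>Homogeneous of degree \<open>n\<close> and invariant under exchanging adjacent
  variables; index 0 is not a variable, hence 0 < a.\<close>

definition symmetric :: "nat \<Rightarrow> ((nat \<Rightarrow> nat) \<Rightarrow> 'a::zero) \<Rightarrow> bool" where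
  "symmetric n f \<longleftrightarrow> (\<forall>\<alpha>. f \<alpha> \<noteq> 0 \<longrightarrow> exponent n \<alpha>) \<and>
    (\<forall>\<alpha> a. 0 < a \<longrightarrow> f (\<alpha> \<circ> transpose a (a + 1)) = f \<alpha>)"

definition part_exp :: "nat list \<Rightarrow> nat \<Rightarrow> nat" where
  "part_exp mu j = (if 1 \<le> j \<and> j \<le> length mu then mu ! (j - 1) else 0)"

lemma symmetric_adjacent:
  assumes "symmetric n f" "0 < a"
  shows "f (\<alpha> \<circ> transpose a (a + 1)) = f \<alpha>"
proof -
  have "\<forall>\<alpha> a. 0 < a \<longrightarrow> f (\<alpha> \<circ> transpose a (a + 1)) = f \<alpha>"
    using assms(1) unfolding symmetric_def by (rule conjunct2)
  then show ?thesis using assms(2) by (elim allE impE)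
qed

lemma symmetric_transpose:
  assumes f: "symmetric n f" and ab: "0 < a" "a < b"
  shows "f (\<alpha> \<circ> transpose a b) = f \<alpha>"
proof -
  have "f (\<alpha> \<circ> transpose a (a + 1 + k)) = f \<alpha>" for k \<alpha>
  proof (induction k arbitrary: \<alpha>)
    case 0
    have "f (\<alpha> \<circ> transpose a (a + 1)) = f \<alpha>" by (rule symmetric_adjacent[OF f ab(1)])
    then show ?case by (simp only: add_0_right)
  next
    case (Suc k)
    let ?b = "a + 1 + k"
    have adj: "f (\<beta> \<circ> transpose ?b (?b + 1)) = f \<beta>" for \<beta>
      by (rule symmetric_adjacent[OF f]) simp
    have eq: "transpose a (?b + 1) = transpose ?b (?b + 1) \<circ> transpose a ?b \<circ> transpose ?b (?b + 1)"
      using transpose_comp_triple[of "?b + 1" a ?b] by (simp add: transpose_commute)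
    have "f (\<alpha> \<circ> transpose a (?b + 1)) = f (((\<alpha> \<circ> transpose ?b (?b + 1)) \<circ> transpose a ?b) \<circ> transpose ?b (?b + 1))"
      by (simp only: eq comp_assoc)
    also have "\<dots> = f \<alpha>" by (simp only: adj Suc.IH)
    finally show ?case by (simp only: add_Suc_right Suc_eq_plus1 add.assoc)
  qed
  moreover have "a + 1 + (b - a - 1) = b" using ab by simp
  ultimately show ?thesis by metis
qed

lemma symmetric_permutes:
  assumes f: "symmetric n f" and p: "p permutes {1..N}"
  shows "f (\<alpha> \<circ> p) = f \<alpha>"
  using p finite_atLeastAtMost[of 1 N]
proof (induction p arbitrary: \<alpha> rule: permutes_induct)
  case id
  then show ?case by simp
next
  case (swap a b p)
  have "f (\<alpha> \<circ> transpose a b) = f \<alpha>"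
  proof (cases a b rule: linorder_cases)
    case less
    then show ?thesis using symmetric_transpose[OF f, of a b \<alpha>] swap by simp
  next
    case greater
    then show ?thesis using symmetric_transpose[OF f, of b a \<alpha>] swap by (simp add: transpose_commute)
  qed (use swap in simp)
  then show ?case using swap.IH[of "\<alpha> \<circ> transpose a b"] by (simp only: comp_assoc)
qed

text \<open>Two finitely supported vectors with the same nonzero exponents, padded with zeros on a
  common range {1..N}, differ by a permutation of that range.\<close>

lemma symmetric_exp_type:
  assumes f: "symmetric n f" and fin: "finite {j. \<alpha> j \<noteq> 0}" "finite {j. \<beta> j \<noteq> 0}" and z: "\<alpha> 0 = 0" "\<beta> 0 = 0"
    and eq: "exp_type \<alpha> = exp_type \<beta>"
  shows "f \<alpha> = f \<beta>"
proof -
  define N where "N = Max ({j. \<alpha> j \<noteq> 0} \<union> {j. \<beta> j \<noteq> 0} \<union> {0})"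
  have N: "\<alpha> j \<noteq> 0 \<or> \<beta> j \<noteq> 0 \<Longrightarrow> j \<in> {1..N}" for j
    unfolding N_def using fin z by (auto intro!: Max_ge simp: Suc_le_eq intro: gr0I)
  have dec: "image_mset \<gamma> (mset_set {1..N}) = exp_type \<gamma> + replicate_mset (N - size (exp_type \<gamma>)) 0"
    if g: "\<And>j. \<gamma> j \<noteq> 0 \<Longrightarrow> j \<in> {1..N}" for \<gamma>
  proof -
    let ?S = "{j. \<gamma> j \<noteq> 0}"
    have S: "?S \<subseteq> {1..N}" using g by blast
    have fS: "finite ?S" by (rule finite_subset[OF S]) simp
    have "mset_set {1..N} = mset_set (?S \<union> ({1..N} - ?S))" using S by (simp add: Un_absorb1)
    also have "\<dots> = mset_set ?S + mset_set ({1..N} - ?S)" by (rule mset_set_Union) (use fS in auto)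
    finally have "image_mset \<gamma> (mset_set {1..N}) = exp_type \<gamma> + image_mset \<gamma> (mset_set ({1..N} - ?S))"
      by (simp add: exp_type_def)
    also have "image_mset \<gamma> (mset_set ({1..N} - ?S)) = image_mset (\<lambda>_. 0) (mset_set ({1..N} - ?S))"
      by (rule image_mset_cong) auto
    also have "\<dots> = replicate_mset (card ({1..N} - ?S)) 0" by (simp add: image_mset_const_eq)
    also have "card ({1..N} - ?S) = N - size (exp_type \<gamma>)"
      using S fS by (simp add: card_Diff_subset exp_type_def)
    finally show ?thesis .
  qed
  have "image_mset \<alpha> (mset_set {1..N}) = image_mset \<beta> (mset_set {1..N})"
    using dec[of \<alpha>] dec[of \<beta>] N eq by auto
  then obtain p where p: "p permutes {1..N}" "\<forall>x\<in>{1..N}. \<alpha> x = \<beta> (p x)"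
    using image_mset_eq_implies_permutes[of "{1..N}" \<alpha> \<beta>] by auto
  have "\<alpha> = \<beta> \<circ> p"
  proof
    fix x show "\<alpha> x = (\<beta> \<circ> p) x"
    proof (cases "x \<in> {1..N}")
      case False
      then have "p x = x" using p(1) by (meson permutes_not_in)
      moreover have "\<alpha> x = 0 \<and> \<beta> x = 0" using N[of x] False by blast
      ultimately show ?thesis by simp
    qed (use p in simp)
  qed
  then show ?thesis using symmetric_permutes[OF f p(1), of \<beta>] by simp
qed

section \<open>Partitions and monomial symmetric functions\<close>

lemma finite_partitions_of: "finite (partitions_of n)"
proof (rule finite_subset)
  show "partitions_of n \<subseteq> {xs. set xs \<subseteq> {..n} \<and> length xs \<le> n}"
  proof
    fix mu assume "mu \<in> partitions_of n"
    then have mu: "\<forall>x\<in>set mu. 0 < x" "sum_list mu = n" by (auto simp: partitions_of_def is_partition_def)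
    have "length xs \<le> sum_list xs" if "\<forall>x\<in>set xs. 0 < x" for xs :: "nat list"
      using that by (induction xs) auto
    then show "mu \<in> {xs. set xs \<subseteq> {..n} \<and> length xs \<le> n}" using mu member_le_sum_list by fastforce
  qed
qed (simp add: finite_lists_length_le)

lemma partition_mset_unique:
  assumes "is_partition mu" "is_partition nu" "mset mu = mset nu"
  shows "mu = nu"
proof -
  have "sorted (rev xs)" if "is_partition xs" for xs
    using that unfolding is_partition_def sorted_wrt_rev by (auto simp: sorted_wrt_rev)
  then have "rev mu = rev nu" using assms by (metis mset_rev properties_for_sort)
  then show ?thesis by simp
qed

lemma exponent_partition:
  assumes "exponent n \<alpha>"
  obtains mu where "mu \<in> partitions_of n" "mset mu = exp_type \<alpha>"
proof -
  let ?mu = "rev (sorted_list_of_multiset (exp_type \<alpha>))"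
  have "sorted_wrt (\<ge>) ?mu" by (simp add: sorted_wrt_rev)
  moreover have "\<forall>x\<in>set ?mu. 0 < x" using assms by (auto simp: exp_type_def exponent_def)
  moreover have "sum_list ?mu = n"
  proof -
    have "sum_list ?mu = sum_mset (exp_type \<alpha>)" by (metis mset_rev mset_sorted_list_of_multiset sum_mset_sum_list)
    then show ?thesis using assms by (simp add: exp_type_def exponent_def sum_unfold_sum_mset)
  qed
  ultimately have "?mu \<in> partitions_of n" by (simp add: partitions_of_def is_partition_def)
  then show ?thesis using that by simp
qed

lemma part_exp_props:
  assumes "mu \<in> partitions_of n"
  shows "{j. part_exp mu j \<noteq> 0} = {1..length mu}" "exp_type (part_exp mu) = mset mu" "exponent n (part_exp mu)"
proof -
  have mu: "\<forall>x\<in>set mu. 0 < x" "sum_list mu = n" using assms by (auto simp: partitions_of_def is_partition_def)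
  have "mu ! (j - 1) \<noteq> 0" if "1 \<le> j" "j \<le> length mu" for j
  proof -
    have "mu ! (j - 1) \<in> set mu" using that by (intro nth_mem) auto
    then show ?thesis using mu by auto
  qed
  then show S: "{j. part_exp mu j \<noteq> 0} = {1..length mu}" by (auto simp: part_exp_def split: if_splits)
  have "map (part_exp mu) [1..<length mu + 1] = mu"
    by (rule nth_equalityI) (auto simp: part_exp_def simp del: upt_Suc)
  moreover have "mset_set {1..length mu} = mset [1..<length mu + 1]"
    by (metis atLeastLessThanSuc_atLeastAtMost Suc_eq_plus1 mset_upt)
  ultimately show t: "exp_type (part_exp mu) = mset mu" unfolding exp_type_def S by (metis mset_map)
  have "(\<Sum>j\<in>{j. part_exp mu j \<noteq> 0}. part_exp mu j) = sum_mset (exp_type (part_exp mu))"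
    by (simp add: exp_type_def sum_unfold_sum_mset)
  then show "exponent n (part_exp mu)" unfolding exponent_def using S t mu by (simp add: part_exp_def sum_mset_sum_list)
qed

lemma mono_coeff_exponent:
  assumes "mu \<in> partitions_of n"
  shows "mono_coeff mu \<alpha> = (if exponent n \<alpha> \<and> exp_type \<alpha> = mset mu then 1 else 0)"
proof -
  have "(\<Sum>j\<in>{j. \<alpha> j \<noteq> 0}. \<alpha> j) = n" if "exp_type \<alpha> = mset mu"
  proof -
    have "(\<Sum>j\<in>{j. \<alpha> j \<noteq> 0}. \<alpha> j) = sum_mset (exp_type \<alpha>)" by (simp add: exp_type_def sum_unfold_sum_mset)
    then show ?thesis using that assms by (simp add: partitions_of_def sum_mset_sum_list)
  qed
  then show ?thesis by (auto simp: mono_coeff_def exponent_def exp_type_def)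
qed

lemma symmetric_mono_expansion:
  fixes f :: "(nat \<Rightarrow> nat) \<Rightarrow> 'a::comm_ring_1"
  assumes f: "symmetric n f"
  shows "f \<alpha> = (\<Sum>mu\<in>partitions_of n. f (part_exp mu) * mono_coeff mu \<alpha>)"
proof (cases "exponent n \<alpha>")
  case True
  obtain nu where nu: "nu \<in> partitions_of n" "mset nu = exp_type \<alpha>" using exponent_partition[OF True] .
  have "mono_coeff mu \<alpha> = (if mu = nu then 1 else (0::'a))" if "mu \<in> partitions_of n" for mu
  proof -
    have "mset mu = exp_type \<alpha> \<longleftrightarrow> mu = nu"
      using that nu partition_mset_unique[of mu nu] by (auto simp: partitions_of_def)
    then show ?thesis unfolding mono_coeff_exponent[OF that] using True by auto
  qed
  then have "(\<Sum>mu\<in>partitions_of n. f (part_exp mu) * mono_coeff mu \<alpha>) = (\<Sum>mu\<in>partitions_of n. if mu = nu then f (part_exp mu) else 0)"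
    by (intro sum.cong) auto
  also have "\<dots> = f (part_exp nu)" using nu(1) finite_partitions_of by simp
  also have "\<dots> = f \<alpha>"
    using part_exp_props[OF nu(1)] True nu(2)
    by (intro symmetric_exp_type[OF f]) (auto simp: exponent_def)
  finally show ?thesis ..
next
  case False
  then have "f \<alpha> = 0" using f by (auto simp: symmetric_def)
  moreover have "(\<Sum>mu\<in>partitions_of n. f (part_exp mu) * mono_coeff mu \<alpha>) = 0"
    by (rule sum.neutral) (simp add: mono_coeff_exponent False)
  ultimately show ?thesis by simp
qed

section \<open>Power sums span the symmetric functions\<close>

lemma psum_coeff_obtain:
  assumes "psum_coeff mu \<alpha> \<noteq> 0"
  obtains phi where "length phi = length mu" "\<forall>x\<in>set phi. 1 \<le> x"
    "\<And>j. \<alpha> j = (\<Sum>i\<in>{i. i < length mu \<and> phi ! i = j}. mu ! i)"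
proof -
  have "{phi. length phi = length mu \<and> (\<forall>x\<in>set phi. 1 \<le> x) \<and>
      (\<forall>j. \<alpha> j = (\<Sum>i\<in>{i. i < length mu \<and> phi ! i = j}. mu ! i))} \<noteq> {}"
  proof
    assume "{phi. length phi = length mu \<and> (\<forall>x\<in>set phi. 1 \<le> x) \<and>
      (\<forall>j. \<alpha> j = (\<Sum>i\<in>{i. i < length mu \<and> phi ! i = j}. mu ! i))} = {}"
    then show False using assms by (simp only: psum_coeff_def card.empty)
  qed
  then show ?thesis using that by blast
qed

text \<open>Triangularity of the power sums: \<open>phi\<close> may put several parts on one
  variable, which only shrinks the support. If the support has as many elements as there are parts,
  \<open>phi\<close> is injective and the exponents are the parts.\<close>

lemma psum_coeff_support:
  assumes mu: "mu \<in> partitions_of n" and nz: "psum_coeff mu \<alpha> \<noteq> 0"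
  shows "exponent n \<alpha>" "card {j. \<alpha> j \<noteq> 0} \<le> length mu"
    "card {j. \<alpha> j \<noteq> 0} = length mu \<Longrightarrow> exp_type \<alpha> = mset mu"
proof -
  obtain phi where phi: "length phi = length mu" "\<forall>x\<in>set phi. 1 \<le> x"
    "\<And>j. \<alpha> j = (\<Sum>i\<in>{i. i < length mu \<and> phi ! i = j}. mu ! i)"
    using psum_coeff_obtain[OF nz] by blast
  have pos: "\<forall>x\<in>set mu. 0 < x" "sum_list mu = n" using mu by (auto simp: partitions_of_def is_partition_def)
  have "\<alpha> j \<noteq> 0 \<longleftrightarrow> j \<in> set phi" for j
  proof -
    have "\<alpha> j = 0 \<longleftrightarrow> (\<forall>i\<in>{i. i < length mu \<and> phi ! i = j}. mu ! i = 0)"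
      unfolding phi(3)[of j] by (subst sum_eq_0_iff) auto
    also have "\<dots> \<longleftrightarrow> j \<notin> set phi" using pos(1) phi(1) by (auto simp: in_set_conv_nth) (metis less_irrefl nth_mem)
    finally show ?thesis by simp
  qed
  then have S: "{j. \<alpha> j \<noteq> 0} = set phi" by blast
  show "card {j. \<alpha> j \<noteq> 0} \<le> length mu" unfolding S phi(1)[symmetric] by (rule card_length)
  have "(\<Sum>j\<in>set phi. \<alpha> j) = (\<Sum>j\<in>set phi. \<Sum>i\<in>{i \<in> {..<length mu}. phi ! i = j}. mu ! i)"
    by (rule sum.cong[OF refl]) (simp add: phi(3))
  also have "\<dots> = (\<Sum>i\<in>{..<length mu}. mu ! i)"
    by (rule sum.group) (use phi(1) in auto)
  also have "\<dots> = n" using pos(2) by (simp add: sum_list_sum_nth atLeast0LessThan)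
  finally have "(\<Sum>j\<in>set phi. \<alpha> j) = n" .
  moreover have "\<alpha> 0 = 0" using S phi(2) by (metis (mono_tags, lifting) mem_Collect_eq not_one_le_zero)
  ultimately show "exponent n \<alpha>" unfolding exponent_def S by simp
  assume "card {j. \<alpha> j \<noteq> 0} = length mu"
  then have d: "distinct phi" unfolding S phi(1)[symmetric] by (rule card_distinct)
  have "map \<alpha> phi = mu"
  proof (rule nth_equalityI)
    fix i assume "i < length (map \<alpha> phi)"
    then have i: "i < length mu" using phi(1) by simp
    have "{k. k < length mu \<and> phi ! k = phi ! i} = {i}" using d i phi(1) by (auto simp: nth_eq_iff_index_eq)
    then show "map \<alpha> phi ! i = mu ! i" using phi(3)[of "phi ! i"] i phi(1) by simp
  qed (use phi in simp)
  then show "exp_type \<alpha> = mset mu"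
    unfolding exp_type_def S using mset_set_set[OF d] by (metis mset_map)
qed

lemma psum_coeff_transpose:
  assumes a: "0 < a"
  shows "psum_coeff mu (\<alpha> \<circ> transpose a (a + 1)) = psum_coeff mu \<alpha>"
proof -
  let ?s = "transpose a (a + 1)"
  let ?P = "\<lambda>\<alpha>. {phi. length phi = length mu \<and> (\<forall>x\<in>set phi. 1 \<le> x) \<and>
      (\<forall>j. \<alpha> j = (\<Sum>i\<in>{i. i < length mu \<and> phi ! i = j}. mu ! i))}"
  have sub: "map ?s ` ?P \<alpha> \<subseteq> ?P (\<alpha> \<circ> ?s)" for \<alpha>
  proof
    fix psi assume "psi \<in> map ?s ` ?P \<alpha>"
    then obtain phi where phi: "length phi = length mu" "\<forall>x\<in>set phi. 1 \<le> x"
      "\<And>j. \<alpha> j = (\<Sum>i\<in>{i. i < length mu \<and> phi ! i = j}. mu ! i)" and psi: "psi = map ?s phi" by blast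
    have "1 \<le> ?s x" if "1 \<le> x" for x using that a by (auto simp: transpose_def)
    moreover have "(\<alpha> \<circ> ?s) j = (\<Sum>i\<in>{i. i < length mu \<and> psi ! i = j}. mu ! i)" for j
    proof -
      have "{i. i < length mu \<and> psi ! i = j} = {i. i < length mu \<and> phi ! i = ?s j}"
        using phi(1) unfolding psi by (auto simp: transpose_eq_iff)
      then show ?thesis using phi(3)[of "?s j"] by simp
    qed
    ultimately show "psi \<in> ?P (\<alpha> \<circ> ?s)" using phi psi by auto
  qed
  have "bij_betw (map ?s) (?P \<alpha>) (?P (\<alpha> \<circ> ?s))"
  proof (rule bij_betw_byWitness[where f' = "map ?s"])
    show "map ?s ` ?P \<alpha> \<subseteq> ?P (\<alpha> \<circ> ?s)" by (rule sub)
    show "map ?s ` ?P (\<alpha> \<circ> ?s) \<subseteq> ?P \<alpha>" using sub[of "\<alpha> \<circ> ?s"] by (simp add: comp_assoc)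
  qed (auto simp: comp_def)
  then show ?thesis unfolding psum_coeff_def by (rule bij_betw_same_card[symmetric])
qed

lemma symmetric_pcomb: "symmetric n (pcomb n c)" for c :: "nat list \<Rightarrow> 'a::comm_ring_1"
  unfolding symmetric_def
proof (intro conjI allI impI)
  fix \<alpha> assume "pcomb n c \<alpha> \<noteq> 0"
  then obtain mu where "mu \<in> partitions_of n" "psum_coeff mu \<alpha> \<noteq> 0"
    unfolding pcomb_def by (metis (mono_tags, lifting) mult_zero_right of_nat_0 sum.neutral)
  then show "exponent n \<alpha>" by (rule psum_coeff_support)
next
  fix \<alpha> and a :: nat assume "0 < a"
  then show "pcomb n c (\<alpha> \<circ> transpose a (a + 1)) = pcomb n c \<alpha>"
    unfolding pcomb_def by (simp only: psum_coeff_transpose)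
qed

lemma psum_coeff_part_exp:
  assumes mu: "mu \<in> partitions_of n"
  shows "psum_coeff mu (part_exp mu) \<noteq> 0"
proof -
  let ?P = "{phi. length phi = length mu \<and> (\<forall>x\<in>set phi. 1 \<le> x) \<and>
      (\<forall>j. part_exp mu j = (\<Sum>i\<in>{i. i < length mu \<and> phi ! i = j}. mu ! i))}"
  have "[1..<length mu + 1] \<in> ?P"
  proof -
    have "part_exp mu j = (\<Sum>i\<in>{i. i < length mu \<and> [1..<length mu + 1] ! i = j}. mu ! i)" for j
    proof (cases "1 \<le> j \<and> j \<le> length mu")
      case True
      then have "{i. i < length mu \<and> [1..<length mu + 1] ! i = j} = {j - 1}" by (auto simp del: upt_Suc)
      then show ?thesis using True by (simp add: part_exp_def del: upt_Suc)
    next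
      case False
      then have e: "{i. i < length mu \<and> [1..<length mu + 1] ! i = j} = {}" by (auto simp del: upt_Suc)
      show ?thesis unfolding e using False by (auto simp: part_exp_def)
    qed
    then show ?thesis unfolding mem_Collect_eq by (intro conjI allI) (simp_all del: upt_Suc)
  qed
  \<comment> \<open>An infinite set has cardinality 0, so exhibiting one assignment is not enough.
    The values of \<open>phi\<close> lie in the support of \<open>part_exp mu\<close>, which bounds
    them.\<close>
  moreover have "finite ?P"
  proof (rule finite_subset)
    show "?P \<subseteq> {phi. set phi \<subseteq> {..length mu} \<and> length phi = length mu}"
    proof
      fix phi assume phi: "phi \<in> ?P"
      have "x \<le> length mu" if "x \<in> set phi" for x
      proof -
        have "length phi = length mu" using phi by simp
        moreover have "\<exists>i<length phi. phi ! i = x" using that by (simp only: in_set_conv_nth)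
        ultimately obtain i where i: "i < length mu" "phi ! i = x" by auto
        have "mu ! i \<in> set mu" using i by simp
        then have "mu ! i \<noteq> 0" using mu by (auto simp: is_partition_def partitions_of_def)
        then have "(\<Sum>i\<in>{i. i < length mu \<and> phi ! i = x}. mu ! i) \<noteq> 0" using i by auto
        moreover have "part_exp mu x = (\<Sum>i\<in>{i. i < length mu \<and> phi ! i = x}. mu ! i)" using phi by blast
        ultimately have "part_exp mu x \<noteq> 0" by simp
        then show ?thesis by (auto simp: part_exp_def split: if_splits)
      qed
      then show "phi \<in> {phi. set phi \<subseteq> {..length mu} \<and> length phi = length mu}" using phi by auto
    qed
  qed (simp add: finite_lists_length_eq)
  ultimately show ?thesis unfolding psum_coeff_def by (metis (no_types, lifting) card_0_eq empty_iff)
qed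

text \<open>Elimination by the number of variables in a monomial: subtracting multiples of the power
  sums with exactly L parts removes the monomials with L variables and, by triangularity, creates
  none with more. The diagonal coefficient is a positive integer, invertible in characteristic
  0.\<close>

lemma symmetric_pcomb_ex_aux:
  fixes f :: "(nat \<Rightarrow> nat) \<Rightarrow> 'a::field_char_0"
  assumes "symmetric n f" and "\<And>\<alpha>. f \<alpha> \<noteq> 0 \<Longrightarrow> card {j. \<alpha> j \<noteq> 0} < L"
  shows "\<exists>c. f = pcomb n c"
  using assms
proof (induction L arbitrary: f)
  case 0
  then have "f = (\<lambda>_. 0)" by auto
  then show ?case by (intro exI[of _ "\<lambda>_. 0"]) (simp add: pcomb_def fun_eq_iff)
next
  case (Suc L)
  define e where "e mu = (if length mu = L then f (part_exp mu) / of_nat (psum_coeff mu (part_exp mu)) else 0)" for mu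
  define g where "g = (\<lambda>\<alpha>. f \<alpha> - pcomb n e \<alpha>)"
  have symg: "symmetric n g"
  proof -
    note sf = Suc.prems(1) and sp = symmetric_pcomb[of n e]
    have "exponent n \<alpha>" if "g \<alpha> \<noteq> 0" for \<alpha>
    proof -
      have "f \<alpha> \<noteq> 0 \<or> pcomb n e \<alpha> \<noteq> 0" using that by (auto simp: g_def)
      then show ?thesis using sf sp unfolding symmetric_def by blast
    qed
    moreover have "g (\<alpha> \<circ> transpose a (a + 1)) = g \<alpha>" if "0 < a" for \<alpha> a
      unfolding g_def symmetric_adjacent[OF sf that] symmetric_adjacent[OF sp that] ..
    ultimately show ?thesis unfolding symmetric_def by (intro conjI allI impI)
  qed
  have "card {j. \<alpha> j \<noteq> 0} < L" if ga: "g \<alpha> \<noteq> 0" for \<alpha>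
  proof (rule ccontr)
    assume L: "\<not> card {j. \<alpha> j \<noteq> 0} < L"
    have ex: "exponent n \<alpha>" using symg ga unfolding symmetric_def by blast
    have big: "psum_coeff mu \<alpha> = 0" if "mu \<in> partitions_of n" "length mu = L" "\<not> (card {j. \<alpha> j \<noteq> 0} = L \<and> exp_type \<alpha> = mset mu)" for mu
    proof (rule ccontr)
      assume "psum_coeff mu \<alpha> \<noteq> 0"
      note s = psum_coeff_support[OF that(1) this]
      show False using s(2,3) that L by linarith
    qed
    show False
    proof (cases "card {j. \<alpha> j \<noteq> 0} = L")
      case False
      then have "f \<alpha> = 0" using Suc.prems(2)[of \<alpha>] L by linarith
      moreover have "pcomb n e \<alpha> = 0"
        unfolding pcomb_def by (rule sum.neutral) (use big False in \<open>auto simp: e_def\<close>)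
      ultimately show False using ga by (simp add: g_def)
    next
      case True
      obtain nu where nu: "nu \<in> partitions_of n" "mset nu = exp_type \<alpha>" using exponent_partition[OF ex] .
      have len: "length nu = L" using nu(2) True by (metis exp_type_def size_image_mset size_mset size_mset_set)
      have same: "h \<alpha> = h (part_exp nu)" if "symmetric n h" for h :: "(nat \<Rightarrow> nat) \<Rightarrow> 'a"
        using part_exp_props[OF nu(1)] ex nu(2) by (intro symmetric_exp_type[OF that]) (auto simp: exponent_def)
      have "pcomb n e \<alpha> = (\<Sum>mu\<in>partitions_of n. if mu = nu then e nu * of_nat (psum_coeff nu \<alpha>) else 0)"
        unfolding pcomb_def
      proof (rule sum.cong[OF refl])
        fix mu assume mu: "mu \<in> partitions_of n"
        show "e mu * of_nat (psum_coeff mu \<alpha>) = (if mu = nu then e nu * of_nat (psum_coeff nu \<alpha>) else 0)"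
        proof (cases "mu = nu \<or> length mu \<noteq> L")
          case False
          then have "mset mu \<noteq> exp_type \<alpha>" using nu mu partition_mset_unique[of mu nu] by (auto simp: partitions_of_def)
          then show ?thesis using big[OF mu] False by auto
        qed (auto simp: e_def len)
      qed
      also have "\<dots> = e nu * of_nat (psum_coeff nu \<alpha>)" using nu(1) finite_partitions_of by simp
      \<comment> \<open>A single power sum is a combination with one coefficient 1, hence symmetric,
        so its coefficients at \<open>\<alpha>\<close> and at \<open>part_exp nu\<close>
        agree.\<close>
      also have "(of_nat (psum_coeff nu \<alpha>) :: 'a) = of_nat (psum_coeff nu (part_exp nu))"
      proof -
        have "pcomb n (\<lambda>mu. if mu = nu then 1 else 0) \<beta> = (of_nat (psum_coeff nu \<beta>) :: 'a)" for \<beta>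
        proof -
          have "pcomb n (\<lambda>mu. if mu = nu then 1 else 0) \<beta> = (\<Sum>mu\<in>partitions_of n. if mu = nu then (of_nat (psum_coeff nu \<beta>) :: 'a) else 0)"
            unfolding pcomb_def by (rule sum.cong) auto
          then show ?thesis using nu(1) finite_partitions_of by simp
        qed
        then show ?thesis using same[OF symmetric_pcomb[of n "\<lambda>mu. if mu = nu then 1 else 0"]] by simp
      qed
      also have "e nu * \<dots> = f (part_exp nu)" using psum_coeff_part_exp[OF nu(1)] by (simp add: e_def len)
      also have "\<dots> = f \<alpha>" using same[OF Suc.prems(1)] by simp
      finally show False using ga by (simp add: g_def)
    qed
  qed
  then obtain c where c: "g = pcomb n c" using Suc.IH[OF symg] by blast
  have "f = pcomb n (\<lambda>mu. c mu + e mu)"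
  proof
    fix \<alpha>
    have "f \<alpha> = g \<alpha> + pcomb n e \<alpha>" by (simp add: g_def)
    then show "f \<alpha> = pcomb n (\<lambda>mu. c mu + e mu) \<alpha>"
      by (simp add: c pcomb_def distrib_right sum.distrib)
  qed
  then show ?case by blast
qed

lemma symmetric_pcomb_ex:
  fixes f :: "(nat \<Rightarrow> nat) \<Rightarrow> 'a::field_char_0"
  assumes "symmetric n f"
  shows "\<exists>c. f = pcomb n c"
proof (rule symmetric_pcomb_ex_aux[OF assms])
  fix \<alpha> assume "f \<alpha> \<noteq> 0"
  then have "exponent n \<alpha>" using assms by (auto simp: symmetric_def)
  then have \<alpha>: "finite {j. \<alpha> j \<noteq> 0}" "(\<Sum>j\<in>{j. \<alpha> j \<noteq> 0}. \<alpha> j) = n" by (auto simp: exponent_def)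
  have "card {j. \<alpha> j \<noteq> 0} = (\<Sum>j\<in>{j. \<alpha> j \<noteq> 0}. 1)" by simp
  also have "\<dots> \<le> (\<Sum>j\<in>{j. \<alpha> j \<noteq> 0}. \<alpha> j)" by (rule sum_mono) auto
  finally show "card {j. \<alpha> j \<noteq> 0} < Suc n" using \<alpha> by simp
qed

section \<open>The series C_lambda as a symmetric function\<close>

lemma card_dg:
  assumes "is_partition lam"
  shows "card (dg lam) = sum_list lam"
proof -
  have "dg lam = (\<lambda>(i, r). (r, i)) ` Sigma {1..length lam} (\<lambda>i. {1..col lam i})"
    by (auto simp: dg_def image_iff)
  moreover have "inj_on (\<lambda>(i, r). (r, i)) (Sigma {1..length lam} (\<lambda>i. {1..col lam i}))"
    by (auto simp: inj_on_def)
  ultimately have "card (dg lam) = card (Sigma {1..length lam} (\<lambda>i. {1..col lam i}))" by (simp add: card_image)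
  also have "\<dots> = (\<Sum>i\<in>{1..length lam}. col lam i)" by simp
  also have "\<dots> = (\<Sum>i\<in>{..<length lam}. lam ! i)"
    by (rule sum.reindex_bij_witness[of _ Suc "\<lambda>i. i - 1"]) (auto simp: col_def)
  also have "\<dots> = sum_list lam" by (simp add: sum_list_sum_nth atLeast0LessThan)
  finally show ?thesis .
qed

lemma has_content_exponent:
  assumes lam: "is_partition lam" and \<sigma>: "has_content lam \<sigma> \<alpha>" "\<And>u. u \<in> dg lam \<Longrightarrow> \<sigma> u \<noteq> 0"
  shows "exponent (sum_list lam) \<alpha>"
proof -
  have fin: "finite (dg lam)" by (rule finite_dg[OF lam])
  let ?f = "\<lambda>u. nat \<bar>\<sigma> u\<bar>"
  have c: "\<alpha> j = card {u \<in> dg lam. ?f u = j}" for j using \<sigma> by (simp add: has_content_def)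
  have "\<alpha> j \<noteq> 0 \<longleftrightarrow> j \<in> ?f ` dg lam" for j unfolding c using fin by auto
  then have S: "{j. \<alpha> j \<noteq> 0} = ?f ` dg lam" by blast
  have "(\<Sum>j\<in>?f ` dg lam. \<alpha> j) = (\<Sum>j\<in>?f ` dg lam. \<Sum>u\<in>{u \<in> dg lam. ?f u = j}. 1)"
    by (rule sum.cong[OF refl]) (simp add: c)
  also have "\<dots> = (\<Sum>u\<in>dg lam. 1)" by (rule sum.group) (use fin in auto)
  also have "\<dots> = sum_list lam" by (simp add: card_dg[OF lam])
  finally have "(\<Sum>j\<in>{j. \<alpha> j \<noteq> 0}. \<alpha> j) = sum_list lam" unfolding S .
  moreover have "\<alpha> 0 = 0"
  proof -
    have "0 \<notin> ?f ` dg lam" using \<sigma>(2) by force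
    then show ?thesis using S by blast
  qed
  moreover have "finite {j. \<alpha> j \<noteq> 0}" unfolding S using fin by simp
  ultimately show ?thesis by (simp add: exponent_def)
qed

lemma symmetric_C_coeff:
  fixes q t :: "'a::idom"
  assumes lam: "is_partition lam"
  shows "symmetric (sum_list lam) (C_coeff lam q t)"
  unfolding symmetric_def
proof (intro conjI allI impI)
  fix \<alpha> assume "C_coeff lam q t \<alpha> \<noteq> 0"
  then obtain \<sigma> where "\<sigma> \<in> dg lam \<rightarrow>\<^sub>E {a. 0 < a}" "has_content lam \<sigma> \<alpha>"
    unfolding C_coeff_def by (metis (mono_tags, lifting) empty_iff equals0I mem_Collect_eq sum.empty)
  then show "exponent (sum_list lam) \<alpha>" by (intro has_content_exponent[OF lam]) force+
next
  fix \<alpha> and a :: nat assume "0 < a"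
  then show "C_coeff lam q t (\<alpha> \<circ> transpose a (a + 1)) = C_coeff lam q t \<alpha>"
    by (rule C_coeff_transpose[OF lam])
qed

section \<open>Superization\<close>

text \<open>One encoding for two kinds of objects: super fillings, where every cell has weight 1,
  and signed assignments of variables to the parts of a power sum, where an index weighs as much as
  its part. \<open>\<gamma>\<close> prescribes the total weight on each signed letter.\<close>

definition letter_fns :: "'i set \<Rightarrow> ('i \<Rightarrow> nat) \<Rightarrow> (int \<Rightarrow> nat) \<Rightarrow> ('i \<Rightarrow> int) set" where
  "letter_fns I m \<gamma> = {\<phi> \<in> I \<rightarrow>\<^sub>E {a. a \<noteq> 0}. \<forall>a. \<gamma> a = (\<Sum>i\<in>{i \<in> I. \<phi> i = a}. m i)}"

text \<open>All other letters in use lie between - k and p as integers, so p is the largest positive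
  and - k the smallest negative one: neighbours in \<open><_2\<close>. The sum runs over all
  splittings of b because changing p into - k at \<open>i\<close> moves the weight
  \<open>m i\<close>. The least index carrying one of the two is the same after the change, so the
  change pairs off the terms.\<close>

lemma sum_letter_fns_cancel:
  fixes w :: "('i::linorder \<Rightarrow> int) \<Rightarrow> 'r::comm_ring_1"
  assumes fin: "finite I" and m: "\<And>i. i \<in> I \<Longrightarrow> 0 < m i"
    and p: "0 < p" and k: "0 < k" and b: "0 < b"
    and \<gamma>: "\<And>a. \<gamma> a \<noteq> 0 \<Longrightarrow> - k < a \<and> a < p"
    and flip: "\<And>\<phi> i. \<phi> \<in> I \<rightarrow>\<^sub>E {a. a \<noteq> 0} \<Longrightarrow> i \<in> I \<Longrightarrow> \<phi> i = p \<Longrightarrow> \<forall>j\<in>I. - k \<le> \<phi> j \<and> \<phi> j \<le> p \<Longrightarrow>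
      \<forall>j\<in>I. j < i \<longrightarrow> \<phi> j \<noteq> p \<and> \<phi> j \<noteq> - k \<Longrightarrow> w (\<phi>(i := - k)) = - w \<phi>"
  shows "(\<Sum>c\<le>b. \<Sum>\<phi>\<in>letter_fns I m (\<gamma>(p := b - c, - k := c)). w \<phi>) = 0"
proof -
  let ?s = "\<lambda>\<phi> a. \<Sum>i\<in>{i \<in> I. \<phi> i = a}. m i"
  define U where "U = {\<phi> \<in> I \<rightarrow>\<^sub>E {a. a \<noteq> 0}. (\<forall>a. a \<noteq> p \<longrightarrow> a \<noteq> - k \<longrightarrow> \<gamma> a = ?s \<phi> a) \<and> ?s \<phi> p + ?s \<phi> (- k) = b}"
  have pk: "p \<noteq> - k" using p k by simp
  have range: "\<forall>j\<in>I. - k \<le> \<phi> j \<and> \<phi> j \<le> p" if "\<phi> \<in> U" for \<phi>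
  proof
    fix j assume j: "j \<in> I"
    show "- k \<le> \<phi> j \<and> \<phi> j \<le> p"
    proof (cases "\<phi> j = p \<or> \<phi> j = - k")
      case True
      then show ?thesis using p k by auto
    next
      case False
      then have "\<gamma> (\<phi> j) = ?s \<phi> (\<phi> j)" using that by (auto simp: U_def)
      moreover have "?s \<phi> (\<phi> j) \<noteq> 0" using fin m j by (auto simp: sum_eq_0_iff)
      ultimately show ?thesis using \<gamma>[of "\<phi> j"] by auto
    qed
  qed
  have "U \<subseteq> I \<rightarrow>\<^sub>E {- k..p}"
  proof
    fix \<phi> assume "\<phi> \<in> U"
    then show "\<phi> \<in> I \<rightarrow>\<^sub>E {- k..p}" using range[of \<phi>] by (auto simp: U_def PiE_def)
  qed
  moreover have "finite (I \<rightarrow>\<^sub>E {- k..p})" using fin by (intro finite_PiE) auto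
  ultimately have finU: "finite U" by (rule finite_subset)
  have fib: "{\<phi> \<in> U. ?s \<phi> (- k) = c} = letter_fns I m (\<gamma>(p := b - c, - k := c))" if c: "c \<le> b" for c
  proof (rule set_eqI)
    fix \<phi>
    have "(\<forall>a. (\<gamma>(p := b - c, - k := c)) a = ?s \<phi> a) \<longleftrightarrow>
      (\<forall>a. a \<noteq> p \<longrightarrow> a \<noteq> - k \<longrightarrow> \<gamma> a = ?s \<phi> a) \<and> b - c = ?s \<phi> p \<and> c = ?s \<phi> (- k)"
      using pk by (auto simp: fun_upd_def)
    then show "\<phi> \<in> {\<phi> \<in> U. ?s \<phi> (- k) = c} \<longleftrightarrow> \<phi> \<in> letter_fns I m (\<gamma>(p := b - c, - k := c))"
      using c unfolding U_def letter_fns_def mem_Collect_eq by auto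
  qed
  have "(\<Sum>c\<le>b. \<Sum>\<phi>\<in>letter_fns I m (\<gamma>(p := b - c, - k := c)). w \<phi>) = (\<Sum>c\<in>{..b}. \<Sum>\<phi>\<in>{\<phi> \<in> U. ?s \<phi> (- k) = c}. w \<phi>)"
    by (rule sum.cong) (simp_all add: fib)
  also have "\<dots> = (\<Sum>\<phi>\<in>U. w \<phi>)"
    by (rule sum.group[OF finU]) (auto simp: U_def)
  also have "\<dots> = 0"
  proof -
    let ?J = "\<lambda>\<phi>. {i \<in> I. \<phi> i = p \<or> \<phi> i = - k}"
    let ?f = "\<lambda>\<phi>. Min (?J \<phi>)"
    have J: "finite (?J \<phi>)" for \<phi> using fin by simp
    have ne: "?J \<phi> \<noteq> {}" if "\<phi> \<in> U" for \<phi>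
    proof
      assume "?J \<phi> = {}"
      then have e: "{i \<in> I. \<phi> i = p} = {}" "{i \<in> I. \<phi> i = - k} = {}" by auto
      have "?s \<phi> p + ?s \<phi> (- k) = b" using that by (simp add: U_def)
      then show False unfolding e using b by simp
    qed
    have fJ: "?f \<phi> \<in> ?J \<phi>" if "\<phi> \<in> U" for \<phi> using Min_in[OF J ne[OF that]] .
    have fmin: "\<forall>j\<in>I. j < ?f \<phi> \<longrightarrow> \<phi> j \<noteq> p \<and> \<phi> j \<noteq> - k" for \<phi>
    proof (intro ballI impI)
      fix j assume "j \<in> I" "j < ?f \<phi>"
      then show "\<phi> j \<noteq> p \<and> \<phi> j \<noteq> - k" using Min_le[OF J, of j \<phi>] by auto
    qed
    have upd: "\<phi>(?f \<phi> := a) \<in> U \<and> ?f (\<phi>(?f \<phi> := a)) = ?f \<phi>" if \<phi>: "\<phi> \<in> U" and a: "a = p \<or> a = - k" for \<phi> a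
    proof -
      define i where "i = ?f \<phi>"
      have i: "i \<in> I" "\<phi> i = p \<or> \<phi> i = - k" using fJ[OF \<phi>] by (auto simp: i_def)
      let ?\<psi> = "\<phi>(i := a)"
      have "?J ?\<psi> = ?J \<phi>" using i a by auto
      then have f: "?f ?\<psi> = ?f \<phi>" by simp
      have s: "?s ?\<psi> c = ?s \<phi> c" if "c \<noteq> p" "c \<noteq> - k" for c
      proof -
        have "{i \<in> I. ?\<psi> i = c} = {i \<in> I. \<phi> i = c}" using i a that by auto
        then show ?thesis by simp
      qed
      have tot: "?s \<chi> p + ?s \<chi> (- k) = sum m (?J \<chi>)" for \<chi>
      proof -
        have "?J \<chi> = {i \<in> I. \<chi> i = p} \<union> {i \<in> I. \<chi> i = - k}" by auto
        then show ?thesis using fin pk by (simp only:) (subst sum.union_disjoint, auto)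
      qed
      have "\<phi> \<in> I \<rightarrow>\<^sub>E {a. a \<noteq> 0}" "a \<noteq> 0" using \<phi> a p k by (auto simp: U_def)
      then have "?\<psi> \<in> I \<rightarrow>\<^sub>E {a. a \<noteq> 0}" using i by (auto simp: PiE_def Pi_def extensional_def)
      moreover have "?s ?\<psi> p + ?s ?\<psi> (- k) = b" using \<phi> unfolding tot \<open>?J ?\<psi> = ?J \<phi>\<close> by (simp add: U_def tot)
      ultimately have "?\<psi> \<in> U" using \<phi> s unfolding U_def by simp
      then show ?thesis using f by (simp add: i_def)
    qed
    let ?P = "{\<phi> \<in> U. \<phi> (?f \<phi>) = p}" and ?N = "{\<phi> \<in> U. \<phi> (?f \<phi>) = - k}"
    have "U = ?P \<union> ?N" using fJ by blast
    moreover have "?P \<inter> ?N = {}" using pk by auto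
    ultimately have "sum w U = sum w ?P + sum w ?N" using finU by (metis (no_types, lifting) finite_Un sum.union_disjoint)
    also have "sum w ?N = (\<Sum>\<phi>\<in>?P. - w \<phi>)"
    proof (rule sum.reindex_bij_witness[of _ "\<lambda>\<phi>. \<phi>(?f \<phi> := - k)" "\<lambda>\<phi>. \<phi>(?f \<phi> := p)"])
      fix \<phi> assume \<phi>: "\<phi> \<in> ?N"
      then have u: "\<phi>(?f \<phi> := p) \<in> U" "?f (\<phi>(?f \<phi> := p)) = ?f \<phi>" using upd[of \<phi> p] by auto
      show "\<phi>(?f \<phi> := p) \<in> ?P" using u by simp
      show inv: "(\<phi>(?f \<phi> := p))(?f (\<phi>(?f \<phi> := p)) := - k) = \<phi>"
        unfolding u(2) using \<phi> by (auto simp: fun_eq_iff)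
      have "w ((\<phi>(?f \<phi> := p))(?f \<phi> := - k)) = - w (\<phi>(?f \<phi> := p))"
      proof (rule flip)
        show "\<phi>(?f \<phi> := p) \<in> I \<rightarrow>\<^sub>E {a. a \<noteq> 0}" using u(1) by (simp add: U_def)
        show "?f \<phi> \<in> I" using fJ[of \<phi>] \<phi> by auto
        show "\<forall>j\<in>I. - k \<le> (\<phi>(?f \<phi> := p)) j \<and> (\<phi>(?f \<phi> := p)) j \<le> p" by (rule range[OF u(1)])
        show "\<forall>j\<in>I. j < ?f \<phi> \<longrightarrow> (\<phi>(?f \<phi> := p)) j \<noteq> p \<and> (\<phi>(?f \<phi> := p)) j \<noteq> - k" using fmin[of \<phi>] by auto
      qed simp
      then show "- w (\<phi>(?f \<phi> := p)) = w \<phi>" using inv unfolding u(2) by simp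
    next
      fix \<phi> assume \<phi>: "\<phi> \<in> ?P"
      then have u: "\<phi>(?f \<phi> := - k) \<in> U" "?f (\<phi>(?f \<phi> := - k)) = ?f \<phi>" using upd[of \<phi> "- k"] by auto
      show "\<phi>(?f \<phi> := - k) \<in> ?N" using u by simp
      show "(\<phi>(?f \<phi> := - k))(?f (\<phi>(?f \<phi> := - k)) := p) = \<phi>"
        unfolding u(2) using \<phi> by (auto simp: fun_eq_iff)
    qed
    finally show ?thesis by (simp add: sum_negf)
  qed
  finally show ?thesis .
qed

text \<open>The cancellation property of supersymmetric functions, coefficient by coefficient: when
  the variables of p and - k are both set to z, no positive power of z remains.\<close>

definition cancelling :: "((int \<Rightarrow> nat) \<Rightarrow> 'r::comm_ring_1) \<Rightarrow> bool" where
  "cancelling T \<longleftrightarrow> (\<forall>p k b \<gamma>. 0 < p \<longrightarrow> 0 < k \<longrightarrow> 0 < b \<longrightarrow> (\<forall>a. \<gamma> a \<noteq> 0 \<longrightarrow> - k < a \<and> a < p) \<longrightarrow>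
     (\<Sum>c\<le>b. T (\<gamma>(p := b - c, - k := c))) = 0)"

text \<open>The term with \<open>c = b\<close> of a cancellation relation is the only one in which the least negative letter
  \<open>- k\<close> occurs \<open>b\<close> times, so contents with negative letters are eliminated one letter at a time.\<close>
lemma cancelling_eq_0:
  fixes T :: "(int \<Rightarrow> nat) \<Rightarrow> 'r::comm_ring_1"
  assumes canc: "cancelling T"
    and pos: "\<And>\<gamma>. finite {a. \<gamma> a \<noteq> 0} \<Longrightarrow> (\<And>a. a \<le> 0 \<Longrightarrow> \<gamma> a = 0) \<Longrightarrow> T \<gamma> = 0"
    and \<gamma>: "finite {a. \<gamma> a \<noteq> 0}" "\<gamma> 0 = 0"
  shows "T \<gamma> = 0"
proof -
  have "T \<gamma> = 0" if "finite {a. \<gamma> a \<noteq> 0}" "\<gamma> 0 = 0" "\<And>a. a < - int K \<Longrightarrow> \<gamma> a = 0" for K \<gamma>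
    using that
  proof (induction K arbitrary: \<gamma>)
    case 0
    show ?case
    proof (rule pos[OF 0(1)])
      fix a :: int assume "a \<le> 0"
      then show "\<gamma> a = 0" using 0(2,3) by (cases "a = 0") auto
    qed
  next
    case (Suc K)
    let ?k = "1 + int K"
    from Suc.prems show ?case
    proof (induction "\<gamma> (- ?k)" arbitrary: \<gamma> rule: less_induct)
      case less
      show ?case
      proof (cases "\<gamma> (- ?k) = 0")
        case True
        show ?thesis
        proof (rule Suc.IH[OF less.prems(1,2)])
          fix a assume "a < - int K"
          then have "a = - ?k \<or> a < - int (Suc K)" by auto
          then show "\<gamma> a = 0" using True less.prems(3) by auto
        qed
      next
        case False
        define b where "b = \<gamma> (- ?k)"
        \<comment> \<open>A positive letter beyond all letters of the content, so that the relation
          for p and - k applies. It does not occur in \<open>\<gamma>\<close>, hence the term c = b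
          is \<open>T \<gamma>\<close> itself.\<close>
        define p where "p = Max (insert 0 {a. \<gamma> a \<noteq> 0}) + 1"
        have le: "a < p" if "\<gamma> a \<noteq> 0" for a
          unfolding p_def using Max_ge[of "insert 0 {a. \<gamma> a \<noteq> 0}" a] less.prems(1) that by auto
        have p: "0 < p" unfolding p_def using Max_ge[of "insert 0 {a. \<gamma> a \<noteq> 0}" 0] less.prems(1) by auto
        have pz: "\<gamma> p = 0" using le[of p] by auto
        let ?g = "\<gamma>(- ?k := 0)"
        have supp: "- ?k < a \<and> a < p" if "?g a \<noteq> 0" for a
        proof -
          have "a \<noteq> - ?k" "\<gamma> a \<noteq> 0" using that by (auto split: if_splits)
          moreover have "\<not> a < - int (Suc K)" using less.prems(3)[of a] \<open>\<gamma> a \<noteq> 0\<close> by blast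
          ultimately show ?thesis using le[of a] by auto
        qed
        have "0 < ?k" by simp
        then have "(\<Sum>c\<le>b. T (?g(p := b - c, - ?k := c))) = 0"
          using canc p False supp unfolding cancelling_def b_def by blast
        moreover have "T (?g(p := b - c, - ?k := c)) = 0" if "c < b" for c
        proof (rule less.hyps)
          show "(?g(p := b - c, - ?k := c)) (- ?k) < \<gamma> (- ?k)" using that by (simp add: b_def)
          have "{a. (?g(p := b - c, - ?k := c)) a \<noteq> 0} \<subseteq> insert p (insert (- ?k) {a. \<gamma> a \<noteq> 0})"
            by (auto split: if_splits)
          then show "finite {a. (?g(p := b - c, - ?k := c)) a \<noteq> 0}"
            using less.prems(1) by (meson finite_insert finite_subset)
          show "(?g(p := b - c, - ?k := c)) 0 = 0" using p less.prems(2) by simp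
          show "(?g(p := b - c, - ?k := c)) a = 0" if "a < - int (Suc K)" for a
            using that p less.prems(3)[of a] by simp
        qed
        ultimately have "T (?g(p := b - b, - ?k := b)) = 0"
          by (simp add: lessThan_Suc_atMost[symmetric] lessThan_Suc sum.insert atMost_Suc
              ivl_disj_un_singleton(2)[symmetric])
        moreover have "?g(p := b - b, - ?k := b) = \<gamma>" using pz by (auto simp: b_def)
        ultimately show ?thesis by simp
      qed
    qed
  qed
  moreover define K where "K = nat (- Min (insert 0 {a. \<gamma> a \<noteq> 0}))"
  moreover have "\<gamma> a = 0" if "a < - int K" for a
  proof (rule ccontr)
    assume "\<gamma> a \<noteq> 0"
    then have "Min (insert 0 {a. \<gamma> a \<noteq> 0}) \<le> a" using \<gamma>(1) by (intro Min_le) auto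
    then show False using that unfolding K_def by linarith
  qed
  ultimately show ?thesis using \<gamma> by blast
qed

section \<open>Signed contents over a given absolute content\<close>

definition signed_contents :: "(nat \<Rightarrow> nat) \<Rightarrow> (int \<Rightarrow> nat) set" where
  "signed_contents \<alpha> = {\<gamma>. \<gamma> 0 = 0 \<and> (\<forall>j>0. \<gamma> (int j) + \<gamma> (- int j) = \<alpha> j)}"

lemma signed_contents_le: "\<gamma> \<in> signed_contents \<alpha> \<Longrightarrow> \<gamma> a \<le> \<alpha> (nat \<bar>a\<bar>)"
proof -
  assume g: "\<gamma> \<in> signed_contents \<alpha>"
  show ?thesis
  proof (cases "a = 0")
    case False
    then have "\<gamma> (int (nat \<bar>a\<bar>)) + \<gamma> (- int (nat \<bar>a\<bar>)) = \<alpha> (nat \<bar>a\<bar>)"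
    proof -
      have "\<forall>j>0. \<gamma> (int j) + \<gamma> (- int j) = \<alpha> j" using g by (simp add: signed_contents_def)
      then show ?thesis using False by (meson zero_less_abs_iff zero_less_nat_eq)
    qed
    then show ?thesis by (cases "0 < a") auto
  qed (use g in \<open>simp add: signed_contents_def\<close>)
qed

lemma finite_supp_signed_content:
  assumes "finite {j. \<alpha> j \<noteq> 0}" "\<gamma> \<in> signed_contents \<alpha>"
  shows "{a. \<gamma> a \<noteq> 0} \<subseteq> int ` {j. \<alpha> j \<noteq> 0} \<union> (\<lambda>j. - int j) ` {j. \<alpha> j \<noteq> 0}"
proof
  fix a assume "a \<in> {a. \<gamma> a \<noteq> 0}"
  then have "\<alpha> (nat \<bar>a\<bar>) \<noteq> 0" using signed_contents_le[OF assms(2), of a] by auto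
  moreover have "a = int (nat \<bar>a\<bar>) \<or> a = - int (nat \<bar>a\<bar>)" by auto
  ultimately show "a \<in> int ` {j. \<alpha> j \<noteq> 0} \<union> (\<lambda>j. - int j) ` {j. \<alpha> j \<noteq> 0}" by blast
qed

lemma finite_signed_contents:
  assumes "finite {j. \<alpha> j \<noteq> 0}"
  shows "finite (signed_contents \<alpha>)"
proof -
  let ?A = "int ` {j. \<alpha> j \<noteq> 0} \<union> (\<lambda>j. - int j) ` {j. \<alpha> j \<noteq> 0}"
  let ?B = "{..Max (insert 0 (\<alpha> ` {j. \<alpha> j \<noteq> 0}))}"
  have "signed_contents \<alpha> \<subseteq> {f. \<forall>x. (x \<in> ?A \<longrightarrow> f x \<in> ?B) \<and> (x \<notin> ?A \<longrightarrow> f x = 0)}"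
  proof (rule subsetI, unfold mem_Collect_eq, intro allI conjI impI)
    fix \<gamma> a assume \<gamma>: "\<gamma> \<in> signed_contents \<alpha>"
    show "\<gamma> a \<in> ?B"
    proof (cases "\<alpha> (nat \<bar>a\<bar>) = 0")
      case True
      then show ?thesis using signed_contents_le[OF \<gamma>, of a] by simp
    next
      case False
      then have "\<alpha> (nat \<bar>a\<bar>) \<le> Max (insert 0 (\<alpha> ` {j. \<alpha> j \<noteq> 0}))" using assms by (intro Max_ge) auto
      then show ?thesis using signed_contents_le[OF \<gamma>, of a] by simp
    qed
    show "\<gamma> a = 0" if "a \<notin> ?A" using finite_supp_signed_content[OF assms \<gamma>] that by blast
  qed
  moreover have "finite {f. \<forall>x. (x \<in> ?A \<longrightarrow> f x \<in> ?B) \<and> (x \<notin> ?A \<longrightarrow> f x = (0::nat))}"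
    using assms by (intro finite_set_of_finite_funs) auto
  ultimately show ?thesis by (rule finite_subset)
qed

definition abs_fns :: "'i set \<Rightarrow> ('i \<Rightarrow> nat) \<Rightarrow> (nat \<Rightarrow> nat) \<Rightarrow> ('i \<Rightarrow> int) set" where
  "abs_fns I m \<alpha> = {\<phi> \<in> I \<rightarrow>\<^sub>E {a. a \<noteq> 0}. \<forall>j. \<alpha> j = (\<Sum>i\<in>{i \<in> I. nat \<bar>\<phi> i\<bar> = j}. m i)}"

lemma abs_fns_supp:
  assumes fin: "finite I" and m: "\<And>i. i \<in> I \<Longrightarrow> 0 < m i" and \<phi>: "\<phi> \<in> abs_fns I m \<alpha>"
  shows "{j. \<alpha> j \<noteq> 0} = (\<lambda>i. nat \<bar>\<phi> i\<bar>) ` I"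
proof -
  have "\<alpha> j = (\<Sum>i\<in>{i \<in> I. nat \<bar>\<phi> i\<bar> = j}. m i)" for j using \<phi> by (simp add: abs_fns_def)
  then have "\<alpha> j \<noteq> 0 \<longleftrightarrow> (\<exists>i\<in>I. nat \<bar>\<phi> i\<bar> = j)" for j using fin m by (auto simp: sum_eq_0_iff)
  then show ?thesis by auto
qed

lemma finite_abs_fns:
  assumes fin: "finite I" and m: "\<And>i. i \<in> I \<Longrightarrow> 0 < m i" and \<alpha>: "finite {j. \<alpha> j \<noteq> 0}"
  shows "finite (abs_fns I m \<alpha>)"
proof (rule finite_subset)
  show "abs_fns I m \<alpha> \<subseteq> I \<rightarrow>\<^sub>E (int ` {j. \<alpha> j \<noteq> 0} \<union> (\<lambda>j. - int j) ` {j. \<alpha> j \<noteq> 0})"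
  proof
    fix \<phi> assume \<phi>: "\<phi> \<in> abs_fns I m \<alpha>"
    have "\<phi> i \<in> int ` {j. \<alpha> j \<noteq> 0} \<union> (\<lambda>j. - int j) ` {j. \<alpha> j \<noteq> 0}" if "i \<in> I" for i
    proof -
      have "nat \<bar>\<phi> i\<bar> \<in> {j. \<alpha> j \<noteq> 0}" using abs_fns_supp[OF fin m \<phi>] that by blast
      moreover have "\<phi> i = int (nat \<bar>\<phi> i\<bar>) \<or> \<phi> i = - int (nat \<bar>\<phi> i\<bar>)" by auto
      ultimately show ?thesis by blast
    qed
    then show "\<phi> \<in> I \<rightarrow>\<^sub>E (int ` {j. \<alpha> j \<noteq> 0} \<union> (\<lambda>j. - int j) ` {j. \<alpha> j \<noteq> 0})"
      using \<phi> by (auto simp: abs_fns_def PiE_def)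
  qed
  show "finite (I \<rightarrow>\<^sub>E (int ` {j. \<alpha> j \<noteq> 0} \<union> (\<lambda>j. - int j) ` {j. \<alpha> j \<noteq> 0}))"
    using fin \<alpha> by (intro finite_PiE) auto
qed

text \<open>The exponent of q is the weight on positive letters, which depends on the signed content
  alone, so it can be taken out of each group.\<close>

lemma sum_abs_fns_eq_signed:
  fixes w :: "('i \<Rightarrow> int) \<Rightarrow> 'r::comm_ring_1"
  assumes fin: "finite I" and m: "\<And>i. i \<in> I \<Longrightarrow> 0 < m i" and \<alpha>: "finite {j. \<alpha> j \<noteq> 0}" "\<alpha> 0 = 0"
  shows "(\<Sum>\<phi>\<in>abs_fns I m \<alpha>. q ^ (\<Sum>i\<in>{i \<in> I. 0 < \<phi> i}. m i) * w \<phi>) =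
    (\<Sum>\<gamma>\<in>signed_contents \<alpha>. q ^ (\<Sum>j\<in>{j. \<alpha> j \<noteq> 0}. \<gamma> (int j)) * (\<Sum>\<phi>\<in>letter_fns I m \<gamma>. w \<phi>))"
proof -
  let ?c = "\<lambda>\<phi> a. \<Sum>i\<in>{i \<in> I. \<phi> i = a}. m i"
  have split: "(\<Sum>i\<in>{i \<in> I. nat \<bar>\<phi> i\<bar> = j}. m i) = ?c \<phi> (int j) + ?c \<phi> (- int j)" if "0 < j" for \<phi> j
  proof -
    have "{i \<in> I. nat \<bar>\<phi> i\<bar> = j} = {i \<in> I. \<phi> i = int j} \<union> {i \<in> I. \<phi> i = - int j}" using that by auto
    then show ?thesis using fin that by (simp only:) (subst sum.union_disjoint, auto)
  qed
  have zero: "(\<Sum>i\<in>{i \<in> I. nat \<bar>\<phi> i\<bar> = 0}. m i) = 0" "?c \<phi> 0 = 0" if "\<phi> \<in> I \<rightarrow>\<^sub>E {a. a \<noteq> 0}" for \<phi>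
  proof -
    have "{i \<in> I. nat \<bar>\<phi> i\<bar> = 0} = {}" "{i \<in> I. \<phi> i = 0} = {}" using that by (auto simp: PiE_def Pi_def)
    then show "(\<Sum>i\<in>{i \<in> I. nat \<bar>\<phi> i\<bar> = 0}. m i) = 0" "?c \<phi> 0 = 0" by (simp_all only: sum.empty)
  qed
  have iff: "\<phi> \<in> abs_fns I m \<alpha> \<longleftrightarrow> ?c \<phi> \<in> signed_contents \<alpha>" if \<phi>: "\<phi> \<in> I \<rightarrow>\<^sub>E {a. a \<noteq> 0}" for \<phi>
  proof -
    have "\<phi> \<in> abs_fns I m \<alpha> \<longleftrightarrow> (\<forall>j. \<alpha> j = (\<Sum>i\<in>{i \<in> I. nat \<bar>\<phi> i\<bar> = j}. m i))"
      using \<phi> by (simp add: abs_fns_def)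
    also have "\<dots> \<longleftrightarrow> (\<forall>j>0. \<alpha> j = (\<Sum>i\<in>{i \<in> I. nat \<bar>\<phi> i\<bar> = j}. m i))"
      using zero(1)[OF \<phi>] \<alpha>(2) by (metis gr0I)
    also have "\<dots> \<longleftrightarrow> ?c \<phi> \<in> signed_contents \<alpha>"
      using zero(2)[OF \<phi>] split[of _ \<phi>] by (auto simp: signed_contents_def)
    finally show ?thesis .
  qed
  have fib: "letter_fns I m \<gamma> = {\<phi> \<in> abs_fns I m \<alpha>. ?c \<phi> = \<gamma>}" if "\<gamma> \<in> signed_contents \<alpha>" for \<gamma>
  proof (rule set_eqI)
    fix \<phi>
    have "\<phi> \<in> letter_fns I m \<gamma> \<longleftrightarrow> \<phi> \<in> I \<rightarrow>\<^sub>E {a. a \<noteq> 0} \<and> ?c \<phi> = \<gamma>"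
      by (auto simp: letter_fns_def fun_eq_iff)
    moreover have "\<phi> \<in> abs_fns I m \<alpha> \<Longrightarrow> \<phi> \<in> I \<rightarrow>\<^sub>E {a. a \<noteq> 0}" by (simp add: abs_fns_def)
    ultimately show "\<phi> \<in> letter_fns I m \<gamma> \<longleftrightarrow> \<phi> \<in> {\<phi> \<in> abs_fns I m \<alpha>. ?c \<phi> = \<gamma>}"
      using iff that by auto
  qed
  have finA: "finite (abs_fns I m \<alpha>)" by (rule finite_abs_fns[OF fin m \<alpha>(1)])
  have pos: "(\<Sum>i\<in>{i \<in> I. 0 < \<phi> i}. m i) = (\<Sum>j\<in>{j. \<alpha> j \<noteq> 0}. ?c \<phi> (int j))" if \<phi>: "\<phi> \<in> abs_fns I m \<alpha>" for \<phi>
  proof -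
    let ?I = "{i \<in> I. 0 < \<phi> i}"
    have "(\<Sum>j\<in>{j. \<alpha> j \<noteq> 0}. sum m {i \<in> ?I. nat \<bar>\<phi> i\<bar> = j}) = sum m ?I"
    proof (rule sum.group)
      show "(\<lambda>i. nat \<bar>\<phi> i\<bar>) ` ?I \<subseteq> {j. \<alpha> j \<noteq> 0}" using abs_fns_supp[OF fin m \<phi>] by blast
    qed (use fin \<alpha> in auto)
    moreover have "{i \<in> ?I. nat \<bar>\<phi> i\<bar> = j} = {i \<in> I. \<phi> i = int j}" if "j \<in> {j. \<alpha> j \<noteq> 0}" for j
    proof -
      have "0 < j" using that \<alpha>(2) by (cases "j = 0") auto
      then show ?thesis by auto
    qed
    ultimately show ?thesis by (metis (no_types, lifting) sum.cong)
  qed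
  have "(\<Sum>\<phi>\<in>abs_fns I m \<alpha>. q ^ (\<Sum>i\<in>{i \<in> I. 0 < \<phi> i}. m i) * w \<phi>) =
     (\<Sum>\<gamma>\<in>signed_contents \<alpha>. \<Sum>\<phi>\<in>{\<phi> \<in> abs_fns I m \<alpha>. ?c \<phi> = \<gamma>}. q ^ (\<Sum>i\<in>{i \<in> I. 0 < \<phi> i}. m i) * w \<phi>)"
  proof (rule sum.group[symmetric, OF finA finite_signed_contents[OF \<alpha>(1)]])
    show "(\<lambda>\<phi>. ?c \<phi>) ` abs_fns I m \<alpha> \<subseteq> signed_contents \<alpha>" using iff by (auto simp: abs_fns_def)
  qed
  also have "\<dots> = (\<Sum>\<gamma>\<in>signed_contents \<alpha>. q ^ (\<Sum>j\<in>{j. \<alpha> j \<noteq> 0}. \<gamma> (int j)) * (\<Sum>\<phi>\<in>letter_fns I m \<gamma>. w \<phi>))"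
    by (rule sum.cong[OF refl]) (auto simp: fib pos sum_distrib_left intro!: sum.cong)
  finally show ?thesis .
qed

text \<open>In every comparison of two entries made by the statistics the first argument sits at the
  later cell, and comparisons with the letter 0 on top are false; so agreement on pairs y < x
  suffices.\<close>

lemma maj_quinv_cong:
  assumes lam: "is_partition lam"
    and I: "\<And>x y. x \<in> dg lam \<Longrightarrow> y \<in> dg lam \<Longrightarrow> y < x \<Longrightarrow> Ind (\<sigma> x) (\<sigma> y) \<longleftrightarrow> Ind (\<tau> x) (\<tau> y)"
  shows "maj lam \<sigma> = maj lam \<tau>" "quinv lam \<sigma> = quinv lam \<tau>"
proof -
  have cell: "(r, i) \<in> dg lam" if "1 \<le> r" "1 \<le> i" "i \<le> rowlen lam r" for r i
    using that dg_iff[OF lam] by simp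
  have anti: "rowlen lam (r + 1) \<le> rowlen lam r" for r by (rule rowlen_antimono) simp
  show "maj lam \<sigma> = maj lam \<tau>"
    unfolding maj_eq_sum_rows[OF lam]
  proof (intro sum.cong refl)
    fix r i assume "r \<in> {1..height lam}" "i \<in> {1..rowlen lam (r + 1)}"
    then have "(r + 1, i) \<in> dg lam" "(r, i) \<in> dg lam" using cell anti[of r] by auto
    then have "Ind (\<sigma> (r + 1, i)) (\<sigma> (r, i)) \<longleftrightarrow> Ind (\<tau> (r + 1, i)) (\<tau> (r, i))" by (intro I) auto
    then show "(if Ind (\<sigma> (r + 1, i)) (\<sigma> (r, i)) then col lam i - r else 0) =
      (if Ind (\<tau> (r + 1, i)) (\<tau> (r, i)) then col lam i - r else 0)" by simp
  qed
  have "int (quinv lam \<sigma>) = int (quinv lam \<tau>)"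
    unfolding quinv_eq_sum_rows[OF lam] quinv_row_def
  proof (intro sum.cong refl)
    fix r x assume r: "r \<in> {1..height lam}" and x: "x \<in> col_pairs (rowlen lam r)"
    obtain i j where ij: "x = (i, j)" "1 \<le> i" "i < j" "j \<le> rowlen lam r" using x by (auto simp: col_pairs_def)
    have c: "(r, i) \<in> dg lam" "(r, j) \<in> dg lam" using r ij cell by auto
    have "Ind (upper lam \<sigma> r i) (\<sigma> (r, l)) \<longleftrightarrow> Ind (upper lam \<tau> r i) (\<tau> (r, l))" if "l = i \<or> l = j" for l
    proof (cases "i \<le> rowlen lam (r + 1)")
      case True
      then have "(r + 1, i) \<in> dg lam" using r ij cell by auto
      then show ?thesis using True that c I[of "(r + 1, i)" "(r, l)"] by (auto simp: upper_def)
    qed (simp add: upper_def)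
    moreover have "Ind (\<sigma> (r, j)) (\<sigma> (r, i)) \<longleftrightarrow> Ind (\<tau> (r, j)) (\<tau> (r, i))" using c ij by (intro I) auto
    ultimately show "(case x of (i, j) \<Rightarrow> qd (upper lam \<sigma> r i) (\<sigma> (r, i)) (\<sigma> (r, j))) =
      (case x of (i, j) \<Rightarrow> qd (upper lam \<tau> r i) (\<tau> (r, i)) (\<tau> (r, j)))"
      by (simp add: ij qd_def)
  qed
  then show "quinv lam \<sigma> = quinv lam \<tau>" by simp
qed

definition full_coeff :: "nat list \<Rightarrow> 'a::comm_ring_1 \<Rightarrow> 'a \<Rightarrow> (nat \<Rightarrow> nat) \<Rightarrow> 'a" where
  "full_coeff lam q t \<alpha> =
     (\<Sum>\<sigma>\<in>{\<sigma>. \<sigma> \<in> dg lam \<rightarrow>\<^sub>E {a. a \<noteq> 0} \<and> has_content lam \<sigma> \<alpha>}.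
        (-1) ^ nneg lam \<sigma> * q ^ (npos lam \<sigma> + maj lam \<sigma>) * t ^ quinv lam \<sigma>)"

text \<open>The factor q^p for the number p of positive entries is left out: sign changes alter it,
  but it is determined by the signed content and restored afterwards.\<close>

definition filling_wt :: "nat list \<Rightarrow> 'a::comm_ring_1 \<Rightarrow> 'a \<Rightarrow> (nat \<times> nat \<Rightarrow> int) \<Rightarrow> 'a" where
  "filling_wt lam q t \<sigma> = (-1) ^ nneg lam \<sigma> * (q ^ maj lam \<sigma> * t ^ quinv lam \<sigma>)"

text \<open>The sign in the expansion of a product of factors p_m(X) - p_m(Y): a part sent to a
  negative letter contributes - 1, whatever its size.\<close>

definition sign_prod :: "nat \<Rightarrow> (nat \<Rightarrow> int) \<Rightarrow> 'a::comm_ring_1" where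
  "sign_prod l \<phi> = (\<Prod>i<l. if \<phi> i < 0 then - 1 else 1)"

text \<open>No letter in use separates p from - k, so only ties matter, and cells before
  \<open>u\<close> carry neither letter. At a later cell, p gives \<open>Ind\<close> false and - k
  gives \<open>Ind\<close> true against either value at \<open>u\<close>; this is why the first cell
  is chosen.\<close>

lemma filling_wt_flip:
  assumes lam: "is_partition lam" and pk: "0 < p" "0 < k" and \<sigma>: "\<sigma> \<in> dg lam \<rightarrow>\<^sub>E {a. a \<noteq> 0}"
    and u: "u \<in> dg lam" "\<sigma> u = p" and range: "\<forall>x\<in>dg lam. - k \<le> \<sigma> x \<and> \<sigma> x \<le> p"
    and first: "\<forall>x\<in>dg lam. x < u \<longrightarrow> \<sigma> x \<noteq> p \<and> \<sigma> x \<noteq> - k"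
  shows "filling_wt lam q t (\<sigma>(u := - k)) = - filling_wt lam q t \<sigma>"
proof -
  let ?\<tau> = "\<sigma>(u := - k)"
  have nz: "\<sigma> x \<noteq> 0" if "x \<in> dg lam" for x using \<sigma> that by auto
  have I: "Ind (\<sigma> x) (\<sigma> y) \<longleftrightarrow> Ind (?\<tau> x) (?\<tau> y)" if xy: "x \<in> dg lam" "y \<in> dg lam" "y < x" for x y
  proof -
    have r: "\<sigma> x \<noteq> 0" "\<sigma> y \<noteq> 0" "- k \<le> \<sigma> x" "\<sigma> x \<le> p" "- k \<le> \<sigma> y" "\<sigma> y \<le> p" using nz range xy by auto
    consider "x = u" "y \<noteq> u" | "y = u" "x \<noteq> u" | "x \<noteq> u" "y \<noteq> u" using xy by auto
    then show ?thesis
    proof cases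
      case 1
      then have "\<sigma> y \<noteq> p" "\<sigma> y \<noteq> - k" using first xy by auto
      then show ?thesis using 1 r pk u by (auto simp: Ind_def less2_def)
    next
      case 2
      then show ?thesis using r pk u by (auto simp: Ind_def less2_def)
    qed simp
  qed
  have "maj lam \<sigma> = maj lam ?\<tau>" "quinv lam \<sigma> = quinv lam ?\<tau>"
    by (rule maj_quinv_cong[OF lam], erule (2) I)+
  moreover have "nneg lam ?\<tau> = Suc (nneg lam \<sigma>)"
  proof -
    have "{x \<in> dg lam. ?\<tau> x < 0} = insert u {x \<in> dg lam. \<sigma> x < 0}" using u pk by auto
    moreover have "u \<notin> {x \<in> dg lam. \<sigma> x < 0}" using u pk by auto
    ultimately show ?thesis using finite_dg[OF lam] by (simp add: nneg_def)
  qed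
  ultimately show ?thesis by (simp add: filling_wt_def)
qed

lemma sign_prod_flip:
  assumes "i < l" "\<phi> i = p" "0 < p" "0 < k"
  shows "sign_prod l (\<phi>(i := - k)) = - (sign_prod l \<phi> :: 'a::comm_ring_1)"
proof -
  have i: "i \<in> {..<l}" using assms by simp
  have "(\<Prod>j\<in>{..<l} - {i}. if (\<phi>(i := - k)) j < 0 then - 1 else (1::'a)) = (\<Prod>j\<in>{..<l} - {i}. if \<phi> j < 0 then - 1 else 1)"
    by (rule prod.cong) auto
  then show ?thesis
    unfolding sign_prod_def using assms by (simp add: prod.remove[OF _ i])
qed

lemma card_letter_fns_eq_psum_coeff:
  assumes "\<And>a. a \<le> 0 \<Longrightarrow> \<gamma> a = 0" and pos: "\<forall>x\<in>set mu. 0 < x"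
  shows "card (letter_fns {..<length mu} ((!) mu) \<gamma>) = psum_coeff mu (\<lambda>j. \<gamma> (int j))"
    and "\<phi> \<in> letter_fns {..<length mu} ((!) mu) \<gamma> \<Longrightarrow> i < length mu \<Longrightarrow> 0 < \<phi> i"
proof -
  let ?l = "length mu"
  let ?L = "letter_fns {..<?l} ((!) mu) \<gamma>"
  let ?P = "{phi. length phi = ?l \<and> (\<forall>x\<in>set phi. 1 \<le> x) \<and>
      (\<forall>j. \<gamma> (int j) = (\<Sum>i\<in>{i. i < ?l \<and> phi ! i = j}. mu ! i))}"
  have p: "0 < \<phi> i" if "\<phi> \<in> ?L" "i < ?l" for \<phi> i
  proof (rule ccontr)
    assume "\<not> 0 < \<phi> i"
    then have "\<gamma> (\<phi> i) = 0" using assms(1) by simp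
    moreover have "\<gamma> (\<phi> i) = (\<Sum>j\<in>{j \<in> {..<?l}. \<phi> j = \<phi> i}. mu ! j)" using that by (simp add: letter_fns_def)
    ultimately have "mu ! i = 0" using that(2) by auto
    then show False using pos that(2) by (metis nth_mem less_irrefl)
  qed
  then show "\<phi> \<in> ?L \<Longrightarrow> i < ?l \<Longrightarrow> 0 < \<phi> i" .
  have "bij_betw (\<lambda>\<phi>. map (\<lambda>i. nat (\<phi> i)) [0..<?l]) ?L ?P"
  proof (rule bij_betw_byWitness[where f' = "\<lambda>phi. restrict (\<lambda>i. int (phi ! i)) {..<?l}"])
    show "\<forall>\<phi>\<in>?L. restrict (\<lambda>i. int (map (\<lambda>i. nat (\<phi> i)) [0..<?l] ! i)) {..<?l} = \<phi>"
    proof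
      fix \<phi> assume \<phi>: "\<phi> \<in> ?L"
      then have "\<phi> \<in> extensional {..<?l}" by (simp add: letter_fns_def PiE_def)
      then show "restrict (\<lambda>i. int (map (\<lambda>i. nat (\<phi> i)) [0..<?l] ! i)) {..<?l} = \<phi>"
        using p[OF \<phi>] by (auto simp: fun_eq_iff extensional_def less_imp_le)
    qed
    show "\<forall>phi\<in>?P. map (\<lambda>i. nat (restrict (\<lambda>i. int (phi ! i)) {..<?l} i)) [0..<?l] = phi"
      by (auto intro!: nth_equalityI)
    show "(\<lambda>\<phi>. map (\<lambda>i. nat (\<phi> i)) [0..<?l]) ` ?L \<subseteq> ?P"
    proof
      fix phi assume "phi \<in> (\<lambda>\<phi>. map (\<lambda>i. nat (\<phi> i)) [0..<?l]) ` ?L"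
      then obtain \<phi> where \<phi>: "\<phi> \<in> ?L" and phi: "phi = map (\<lambda>i. nat (\<phi> i)) [0..<?l]" by auto
      have "1 \<le> x" if "x \<in> set phi" for x using that p[OF \<phi>] by (force simp: phi)
      moreover have "\<gamma> (int j) = (\<Sum>i\<in>{i. i < ?l \<and> phi ! i = j}. mu ! i)" for j
      proof -
        have "{i. i < ?l \<and> phi ! i = j} = {i \<in> {..<?l}. \<phi> i = int j}" using p[OF \<phi>] by (fastforce simp: phi)
        then show ?thesis using \<phi> by (simp add: letter_fns_def)
      qed
      ultimately show "phi \<in> ?P" by (simp add: phi)
    qed
    show "(\<lambda>phi. restrict (\<lambda>i. int (phi ! i)) {..<?l}) ` ?P \<subseteq> ?L"
    proof
      fix \<phi> assume "\<phi> \<in> (\<lambda>phi. restrict (\<lambda>i. int (phi ! i)) {..<?l}) ` ?P"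
      then obtain phi where phi: "phi \<in> ?P" and \<phi>: "\<phi> = restrict (\<lambda>i. int (phi ! i)) {..<?l}" by auto
      have ge: "1 \<le> phi ! i" if "i < ?l" for i using phi that by (metis (mono_tags, lifting) mem_Collect_eq nth_mem)
      have "\<gamma> a = (\<Sum>i\<in>{i \<in> {..<?l}. \<phi> i = a}. mu ! i)" for a
      proof (cases "0 < a")
        case True
        then have "{i \<in> {..<?l}. \<phi> i = a} = {i. i < ?l \<and> phi ! i = nat a}" by (auto simp: \<phi>)
        moreover have "\<gamma> (int (nat a)) = (\<Sum>i\<in>{i. i < ?l \<and> phi ! i = nat a}. mu ! i)" using phi by blast
        ultimately show ?thesis using True by simp
      next
        case False
        then have e: "{i \<in> {..<?l}. \<phi> i = a} = {}" using ge by (force simp: \<phi>)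
        show ?thesis unfolding e using assms(1)[of a] False by simp
      qed
      moreover have "\<phi> \<in> {..<?l} \<rightarrow>\<^sub>E {a. a \<noteq> 0}" using ge by (force simp: \<phi>)
      ultimately show "\<phi> \<in> ?L" by (simp add: letter_fns_def)
    qed
  qed
  then show "card ?L = psum_coeff mu (\<lambda>j. \<gamma> (int j))"
    unfolding psum_coeff_def by (rule bij_betw_same_card)
qed

lemma sum_sign_prod_positive:
  assumes "\<And>a. a \<le> 0 \<Longrightarrow> \<gamma> a = 0" and pos: "\<forall>x\<in>set mu. 0 < x"
  shows "(\<Sum>\<phi>\<in>letter_fns {..<length mu} ((!) mu) \<gamma>. sign_prod (length mu) \<phi>) =
    (of_nat (psum_coeff mu (\<lambda>j. \<gamma> (int j))) :: 'a::comm_ring_1)"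
proof -
  have "sign_prod (length mu) \<phi> = (1::'a)" if "\<phi> \<in> letter_fns {..<length mu} ((!) mu) \<gamma>" for \<phi>
    unfolding sign_prod_def
    by (rule prod.neutral) (use card_letter_fns_eq_psum_coeff(2)[OF assms that] in fastforce)
  then show ?thesis by (simp add: card_letter_fns_eq_psum_coeff(1)[OF assms])
qed

lemma sum_filling_wt_positive:
  assumes "\<And>a. a \<le> 0 \<Longrightarrow> \<gamma> a = 0" and lam: "is_partition lam"
  shows "(\<Sum>\<sigma>\<in>letter_fns (dg lam) (\<lambda>_. 1) \<gamma>. filling_wt lam q t \<sigma>) = C_coeff lam q t (\<lambda>j. \<gamma> (int j))"
proof -
  have fin: "finite (dg lam)" by (rule finite_dg[OF lam])
  have pos: "0 < \<sigma> u" if \<sigma>: "\<sigma> \<in> letter_fns (dg lam) (\<lambda>_. 1) \<gamma>" and u: "u \<in> dg lam" for \<sigma> u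
  proof (rule ccontr)
    assume "\<not> 0 < \<sigma> u"
    then have "\<gamma> (\<sigma> u) = 0" using assms(1) by simp
    moreover have "\<gamma> (\<sigma> u) = card {v \<in> dg lam. \<sigma> v = \<sigma> u}" using \<sigma> by (simp add: letter_fns_def)
    ultimately show False using fin u by auto
  qed
  have "letter_fns (dg lam) (\<lambda>_. 1) \<gamma> = {\<sigma>. \<sigma> \<in> dg lam \<rightarrow>\<^sub>E {a. 0 < a} \<and> has_content lam \<sigma> (\<lambda>j. \<gamma> (int j))}"
  proof (intro set_eqI iffI)
    fix \<sigma> assume \<sigma>: "\<sigma> \<in> letter_fns (dg lam) (\<lambda>_. 1) \<gamma>"
    have "\<gamma> (int j) = card {u \<in> dg lam. nat \<bar>\<sigma> u\<bar> = j}" for j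
    proof -
      have "nat \<bar>\<sigma> u\<bar> = j \<longleftrightarrow> \<sigma> u = int j" if "u \<in> dg lam" for u using pos[OF \<sigma> that] by auto
      then have "{u \<in> dg lam. nat \<bar>\<sigma> u\<bar> = j} = {u \<in> dg lam. \<sigma> u = int j}" by blast
      then show ?thesis using \<sigma> by (simp add: letter_fns_def)
    qed
    then show "\<sigma> \<in> {\<sigma>. \<sigma> \<in> dg lam \<rightarrow>\<^sub>E {a. 0 < a} \<and> has_content lam \<sigma> (\<lambda>j. \<gamma> (int j))}"
      using \<sigma> pos[OF \<sigma>] by (auto simp: letter_fns_def has_content_def PiE_def)
  next
    fix \<sigma> assume \<sigma>: "\<sigma> \<in> {\<sigma>. \<sigma> \<in> dg lam \<rightarrow>\<^sub>E {a. 0 < a} \<and> has_content lam \<sigma> (\<lambda>j. \<gamma> (int j))}"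
    then have p: "0 < \<sigma> u" if "u \<in> dg lam" for u using that by auto
    have "\<gamma> a = card {u \<in> dg lam. \<sigma> u = a}" for a
    proof (cases "0 < a")
      case True
      then have "{u \<in> dg lam. \<sigma> u = a} = {u \<in> dg lam. nat \<bar>\<sigma> u\<bar> = nat a}" using p by force
      moreover have "\<gamma> (int (nat a)) = card {u \<in> dg lam. nat \<bar>\<sigma> u\<bar> = nat a}" using \<sigma> unfolding has_content_def by blast
      ultimately show ?thesis using True by simp
    next
      case False
      then have e: "{u \<in> dg lam. \<sigma> u = a} = {}" using p by force
      show ?thesis unfolding e using assms(1)[of a] False by simp
    qed
    then show "\<sigma> \<in> letter_fns (dg lam) (\<lambda>_. 1) \<gamma>" using \<sigma> by (auto simp: letter_fns_def PiE_def Pi_def)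
  qed
  moreover have "filling_wt lam q t \<sigma> = q ^ maj lam \<sigma> * t ^ quinv lam \<sigma>" if "\<sigma> \<in> letter_fns (dg lam) (\<lambda>_. 1) \<gamma>" for \<sigma>
  proof -
    have e: "{u \<in> dg lam. \<sigma> u < 0} = {}" using pos[OF that] by force
    show ?thesis unfolding filling_wt_def nneg_def e by simp
  qed
  ultimately show ?thesis unfolding C_coeff_def by (metis (no_types, lifting) sum.cong)
qed

text \<open>Both sides are coefficients of f[X - Y]. They satisfy the same cancellation relations
  and agree on contents without negative letters, where the claim is the hypothesis on
  \<open>C_coeff\<close>; so their difference vanishes everywhere.\<close>

lemma super_content_sum:
  fixes q t :: "'a::comm_ring_1"
  assumes lam: "is_partition lam" and C: "C_coeff lam q t = pcomb n c"
    and \<gamma>: "finite {a. \<gamma> a \<noteq> 0}" "\<gamma> 0 = 0"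
  shows "(\<Sum>\<sigma>\<in>letter_fns (dg lam) (\<lambda>_. 1) \<gamma>. filling_wt lam q t \<sigma>) =
    (\<Sum>mu\<in>partitions_of n. c mu * (\<Sum>\<phi>\<in>letter_fns {..<length mu} ((!) mu) \<gamma>. sign_prod (length mu) \<phi>))"
proof -
  let ?S = "\<lambda>\<gamma>. \<Sum>\<sigma>\<in>letter_fns (dg lam) (\<lambda>_. 1) \<gamma>. filling_wt lam q t \<sigma>"
  let ?R = "\<lambda>mu \<gamma>. \<Sum>\<phi>\<in>letter_fns {..<length mu} ((!) mu) \<gamma>. sign_prod (length mu) \<phi> :: 'a"
  let ?T = "\<lambda>\<gamma>. ?S \<gamma> - (\<Sum>mu\<in>partitions_of n. c mu * ?R mu \<gamma>)"
  have pos: "\<forall>x\<in>set mu. 0 < x" if "mu \<in> partitions_of n" for mu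
    using that by (auto simp: partitions_of_def is_partition_def)
  have "cancelling ?T"
    unfolding cancelling_def
  proof (intro allI impI)
    fix p k :: int and b :: nat and \<gamma> :: "int \<Rightarrow> nat"
    assume h: "0 < p" "0 < k" "0 < b" and g: "\<forall>a. \<gamma> a \<noteq> 0 \<longrightarrow> - k < a \<and> a < p"
    let ?g = "\<lambda>c. \<gamma>(p := b - c, - k := c)"
    have S: "(\<Sum>c\<le>b. ?S (?g c)) = 0"
    proof (rule sum_letter_fns_cancel[OF finite_dg[OF lam] _ h])
      show "- k < a \<and> a < p" if "\<gamma> a \<noteq> 0" for a using g that by blast
      fix \<sigma> u assume "\<sigma> \<in> dg lam \<rightarrow>\<^sub>E {a. a \<noteq> 0}" "u \<in> dg lam" "\<sigma> u = p" "\<forall>j\<in>dg lam. - k \<le> \<sigma> j \<and> \<sigma> j \<le> p"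
        "\<forall>j\<in>dg lam. j < u \<longrightarrow> \<sigma> j \<noteq> p \<and> \<sigma> j \<noteq> - k"
      then show "filling_wt lam q t (\<sigma>(u := - k)) = - filling_wt lam q t \<sigma>"
        by (rule filling_wt_flip[OF lam h(1,2)])
    qed simp
    have R: "(\<Sum>c\<le>b. ?R mu (?g c)) = 0" if "mu \<in> partitions_of n" for mu
    proof (rule sum_letter_fns_cancel[OF _ _ h])
      show "- k < a \<and> a < p" if "\<gamma> a \<noteq> 0" for a using g that by blast
      show "0 < mu ! i" if "i \<in> {..<length mu}" for i using pos[OF \<open>mu \<in> partitions_of n\<close>] that by simp
      fix \<phi> i assume "i \<in> {..<length mu}" "\<phi> i = p"
      then show "sign_prod (length mu) (\<phi>(i := - k)) = - (sign_prod (length mu) \<phi> :: 'a)"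
        by (intro sign_prod_flip[OF _ _ h(1,2)]) auto
    qed simp
    have "(\<Sum>d\<le>b. ?T (?g d)) = (\<Sum>d\<le>b. ?S (?g d)) - (\<Sum>mu\<in>partitions_of n. c mu * (\<Sum>d\<le>b. ?R mu (?g d)))"
    proof -
      have "(\<Sum>d\<le>b. \<Sum>mu\<in>partitions_of n. c mu * ?R mu (?g d)) = (\<Sum>mu\<in>partitions_of n. \<Sum>d\<le>b. c mu * ?R mu (?g d))"
        by (rule sum.swap)
      then show ?thesis by (simp only: sum_subtractf sum_distrib_left)
    qed
    also have "\<dots> = 0" unfolding S by (simp add: R)
    finally show "(\<Sum>d\<le>b. ?T (?g d)) = 0" .
  qed
  moreover have "?T \<gamma> = 0" if "finite {a. \<gamma> a \<noteq> 0}" "\<And>a. a \<le> 0 \<Longrightarrow> \<gamma> a = 0" for \<gamma>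
  proof -
    have "?S \<gamma> = pcomb n c (\<lambda>j. \<gamma> (int j))"
      using sum_filling_wt_positive[OF that(2) lam, where q = q and t = t] C by simp
    also have "\<dots> = (\<Sum>mu\<in>partitions_of n. c mu * ?R mu \<gamma>)"
      unfolding pcomb_def by (intro sum.cong refl) (simp add: sum_sign_prod_positive[OF that(2) pos])
    finally show ?thesis by simp
  qed
  ultimately have "?T \<gamma> = 0" using cancelling_eq_0[of ?T \<gamma>] \<gamma> by blast
  then show ?thesis by simp
qed

text \<open>Once the absolute values are fixed, each part m chooses its sign independently and
  contributes q^m for a positive and - 1 for a negative letter, in total q^m - 1.\<close>

lemma sum_abs_fns_sign_prod:
  fixes q :: "'a::comm_ring_1"
  assumes pos: "\<forall>x\<in>set mu. 0 < x" and \<alpha>: "\<alpha> 0 = 0" "finite {j. \<alpha> j \<noteq> 0}"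
  shows "(\<Sum>\<phi>\<in>abs_fns {..<length mu} ((!) mu) \<alpha>. q ^ (\<Sum>i\<in>{i \<in> {..<length mu}. 0 < \<phi> i}. mu ! i) * sign_prod (length mu) \<phi>)
    = prod_list (map (\<lambda>m. q ^ m - 1) mu) * of_nat (psum_coeff mu \<alpha>)"
proof -
  let ?l = "length mu" and ?I = "{..<length mu}"
  let ?g = "\<lambda>a::int. if 0 < a then \<alpha> (nat a) else 0"
  let ?L = "letter_fns ?I ((!) mu) ?g"
  let ?f = "\<lambda>i a. if a < (0::int) then - 1 else q ^ (mu ! i)"
  let ?abs = "\<lambda>\<phi>. restrict (\<lambda>i. \<bar>\<phi> i\<bar>) ?I"
  have Lpos: "0 < \<psi> i" if "\<psi> \<in> ?L" "i < ?l" for \<psi> i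
    by (rule card_letter_fns_eq_psum_coeff(2)[OF _ pos that]) simp
  have trm: "q ^ (\<Sum>i\<in>{i \<in> ?I. 0 < \<phi> i}. mu ! i) * sign_prod ?l \<phi> = (\<Prod>i\<in>?I. ?f i (\<phi> i))"
    if "\<phi> \<in> ?I \<rightarrow>\<^sub>E {a. a \<noteq> 0}" for \<phi>
  proof -
    have "q ^ (\<Sum>i\<in>{i \<in> ?I. 0 < \<phi> i}. mu ! i) = (\<Prod>i\<in>?I. if 0 < \<phi> i then q ^ (mu ! i) else 1)"
      unfolding power_sum by (subst prod.inter_filter) auto
    then have "q ^ (\<Sum>i\<in>{i \<in> ?I. 0 < \<phi> i}. mu ! i) * sign_prod ?l \<phi> =
      (\<Prod>i\<in>?I. (if 0 < \<phi> i then q ^ (mu ! i) else 1) * (if \<phi> i < 0 then - 1 else 1))"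
      by (simp add: sign_prod_def prod.distrib)
    also have "\<dots> = (\<Prod>i\<in>?I. ?f i (\<phi> i))"
    proof (rule prod.cong[OF refl])
      fix i assume "i \<in> ?I"
      then have "\<phi> i \<noteq> 0" using that by auto
      then show "(if 0 < \<phi> i then q ^ (mu ! i) else 1) * (if \<phi> i < 0 then - 1 else 1) = ?f i (\<phi> i)" by auto
    qed
    finally show ?thesis .
  qed
  have absL: "?abs \<phi> \<in> ?L \<longleftrightarrow> \<phi> \<in> abs_fns ?I ((!) mu) \<alpha>" if \<phi>: "\<phi> \<in> ?I \<rightarrow>\<^sub>E {a. a \<noteq> 0}" for \<phi>
  proof -
    have nz: "\<phi> i \<noteq> 0" if "i \<in> ?I" for i using \<phi> that by auto
    have "?abs \<phi> \<in> ?L \<longleftrightarrow> (\<forall>a. ?g a = (\<Sum>i\<in>{i \<in> ?I. ?abs \<phi> i = a}. mu ! i))"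
      using nz by (auto simp: letter_fns_def)
    also have "\<dots> \<longleftrightarrow> (\<forall>j. \<alpha> j = (\<Sum>i\<in>{i \<in> ?I. nat \<bar>\<phi> i\<bar> = j}. mu ! i))"
    proof (intro iffI allI)
      fix j assume h: "\<forall>a. ?g a = (\<Sum>i\<in>{i \<in> ?I. ?abs \<phi> i = a}. mu ! i)"
      have "{i \<in> ?I. nat \<bar>\<phi> i\<bar> = j} = {i \<in> ?I. ?abs \<phi> i = int j}" by auto
      then show "\<alpha> j = (\<Sum>i\<in>{i \<in> ?I. nat \<bar>\<phi> i\<bar> = j}. mu ! i)"
        using h[rule_format, of "int j"] \<alpha>(1) by (cases "j = 0") auto
    next
      fix a assume h: "\<forall>j. \<alpha> j = (\<Sum>i\<in>{i \<in> ?I. nat \<bar>\<phi> i\<bar> = j}. mu ! i)"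
      show "?g a = (\<Sum>i\<in>{i \<in> ?I. ?abs \<phi> i = a}. mu ! i)"
      proof (cases "0 < a")
        case True
        then have "{i \<in> ?I. nat \<bar>\<phi> i\<bar> = nat a} = {i \<in> ?I. ?abs \<phi> i = a}" by auto
        then show ?thesis using True h by simp
      next
        case False
        then have e: "{i \<in> ?I. ?abs \<phi> i = a} = {}" using nz by force
        show ?thesis unfolding e using False by simp
      qed
    qed
    also have "\<dots> \<longleftrightarrow> \<phi> \<in> abs_fns ?I ((!) mu) \<alpha>" using \<phi> by (simp add: abs_fns_def)
    finally show ?thesis .
  qed
  have fib: "{\<phi> \<in> abs_fns ?I ((!) mu) \<alpha>. ?abs \<phi> = \<psi>} = PiE ?I (\<lambda>i. {\<psi> i, - \<psi> i})" if \<psi>: "\<psi> \<in> ?L" for \<psi>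
  proof (intro set_eqI iffI)
    fix \<phi> assume \<phi>: "\<phi> \<in> {\<phi> \<in> abs_fns ?I ((!) mu) \<alpha>. ?abs \<phi> = \<psi>}"
    then have "\<psi> = ?abs \<phi>" "\<phi> \<in> extensional ?I" by (auto simp: abs_fns_def PiE_def)
    then show "\<phi> \<in> PiE ?I (\<lambda>i. {\<psi> i, - \<psi> i})" by (auto simp: PiE_def)
  next
    fix \<phi> assume \<phi>: "\<phi> \<in> PiE ?I (\<lambda>i. {\<psi> i, - \<psi> i})"
    have v: "\<phi> i = \<psi> i \<or> \<phi> i = - \<psi> i" "0 < \<psi> i" if "i \<in> ?I" for i
      using \<phi> that Lpos[OF \<psi>, of i] by auto
    have "\<phi> i \<noteq> 0" if "i \<in> ?I" for i using v[OF that] by auto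
    then have p: "\<phi> \<in> ?I \<rightarrow>\<^sub>E {a. a \<noteq> 0}" using \<phi> by (auto simp: PiE_def)
    have ex: "\<psi> \<in> extensional ?I" using \<psi> by (simp add: letter_fns_def PiE_def)
    have "?abs \<phi> = \<psi>"
    proof
      fix i show "?abs \<phi> i = \<psi> i" using v[of i] ex by (auto simp: extensional_def)
    qed
    then show "\<phi> \<in> {\<phi> \<in> abs_fns ?I ((!) mu) \<alpha>. ?abs \<phi> = \<psi>}" using absL[OF p] \<psi> by simp
  qed
  have abs_mem: "\<phi> \<in> ?I \<rightarrow>\<^sub>E {a. a \<noteq> 0}" if "\<phi> \<in> abs_fns ?I ((!) mu) \<alpha>" for \<phi>
    using that by (simp add: abs_fns_def)
  have finL: "finite ?L"
  proof (rule finite_subset)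
    show "?L \<subseteq> ?I \<rightarrow>\<^sub>E int ` {j. \<alpha> j \<noteq> 0}"
    proof
      fix \<psi> assume \<psi>: "\<psi> \<in> ?L"
      have "\<psi> i \<in> int ` {j. \<alpha> j \<noteq> 0}" if i: "i \<in> ?I" for i
      proof -
        have "?g (\<psi> i) = (\<Sum>j\<in>{j \<in> ?I. \<psi> j = \<psi> i}. mu ! j)" using \<psi> by (simp add: letter_fns_def)
        moreover have "mu ! i \<noteq> 0" using pos i by (metis lessThan_iff less_irrefl nth_mem)
        ultimately have "?g (\<psi> i) \<noteq> 0" using i by (auto simp: sum_eq_0_iff)
        then have "0 < \<psi> i" "\<alpha> (nat (\<psi> i)) \<noteq> 0" by (auto split: if_splits)
        then show ?thesis by (intro image_eqI[of _ _ "nat (\<psi> i)"]) auto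
      qed
      then show "\<psi> \<in> ?I \<rightarrow>\<^sub>E int ` {j. \<alpha> j \<noteq> 0}" using \<psi> by (auto simp: letter_fns_def PiE_def)
    qed
    show "finite (?I \<rightarrow>\<^sub>E int ` {j. \<alpha> j \<noteq> 0})" using \<alpha> by (intro finite_PiE) auto
  qed
  have finA: "finite (abs_fns ?I ((!) mu) \<alpha>)"
    by (rule finite_abs_fns[OF _ _ \<alpha>(2)]) (use pos in auto)
  have "(\<Sum>\<phi>\<in>abs_fns ?I ((!) mu) \<alpha>. q ^ (\<Sum>i\<in>{i \<in> ?I. 0 < \<phi> i}. mu ! i) * sign_prod ?l \<phi>) =
    (\<Sum>\<phi>\<in>abs_fns ?I ((!) mu) \<alpha>. \<Prod>i\<in>?I. ?f i (\<phi> i))"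
    by (rule sum.cong[OF refl]) (use trm abs_mem in blast)
  also have "\<dots> = (\<Sum>\<psi>\<in>?L. \<Sum>\<phi>\<in>{\<phi> \<in> abs_fns ?I ((!) mu) \<alpha>. ?abs \<phi> = \<psi>}. \<Prod>i\<in>?I. ?f i (\<phi> i))"
    by (rule sum.group[symmetric, OF finA finL]) (use absL abs_mem in blast)
  also have "\<dots> = (\<Sum>\<psi>\<in>?L. \<Prod>i\<in>?I. q ^ (mu ! i) - 1)"
  proof (rule sum.cong[OF refl])
    fix \<psi> assume \<psi>: "\<psi> \<in> ?L"
    have "(\<Sum>\<phi>\<in>{\<phi> \<in> abs_fns ?I ((!) mu) \<alpha>. ?abs \<phi> = \<psi>}. \<Prod>i\<in>?I. ?f i (\<phi> i)) = (\<Prod>i\<in>?I. \<Sum>a\<in>{\<psi> i, - \<psi> i}. ?f i a)"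
      unfolding fib[OF \<psi>] by (rule prod_sum_PiE[symmetric]) auto
    also have "\<dots> = (\<Prod>i\<in>?I. q ^ (mu ! i) - 1)"
      by (rule prod.cong[OF refl]) (use Lpos[OF \<psi>] in force)
    finally show "(\<Sum>\<phi>\<in>{\<phi> \<in> abs_fns ?I ((!) mu) \<alpha>. ?abs \<phi> = \<psi>}. \<Prod>i\<in>?I. ?f i (\<phi> i)) = (\<Prod>i\<in>?I. q ^ (mu ! i) - 1)" .
  qed
  also have "\<dots> = of_nat (card ?L) * (\<Prod>i\<in>?I. q ^ (mu ! i) - 1)" by simp
  also have "card ?L = psum_coeff mu (\<lambda>j. ?g (int j))"
    by (rule card_letter_fns_eq_psum_coeff(1)[OF _ pos]) simp
  also have "(\<lambda>j. ?g (int j)) = \<alpha>" using \<alpha>(1) by (auto simp: fun_eq_iff)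
  also have "(\<Prod>i\<in>?I. q ^ (mu ! i) - 1) = prod_list (map (\<lambda>m. q ^ m - 1) mu)"
    by (simp add: prod.list_conv_set_nth atLeast0LessThan)
  finally show ?thesis by (simp add: mult.commute)
qed

lemma psum_coeff_nonzero:
  assumes "psum_coeff mu \<alpha> \<noteq> 0"
  shows "\<alpha> 0 = 0" "finite {j. \<alpha> j \<noteq> 0}"
proof -
  obtain phi where phi: "length phi = length mu" "\<forall>x\<in>set phi. 1 \<le> x"
    "\<And>j. \<alpha> j = (\<Sum>i\<in>{i. i < length mu \<and> phi ! i = j}. mu ! i)"
    using psum_coeff_obtain[OF assms] by blast
  have e: "{i. i < length mu \<and> phi ! i = j} = {}" if "j \<notin> set phi" for j
    using that phi(1) by (auto simp: in_set_conv_nth)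
  have z: "\<alpha> j = 0" if "j \<notin> set phi" for j using phi(3)[of j] e[OF that] by simp
  have "0 \<notin> set phi" using phi(2) by auto
  then show "\<alpha> 0 = 0" by (rule z)
  have "{j. \<alpha> j \<noteq> 0} \<subseteq> set phi"
  proof
    fix j assume "j \<in> {j. \<alpha> j \<noteq> 0}"
    then show "j \<in> set phi" using z[of j] by auto
  qed
  then show "finite {j. \<alpha> j \<noteq> 0}" by (rule finite_subset) simp
qed

lemma pleth_eq_full_coeff:
  fixes q t :: "'a::comm_ring_1"
  assumes lam: "is_partition lam" and C: "C_coeff lam q t = pcomb n c"
  shows "pleth_qm1 q n c = full_coeff lam q t"
proof
  fix \<alpha> :: "nat \<Rightarrow> nat"
  have fin: "finite (dg lam)" by (rule finite_dg[OF lam])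
  have set: "{\<sigma>. \<sigma> \<in> dg lam \<rightarrow>\<^sub>E {a. a \<noteq> 0} \<and> has_content lam \<sigma> \<alpha>} = abs_fns (dg lam) (\<lambda>_. 1) \<alpha>"
    by (auto simp: abs_fns_def has_content_def)
  show "pleth_qm1 q n c \<alpha> = full_coeff lam q t \<alpha>"
  proof (cases "\<alpha> 0 = 0 \<and> finite {j. \<alpha> j \<noteq> 0}")
    case True
    then have \<alpha>: "\<alpha> 0 = 0" "finite {j. \<alpha> j \<noteq> 0}" by auto
    have pos: "\<forall>x\<in>set mu. 0 < x" if "mu \<in> partitions_of n" for mu
      using that by (auto simp: partitions_of_def is_partition_def)
    let ?R = "\<lambda>mu \<gamma>. \<Sum>\<phi>\<in>letter_fns {..<length mu} ((!) mu) \<gamma>. sign_prod (length mu) \<phi> :: 'a"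
    let ?p = "\<lambda>\<gamma>. \<Sum>j\<in>{j. \<alpha> j \<noteq> 0}. \<gamma> (int j)"
    have "full_coeff lam q t \<alpha> =
      (\<Sum>\<sigma>\<in>abs_fns (dg lam) (\<lambda>_. 1) \<alpha>. q ^ (\<Sum>u\<in>{u \<in> dg lam. 0 < \<sigma> u}. 1) * filling_wt lam q t \<sigma>)"
      unfolding full_coeff_def set
      by (rule sum.cong) (simp_all add: npos_def filling_wt_def power_add mult_ac)
    also have "\<dots> = (\<Sum>\<gamma>\<in>signed_contents \<alpha>. q ^ ?p \<gamma> * (\<Sum>\<sigma>\<in>letter_fns (dg lam) (\<lambda>_. 1) \<gamma>. filling_wt lam q t \<sigma>))"
      by (rule sum_abs_fns_eq_signed[OF fin _ \<alpha>(2,1)]) simp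
    also have "\<dots> = (\<Sum>\<gamma>\<in>signed_contents \<alpha>. q ^ ?p \<gamma> * (\<Sum>mu\<in>partitions_of n. c mu * ?R mu \<gamma>))"
    proof (rule sum.cong[OF refl])
      fix \<gamma> assume \<gamma>: "\<gamma> \<in> signed_contents \<alpha>"
      have "finite {a. \<gamma> a \<noteq> 0}"
        by (rule finite_subset[OF finite_supp_signed_content[OF \<alpha>(2) \<gamma>]]) (use \<alpha>(2) in simp)
      moreover have "\<gamma> 0 = 0" using \<gamma> by (simp add: signed_contents_def)
      ultimately show "q ^ ?p \<gamma> * (\<Sum>\<sigma>\<in>letter_fns (dg lam) (\<lambda>_. 1) \<gamma>. filling_wt lam q t \<sigma>) =
        q ^ ?p \<gamma> * (\<Sum>mu\<in>partitions_of n. c mu * ?R mu \<gamma>)"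
        by (simp only: super_content_sum[OF lam C])
    qed
    also have "\<dots> = (\<Sum>mu\<in>partitions_of n. c mu * (\<Sum>\<gamma>\<in>signed_contents \<alpha>. q ^ ?p \<gamma> * ?R mu \<gamma>))"
    proof -
      have "(\<Sum>\<gamma>\<in>signed_contents \<alpha>. q ^ ?p \<gamma> * (\<Sum>mu\<in>partitions_of n. c mu * ?R mu \<gamma>)) =
        (\<Sum>\<gamma>\<in>signed_contents \<alpha>. \<Sum>mu\<in>partitions_of n. c mu * (q ^ ?p \<gamma> * ?R mu \<gamma>))"
        by (intro sum.cong refl) (simp only: sum_distrib_left mult.left_commute)
      also have "\<dots> = (\<Sum>mu\<in>partitions_of n. \<Sum>\<gamma>\<in>signed_contents \<alpha>. c mu * (q ^ ?p \<gamma> * ?R mu \<gamma>))"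
        by (rule sum.swap)
      finally show ?thesis by (simp only: sum_distrib_left)
    qed
    also have "\<dots> = (\<Sum>mu\<in>partitions_of n. c mu * (prod_list (map (\<lambda>m. q ^ m - 1) mu) * of_nat (psum_coeff mu \<alpha>)))"
    proof (intro sum.cong refl arg_cong2[of _ _ _ _ "(*)"])
      fix mu assume mu: "mu \<in> partitions_of n"
      have "(\<Sum>\<gamma>\<in>signed_contents \<alpha>. q ^ ?p \<gamma> * ?R mu \<gamma>) =
        (\<Sum>\<phi>\<in>abs_fns {..<length mu} ((!) mu) \<alpha>. q ^ (\<Sum>i\<in>{i \<in> {..<length mu}. 0 < \<phi> i}. mu ! i) * sign_prod (length mu) \<phi>)"
        by (rule sum_abs_fns_eq_signed[symmetric, OF _ _ \<alpha>(2,1)]) (use pos[OF mu] in auto)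
      also have "\<dots> = prod_list (map (\<lambda>m. q ^ m - 1) mu) * of_nat (psum_coeff mu \<alpha>)"
        by (rule sum_abs_fns_sign_prod[OF pos[OF mu] \<alpha>])
      finally show "(\<Sum>\<gamma>\<in>signed_contents \<alpha>. q ^ ?p \<gamma> * ?R mu \<gamma>) =
        prod_list (map (\<lambda>m. q ^ m - 1) mu) * of_nat (psum_coeff mu \<alpha>)" .
    qed
    also have "\<dots> = pleth_qm1 q n c \<alpha>" by (simp add: pleth_qm1_def mult.assoc)
    finally show ?thesis ..
  next
    case False
    \<comment> \<open>A vector with infinite support or with a nonzero entry at index 0 is no
      exponent vector; both sides vanish on it.\<close>
    have "abs_fns (dg lam) (\<lambda>_. 1) \<alpha> = {}"
    proof (rule ccontr)
      assume "abs_fns (dg lam) (\<lambda>_. 1) \<alpha> \<noteq> {}"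
      then obtain \<phi> where \<phi>: "\<phi> \<in> abs_fns (dg lam) (\<lambda>_. 1) \<alpha>" by blast
      have s: "{j. \<alpha> j \<noteq> 0} = (\<lambda>i. nat \<bar>\<phi> i\<bar>) ` dg lam" by (rule abs_fns_supp[OF fin _ \<phi>]) simp
      then have "finite {j. \<alpha> j \<noteq> 0}" using fin by simp
      moreover have "\<alpha> 0 = 0"
      proof (rule ccontr)
        assume "\<alpha> 0 \<noteq> 0"
        then have "0 \<in> (\<lambda>i. nat \<bar>\<phi> i\<bar>) ` dg lam" using s by blast
        then show False using \<phi> by (force simp: abs_fns_def)
      qed
      ultimately show False using False by simp
    qed
    then have "full_coeff lam q t \<alpha> = 0" unfolding full_coeff_def set by simp
    moreover have "psum_coeff mu \<alpha> = 0" for mu using psum_coeff_nonzero[of mu \<alpha>] False by blast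
    ultimately show ?thesis by (simp add: pleth_qm1_def)
  qed
qed

section \<open>Exchanging columns of equal height\<close>

lemma transpose_adjacent_simps:
  "transpose c (c + 1) c = c + 1" "transpose c (c + 1) (c + 1) = c"
  "i \<noteq> c \<Longrightarrow> i \<noteq> c + 1 \<Longrightarrow> transpose c (c + 1) i = (i::nat)"
  by (auto simp: transpose_def)

text \<open>The exchange permutes all pairs of columns except (c, c + 1), whose order it would
  reverse; only that pair changes its contribution.\<close>

lemma quinv_row_swap:
  assumes "1 \<le> c" "c + 1 \<le> n"
  shows "quinv_row n (u \<circ> transpose c (c + 1)) (v \<circ> transpose c (c + 1)) =
    quinv_row n u v + qd (u (c + 1)) (v (c + 1)) (v c) - qd (u c) (v c) (v (c + 1))"
proof -
  let ?s = "transpose c (c + 1)" and ?P = "col_pairs n - {(c, c + 1)}"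
  have mem: "(c, c + 1) \<in> col_pairs n" using assms by (auto simp: col_pairs_def)
  have split: "quinv_row n u' v' = qd (u' c) (v' c) (v' (c + 1)) + (\<Sum>(i, j)\<in>?P. qd (u' i) (v' i) (v' j))" for u' v'
    unfolding quinv_row_def by (subst sum.remove[OF _ mem]) auto
  have pres: "(?s i, ?s j) \<in> ?P" if "(i, j) \<in> ?P" for i j
    using that assms by (auto simp: col_pairs_def transpose_def)
  have "(\<Sum>(i, j)\<in>?P. qd (u (?s i)) (v (?s i)) (v (?s j))) = (\<Sum>(i, j)\<in>?P. qd (u i) (v i) (v j))"
  proof (rule sum.reindex_bij_witness[of _ "map_prod ?s ?s" "map_prod ?s ?s"])
    fix x assume x: "x \<in> ?P"
    obtain i j where ij: "x = (i, j)" by (cases x)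
    show "map_prod ?s ?s x \<in> ?P" "map_prod ?s ?s x \<in> ?P" using pres x unfolding ij map_prod_simp by blast+
    show "map_prod ?s ?s (map_prod ?s ?s x) = x" "map_prod ?s ?s (map_prod ?s ?s x) = x" by (simp_all add: ij)
    show "(case map_prod ?s ?s x of (i, j) \<Rightarrow> qd (u i) (v i) (v j)) = (case x of (i, j) \<Rightarrow> qd (u (?s i)) (v (?s i)) (v (?s j)))"
      by (simp add: ij)
  qed
  then show ?thesis
    unfolding split[of u v] split[of "u \<circ> ?s" "v \<circ> ?s"] by (simp add: comp_def)
qed

text \<open>Moving an upper entry x from column c + 1 to column c changes its contribution by (n -
  c) * (I(x, v(c + 1)) - I(x, v(c))), up to a term without x. The balance condition says that this
  amount is the same for both upper entries, so the two changes cancel.\<close>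

lemma quinv_row_swap_upper:
  assumes c: "1 \<le> c" "c + 1 \<le> n"
    and bal: "of_bool (Ind (u c) (v (c + 1))) + of_bool (Ind (u (c + 1)) (v c)) =
      (of_bool (Ind (u c) (v c)) + of_bool (Ind (u (c + 1)) (v (c + 1))) :: int)"
  shows "quinv_row n (u \<circ> transpose c (c + 1)) v = quinv_row n u v"
proof -
  let ?s = "transpose c (c + 1)"
  let ?h = "\<lambda>i x. \<Sum>j\<in>{i<..n}. qd x (v i) (v j)"
  have split: "quinv_row n u' v = ?h c (u' c) + ?h (c + 1) (u' (c + 1)) + (\<Sum>i\<in>{1..n} - {c} - {c + 1}. ?h i (u' i))" for u'
  proof -
    have "quinv_row n u' v = (\<Sum>i\<in>{1..n}. ?h i (u' i))" unfolding quinv_row_def by (rule sum_col_pairs)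
    also have "\<dots> = ?h c (u' c) + (\<Sum>i\<in>{1..n} - {c}. ?h i (u' i))" using c by (intro sum.remove) auto
    also have "(\<Sum>i\<in>{1..n} - {c}. ?h i (u' i)) = ?h (c + 1) (u' (c + 1)) + (\<Sum>i\<in>{1..n} - {c} - {c + 1}. ?h i (u' i))"
      using c by (intro sum.remove) auto
    finally show ?thesis by simp
  qed
  have rest: "(\<Sum>i\<in>{1..n} - {c} - {c + 1}. ?h i ((u \<circ> ?s) i)) = (\<Sum>i\<in>{1..n} - {c} - {c + 1}. ?h i (u i))"
  proof (rule sum.cong[OF refl])
    fix i assume "i \<in> {1..n} - {c} - {c + 1}"
    then have "?s i = i" by (auto simp: transpose_def)
    then show "?h i ((u \<circ> ?s) i) = ?h i (u i)" by simp
  qed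
  let ?I = "\<lambda>x y. of_bool (Ind x y) :: int"
  have hh: "?h c x = ?h (c + 1) x + int (n - c) * (?I x (v (c + 1)) - ?I x (v c)) +
     ((\<Sum>j\<in>{c<..n}. ?I (v j) (v c)) - (\<Sum>j\<in>{c + 1<..n}. ?I (v j) (v (c + 1))))" for x
  proof -
    have S: "{c<..n} = insert (c + 1) {c + 1<..n}" using c by auto
    have "?h c x = (\<Sum>j\<in>{c<..n}. ?I (v j) (v c)) + (\<Sum>j\<in>{c<..n}. ?I x (v j)) - int (n - c) * ?I x (v c)"
      by (simp add: qd_def sum.distrib sum_subtractf)
    also have "(\<Sum>j\<in>{c<..n}. ?I x (v j)) = ?I x (v (c + 1)) + (\<Sum>j\<in>{c + 1<..n}. ?I x (v j))"
      unfolding S by (subst sum.insert) auto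
    also have "(\<Sum>j\<in>{c + 1<..n}. ?I x (v j)) = ?h (c + 1) x - (\<Sum>j\<in>{c + 1<..n}. ?I (v j) (v (c + 1))) + int (n - (c + 1)) * ?I x (v (c + 1))"
      by (simp add: qd_def sum.distrib sum_subtractf)
    also have "int (n - (c + 1)) = int (n - c) - 1" using c by simp
    finally show ?thesis by (simp add: algebra_simps)
  qed
  have D: "?I (u c) (v (c + 1)) - ?I (u c) (v c) = ?I (u (c + 1)) (v (c + 1)) - ?I (u (c + 1)) (v c)"
    using bal by linarith
  have "?h c (u (c + 1)) + ?h (c + 1) (u c) = ?h c (u c) + ?h (c + 1) (u (c + 1))"
    unfolding hh[of "u c"] hh[of "u (c + 1)"] D by (simp only: ac_simps)
  then show ?thesis unfolding split[of u] split[of "u \<circ> ?s"] rest by simp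
qed

text \<open>Exchanging the two entries of row r + 1 over the fixed entries of row \<open>r\<close>
  keeps the number of descents in the two columns.\<close>

definition balanced :: "(nat \<times> nat \<Rightarrow> int) \<Rightarrow> nat \<Rightarrow> nat \<Rightarrow> bool" where
  "balanced \<sigma> c r \<longleftrightarrow>
    of_bool (Ind (\<sigma> (r + 1, c)) (\<sigma> (r, c + 1))) + of_bool (Ind (\<sigma> (r + 1, c + 1)) (\<sigma> (r, c))) =
    (of_bool (Ind (\<sigma> (r + 1, c)) (\<sigma> (r, c))) + of_bool (Ind (\<sigma> (r + 1, c + 1)) (\<sigma> (r, c + 1))) :: int)"

text \<open>The columns \<open>c\<close> and \<open>c + 1\<close> of equal height \<open>h\<close> are exchanged from the top down to the highest row
  below which exchanging the upper entries alone does not affect the statistics.\<close>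
definition swap_depth :: "nat \<Rightarrow> (nat \<times> nat \<Rightarrow> int) \<Rightarrow> nat \<Rightarrow> nat" where
  "swap_depth h \<sigma> c = Max (insert 1 {s \<in> {2..h}. balanced \<sigma> c (s - 1)})"

definition col_swap :: "nat \<Rightarrow> nat \<Rightarrow> (nat \<times> nat \<Rightarrow> int) \<Rightarrow> nat \<times> nat \<Rightarrow> int" where
  "col_swap h c \<sigma> = (\<lambda>(r, i). \<sigma> (r, if swap_depth h \<sigma> c \<le> r then transpose c (c + 1) i else i))"

text \<open>Over the fixed lower pair, \<open>qd\<close> is 0 or 1 for each of the two upper
  entries, and without balance the two values differ. Reversing the lower pair, whose entries are
  distinct, turns each value v into 1 - v. So the exchange of both rows restores the value that was
  there before.\<close>

lemma unbalanced_qd: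
  assumes "\<not> balanced \<sigma> c r"
  shows "qd (\<sigma> (r + 1, c + 1)) (\<sigma> (r, c + 1)) (\<sigma> (r, c)) = qd (\<sigma> (r + 1, c)) (\<sigma> (r, c)) (\<sigma> (r, c + 1))"
proof -
  let ?z = "\<sigma> (r, c)" and ?z' = "\<sigma> (r, c + 1)" and ?x = "\<sigma> (r + 1, c)" and ?y = "\<sigma> (r + 1, c + 1)"
  have ne: "?z \<noteq> ?z'" using assms by (auto simp: balanced_def)
  have b: "qd ?x ?z ?z' \<in> {0, 1}" "qd ?y ?z ?z' \<in> {0, 1}" unfolding quinv_cond_eq_qd[symmetric] by auto
  have "of_bool (Ind ?z ?z') = (1::int) - of_bool (Ind ?z' ?z)" using Ind_antisym[OF ne] by simp
  moreover have "e' + b1 - b2 = e + a2 - a1"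
    if "e' = 1 - e" "e + a2 - a1 \<in> {0, 1}" "e + b2 - b1 \<in> {0, 1}" "a2 + b1 \<noteq> a1 + b2" for e e' a1 a2 b1 b2 :: int
    using that by auto
  ultimately show ?thesis using assms b unfolding balanced_def qd_def by meson
qed

text \<open>The inequalities on row lengths say that the columns \<open>c\<close> and c + 1 both
  have height exactly \<open>h\<close>.\<close>

locale equal_columns =
  fixes lam :: "nat list" and h c :: nat
  assumes lam: "is_partition lam" and h: "1 \<le> h" and c: "rowlen lam (h + 1) < c" "c + 1 \<le> rowlen lam h"
begin

abbreviation s where "s \<equiv> transpose c (c + 1)"

lemma c_le: "r \<le> h \<Longrightarrow> c + 1 \<le> rowlen lam r"
  using rowlen_antimono[of r h lam] c by linarith

lemma less_c: "h < r \<Longrightarrow> rowlen lam r < c"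
  using rowlen_antimono[of "h + 1" r lam] c by linarith

lemma c_ge: "1 \<le> c" using c by simp

lemma col_c: "col lam c = h" "col lam (c + 1) = h"
proof -
  have "(h, c) \<in> dg lam" "(h, c + 1) \<in> dg lam" using dg_iff[OF lam] h c c_ge by auto
  then show "col lam c = h" "col lam (c + 1) = h" using col_less_Suc_iff[OF lam] c by auto
qed

lemma depth:
  "1 \<le> swap_depth h \<sigma> c" "swap_depth h \<sigma> c \<le> h"
  "1 < swap_depth h \<sigma> c \<Longrightarrow> balanced \<sigma> c (swap_depth h \<sigma> c - 1)"
  "swap_depth h \<sigma> c \<le> r \<Longrightarrow> r < h \<Longrightarrow> \<not> balanced \<sigma> c r"
proof -
  let ?S = "insert 1 {s \<in> {2..h}. balanced \<sigma> c (s - 1)}"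
  have fin: "finite ?S" by simp
  have "Max ?S \<in> ?S" by (rule Max_in) auto
  then have m: "swap_depth h \<sigma> c = 1 \<or> (2 \<le> swap_depth h \<sigma> c \<and> swap_depth h \<sigma> c \<le> h \<and> balanced \<sigma> c (swap_depth h \<sigma> c - 1))"
    unfolding swap_depth_def by auto
  then show "1 \<le> swap_depth h \<sigma> c" "swap_depth h \<sigma> c \<le> h"
    "1 < swap_depth h \<sigma> c \<Longrightarrow> balanced \<sigma> c (swap_depth h \<sigma> c - 1)" using h by auto
  show "\<not> balanced \<sigma> c r" if "swap_depth h \<sigma> c \<le> r" "r < h"
  proof
    assume "balanced \<sigma> c r"
    moreover have "1 \<le> r" using that m by auto
    ultimately have "r + 1 \<in> ?S" using that by auto
    then have "r + 1 \<le> swap_depth h \<sigma> c" unfolding swap_depth_def by (rule Max_ge[OF fin])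
    then show False using that by simp
  qed
qed

lemma depth_unique:
  assumes "1 \<le> d" "d \<le> h" "1 < d \<Longrightarrow> balanced \<sigma> c (d - 1)" "\<And>r. d \<le> r \<Longrightarrow> r < h \<Longrightarrow> \<not> balanced \<sigma> c r"
  shows "swap_depth h \<sigma> c = d"
proof (rule antisym)
  let ?e = "swap_depth h \<sigma> c"
  show "?e \<le> d"
  proof (rule ccontr)
    assume "\<not> ?e \<le> d"
    then have "balanced \<sigma> c (?e - 1)" "d \<le> ?e - 1" "?e - 1 < h" using depth[where \<sigma> = \<sigma>] assms(1) by auto
    then show False using assms(4) by blast
  qed
  show "d \<le> ?e"
  proof (rule ccontr)
    assume "\<not> d \<le> ?e"
    then have "balanced \<sigma> c (d - 1)" "?e \<le> d - 1" "d - 1 < h" using depth(1)[of \<sigma>] assms by auto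
    then show False using depth(4) by blast
  qed
qed

lemma balanced_swap_both:
  "(\<And>i. \<tau> (r + 1, i) = \<sigma> (r + 1, s i)) \<Longrightarrow> (\<And>i. \<tau> (r, i) = \<sigma> (r, s i)) \<Longrightarrow> balanced \<tau> c r \<longleftrightarrow> balanced \<sigma> c r"
  unfolding balanced_def by (simp add: transpose_adjacent_simps[simplified])

lemma balanced_swap_upper:
  "(\<And>i. \<tau> (r + 1, i) = \<sigma> (r + 1, s i)) \<Longrightarrow> (\<And>i. \<tau> (r, i) = \<sigma> (r, i)) \<Longrightarrow> balanced \<tau> c r \<longleftrightarrow> balanced \<sigma> c r"
  unfolding balanced_def by (simp add: transpose_adjacent_simps[simplified])

lemma col_swap_apply:
  "swap_depth h \<sigma> c \<le> r \<Longrightarrow> col_swap h c \<sigma> (r, i) = \<sigma> (r, s i)"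
  "r < swap_depth h \<sigma> c \<Longrightarrow> col_swap h c \<sigma> (r, i) = \<sigma> (r, i)"
  by (auto simp: col_swap_def)

text \<open>Balance is unaffected by exchanging both rows or only the upper one, and nothing else
  happens from the row below the depth upwards. So the exchange finds the same depth again and is an
  involution.\<close>

lemma depth_col_swap: "swap_depth h (col_swap h c \<sigma>) c = swap_depth h \<sigma> c"
proof (rule depth_unique)
  let ?d = "swap_depth h \<sigma> c" and ?\<tau> = "col_swap h c \<sigma>"
  show "1 \<le> ?d" "?d \<le> h" by (rule depth)+
  show "balanced ?\<tau> c (?d - 1)" if "1 < ?d"
  proof -
    have "balanced ?\<tau> c (?d - 1) \<longleftrightarrow> balanced \<sigma> c (?d - 1)"
      by (rule balanced_swap_upper) (use that in \<open>auto simp: col_swap_apply\<close>)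
    then show ?thesis using depth(3)[OF that] by simp
  qed
  show "\<not> balanced ?\<tau> c r" if "?d \<le> r" "r < h" for r
  proof -
    have "balanced ?\<tau> c r \<longleftrightarrow> balanced \<sigma> c r"
      by (rule balanced_swap_both) (use that in \<open>auto simp: col_swap_apply\<close>)
    then show ?thesis using depth(4)[OF that] by simp
  qed
qed

lemma col_swap_col_swap: "col_swap h c (col_swap h c \<sigma>) = \<sigma>"
proof
  fix u show "col_swap h c (col_swap h c \<sigma>) u = \<sigma> u"
    by (cases u) (auto simp: col_swap_def[of h c "col_swap h c \<sigma>"] depth_col_swap col_swap_apply not_le)
qed

lemma col_swap_top:
  "col_swap h c \<sigma> (h, c) = \<sigma> (h, c + 1)" "col_swap h c \<sigma> (h, c + 1) = \<sigma> (h, c)"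
  "i \<noteq> c \<Longrightarrow> i \<noteq> c + 1 \<Longrightarrow> col_swap h c \<sigma> (r, i) = \<sigma> (r, i)"
  using depth(2)[of \<sigma>] by (auto simp: col_swap_def transpose_def)

lemma swap_mem_dg: "(r, i) \<in> dg lam \<Longrightarrow> (r, s i) \<in> dg lam"
proof -
  assume d: "(r, i) \<in> dg lam"
  show "(r, s i) \<in> dg lam"
  proof (cases "r \<le> h")
    case True
    then show ?thesis using d c_le[OF True] c_ge dg_iff[OF lam] by (auto simp: transpose_def)
  next
    case False
    then have "i < c" using d less_c[of r] dg_iff[OF lam] by auto
    then show ?thesis using d by (simp add: transpose_def)
  qed
qed

text \<open>\<open>col_swap\<close> as composition with a row-preserving permutation of the cells,
  so that counts and conditions that see only rows and entries carry over.\<close>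

definition cell_swap :: "(nat \<times> nat \<Rightarrow> int) \<Rightarrow> nat \<times> nat \<Rightarrow> nat \<times> nat" where
  "cell_swap \<sigma> = (\<lambda>(r, i). (r, if swap_depth h \<sigma> c \<le> r then s i else i))"

lemma cell_swap:
  "bij_betw (cell_swap \<sigma>) (dg lam) (dg lam)" "fst (cell_swap \<sigma> u) = fst u"
  "col_swap h c \<sigma> u = \<sigma> (cell_swap \<sigma> u)" "u \<notin> dg lam \<Longrightarrow> cell_swap \<sigma> u \<notin> dg lam"
proof -
  have inv: "cell_swap \<sigma> (cell_swap \<sigma> u) = u" for u by (cases u) (auto simp: cell_swap_def)
  have mem: "cell_swap \<sigma> u \<in> dg lam" if "u \<in> dg lam" for u
    using that swap_mem_dg by (cases u) (auto simp: cell_swap_def)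
  show "bij_betw (cell_swap \<sigma>) (dg lam) (dg lam)"
    by (rule bij_betw_byWitness[of _ "cell_swap \<sigma>"]) (use inv mem in \<open>blast+\<close>)
  show "fst (cell_swap \<sigma> u) = fst u" by (cases u) (auto simp: cell_swap_def)
  show "col_swap h c \<sigma> u = \<sigma> (cell_swap \<sigma> u)" by (cases u) (auto simp: cell_swap_def col_swap_def)
  show "cell_swap \<sigma> u \<notin> dg lam" if "u \<notin> dg lam" using mem[of "cell_swap \<sigma> u"] inv[of u] that by metis
qed

lemma card_col_swap: "card {u \<in> dg lam. P (fst u) (col_swap h c \<sigma> u)} = card {u \<in> dg lam. P (fst u) (\<sigma> u)}"
proof -
  let ?b = "cell_swap \<sigma>"
  note \<beta> = cell_swap[where \<sigma> = \<sigma>]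
  have "bij_betw ?b {u \<in> dg lam. P (fst u) (col_swap h c \<sigma> u)} {u \<in> dg lam. P (fst u) (\<sigma> u)}"
    unfolding bij_betw_def
  proof
    show "inj_on ?b {u \<in> dg lam. P (fst u) (col_swap h c \<sigma> u)}"
      by (rule inj_on_subset[of _ "dg lam"]) (use \<beta>(1) in \<open>auto simp: bij_betw_def\<close>)
    show "?b ` {u \<in> dg lam. P (fst u) (col_swap h c \<sigma> u)} = {u \<in> dg lam. P (fst u) (\<sigma> u)}"
    proof (intro set_eqI iffI)
      fix v assume "v \<in> ?b ` {u \<in> dg lam. P (fst u) (col_swap h c \<sigma> u)}"
      then obtain u where "u \<in> dg lam" "P (fst u) (\<sigma> (?b u))" "v = ?b u" by (auto simp: \<beta>(3))
      then show "v \<in> {u \<in> dg lam. P (fst u) (\<sigma> u)}" using \<beta>(1,2) by (auto simp: bij_betw_def)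
    next
      fix v assume v: "v \<in> {u \<in> dg lam. P (fst u) (\<sigma> u)}"
      then have "v \<in> ?b ` dg lam" using bij_betw_imp_surj_on[OF \<beta>(1)] by simp
      then obtain u where "u \<in> dg lam" "v = ?b u" by (elim imageE)
      then show "v \<in> ?b ` {u \<in> dg lam. P (fst u) (col_swap h c \<sigma> u)}" using v by (auto simp: \<beta>(2,3))
    qed
  qed
  then show ?thesis by (rule bij_betw_same_card)
qed

lemma col_swap_rows: "(\<forall>u\<in>dg lam. P (fst u) (col_swap h c \<sigma> u)) \<longleftrightarrow> (\<forall>u\<in>dg lam. P (fst u) (\<sigma> u))"
proof -
  let ?b = "cell_swap \<sigma>"
  note \<beta> = cell_swap[where \<sigma> = \<sigma>]
  have "(\<forall>u\<in>dg lam. P (fst u) (col_swap h c \<sigma> u)) \<longleftrightarrow> (\<forall>u\<in>dg lam. P (fst (?b u)) (\<sigma> (?b u)))"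
    by (simp add: \<beta>(2,3))
  also have "\<dots> \<longleftrightarrow> (\<forall>u\<in>?b ` dg lam. P (fst u) (\<sigma> u))" by blast
  finally show ?thesis unfolding bij_betw_imp_surj_on[OF \<beta>(1)] .
qed

lemma col_swap_extensional: "\<sigma> \<in> extensional (dg lam) \<Longrightarrow> col_swap h c \<sigma> \<in> extensional (dg lam)"
proof -
  assume e: "\<sigma> \<in> extensional (dg lam)"
  let ?b = "cell_swap \<sigma>"
  note \<beta> = cell_swap[where \<sigma> = \<sigma>]
  show ?thesis using e \<beta>(4) by (auto simp: \<beta>(3) extensional_def)
qed

text \<open>Rows from the depth to h - 1 are exchanged whole together with their upper entries and
  contribute the same by \<open>unbalanced_qd\<close>. In the row below the depth only the upper
  entries are exchanged, which is balanced. What remains is the degenerate triple in row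
  \<open>h\<close>, where only the two top entries are compared.\<close>

lemma quinv_col_swap:
  "int (quinv lam (col_swap h c \<sigma>)) + of_bool (Ind (\<sigma> (h, c + 1)) (\<sigma> (h, c))) =
    int (quinv lam \<sigma>) + of_bool (Ind (\<sigma> (h, c)) (\<sigma> (h, c + 1)))"
proof -
  let ?\<tau> = "col_swap h c \<sigma>" and ?d = "swap_depth h \<sigma> c"
  let ?e = "of_bool (Ind (\<sigma> (h, c)) (\<sigma> (h, c + 1))) - of_bool (Ind (\<sigma> (h, c + 1)) (\<sigma> (h, c))) :: int"
  have row: "quinv_row (rowlen lam r) (upper lam ?\<tau> r) (\<lambda>i. ?\<tau> (r, i)) =
      quinv_row (rowlen lam r) (upper lam \<sigma> r) (\<lambda>i. \<sigma> (r, i)) + (if r = h then ?e else 0)" if r: "1 \<le> r" for r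
  proof -
    have up_swap: "upper lam ?\<tau> r = upper lam \<sigma> r \<circ> s" if "?d \<le> r + 1" "r \<le> h"
    proof
      fix i show "upper lam ?\<tau> r i = (upper lam \<sigma> r \<circ> s) i"
      proof (cases "r < h")
        case True
        then have "c + 1 \<le> rowlen lam (r + 1)" by (intro c_le) simp
        then have "s i \<le> rowlen lam (r + 1) \<longleftrightarrow> i \<le> rowlen lam (r + 1)" by (auto simp: transpose_def)
        then show ?thesis using that by (simp add: upper_def col_swap_apply)
      next
        case False
        then have "rowlen lam (r + 1) < c" by (intro less_c) simp
        then show ?thesis using that by (auto simp: upper_def col_swap_apply transpose_def)
      qed
    qed
    consider "h < r" | "r = h" | "?d \<le> r" "r < h" | "r + 1 = ?d" | "r + 1 < ?d" by linarith
    then show ?thesis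
    proof cases
      case 1
      then have n: "rowlen lam r < c" "rowlen lam (r + 1) < c" using less_c[of r] less_c[of "r + 1"] by auto
      have "upper lam ?\<tau> r i = upper lam \<sigma> r i" for i
        using n by (auto simp: upper_def col_swap_top)
      moreover have "?\<tau> (r, i) = \<sigma> (r, i)" if "i \<le> rowlen lam r" for i
        using that n by (intro col_swap_top) auto
      ultimately show ?thesis using 1 unfolding quinv_row_def by (auto simp: col_pairs_def intro!: sum.cong)
    next
      case 2
      have d: "?d \<le> h" by (rule depth)
      have low: "(\<lambda>i. ?\<tau> (r, i)) = (\<lambda>i. \<sigma> (r, i)) \<circ> s" using 2 d by (auto simp: col_swap_apply)
      have z: "upper lam \<sigma> r c = 0" "upper lam \<sigma> r (c + 1) = 0" using 2 c by (auto simp: upper_def)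
      have "upper lam ?\<tau> r = upper lam \<sigma> r \<circ> s" using up_swap 2 d by simp
      moreover have "quinv_row (rowlen lam r) (upper lam \<sigma> r \<circ> s) ((\<lambda>i. \<sigma> (r, i)) \<circ> s) =
        quinv_row (rowlen lam r) (upper lam \<sigma> r) (\<lambda>i. \<sigma> (r, i)) +
        qd 0 (\<sigma> (r, c + 1)) (\<sigma> (r, c)) - qd 0 (\<sigma> (r, c)) (\<sigma> (r, c + 1))"
        using quinv_row_swap[OF c_ge, of "rowlen lam r" "upper lam \<sigma> r" "\<lambda>i. \<sigma> (r, i)"] c_le[of r] 2 unfolding z by simp
      ultimately show ?thesis unfolding low using 2 by (simp add: qd_def)
    next
      case 3
      have low: "(\<lambda>i. ?\<tau> (r, i)) = (\<lambda>i. \<sigma> (r, i)) \<circ> s" using 3 by (auto simp: col_swap_apply)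
      have up: "upper lam ?\<tau> r = upper lam \<sigma> r \<circ> s" using up_swap 3 by simp
      have "c + 1 \<le> rowlen lam (r + 1)" using 3 by (intro c_le) simp
      then have u: "upper lam \<sigma> r c = \<sigma> (r + 1, c)" "upper lam \<sigma> r (c + 1) = \<sigma> (r + 1, c + 1)" by (auto simp: upper_def)
      have "c + 1 \<le> rowlen lam r" using 3 by (intro c_le) simp
      then show ?thesis unfolding low up
        using 3 quinv_row_swap[OF c_ge, of "rowlen lam r" "upper lam \<sigma> r" "\<lambda>i. \<sigma> (r, i)"] unbalanced_qd[OF depth(4)[OF 3]]
        by (simp add: u[simplified])
    next
      case 4
      then have rh: "r < h" using depth(2)[of \<sigma>] by simp
      have low: "(\<lambda>i. ?\<tau> (r, i)) = (\<lambda>i. \<sigma> (r, i))" using 4 by (auto simp: col_swap_apply)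
      have up: "upper lam ?\<tau> r = upper lam \<sigma> r \<circ> s" using up_swap 4 rh by simp
      have "c + 1 \<le> rowlen lam (r + 1)" using rh by (intro c_le) simp
      then have u: "upper lam \<sigma> r c = \<sigma> (r + 1, c)" "upper lam \<sigma> r (c + 1) = \<sigma> (r + 1, c + 1)" by (auto simp: upper_def)
      have "balanced \<sigma> c (?d - 1)" using 4 r by (intro depth(3)) simp
      moreover have "?d - 1 = r" using 4 by simp
      ultimately have "balanced \<sigma> c r" by simp
      then have "quinv_row (rowlen lam r) (upper lam \<sigma> r \<circ> s) (\<lambda>i. \<sigma> (r, i)) = quinv_row (rowlen lam r) (upper lam \<sigma> r) (\<lambda>i. \<sigma> (r, i))"
        using c_le[of r] rh by (intro quinv_row_swap_upper[OF c_ge]) (simp_all add: u[simplified] balanced_def)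
      then show ?thesis using rh unfolding low up by simp
    next
      case 5
      then have rh: "r < h" using depth(2)[of \<sigma>] by simp
      have "upper lam ?\<tau> r = upper lam \<sigma> r" using 5 by (auto simp: upper_def col_swap_apply fun_eq_iff)
      moreover have "(\<lambda>i. ?\<tau> (r, i)) = (\<lambda>i. \<sigma> (r, i))" using 5 by (auto simp: col_swap_apply)
      ultimately show ?thesis using rh by simp
    qed
  qed
  have "h \<in> {1..height lam}"
    using h rowlen_height[of lam h] c by (cases "height lam < h") auto
  moreover have "int (quinv lam ?\<tau>) = (\<Sum>r\<in>{1..height lam}. quinv_row (rowlen lam r) (upper lam \<sigma> r) (\<lambda>i. \<sigma> (r, i)) + (if r = h then ?e else 0))"
    unfolding quinv_eq_sum_rows[OF lam] by (rule sum.cong) (auto simp: row)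
  ultimately have "int (quinv lam ?\<tau>) = int (quinv lam \<sigma>) + ?e"
    unfolding quinv_eq_sum_rows[OF lam, of \<sigma>] by (simp add: sum.distrib)
  then show ?thesis by simp
qed

text \<open>Descents inside the exchanged parts keep their legs, as the columns have equal height.
  At the seam below the depth the balance condition keeps the number of descents, and both columns
  have the same leg there.\<close>

lemma maj_col_swap: "maj lam (col_swap h c \<sigma>) = maj lam \<sigma>"
  unfolding maj_eq_sum_rows[OF lam]
proof (rule sum.cong[OF refl])
  let ?\<tau> = "col_swap h c \<sigma>" and ?d = "swap_depth h \<sigma> c"
  let ?T = "\<lambda>r \<sigma> i. if Ind (\<sigma> (r + 1, i)) (\<sigma> (r, i)) then col lam i - r else 0"
  fix r assume "r \<in> {1..height lam}"
  then have r: "1 \<le> r" by simp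
  have col_s: "col lam (s i) = col lam i" for i using col_c by (auto simp: transpose_def)
  consider "h \<le> r" | "?d \<le> r" "r < h" | "r + 1 = ?d" | "r + 1 < ?d" by linarith
  then show "(\<Sum>i\<in>{1..rowlen lam (r + 1)}. ?T r ?\<tau> i) = (\<Sum>i\<in>{1..rowlen lam (r + 1)}. ?T r \<sigma> i)"
  proof cases
    case 1
    then have "rowlen lam (r + 1) < c" by (intro less_c) simp
    then show ?thesis by (intro sum.cong) (auto simp: col_swap_top)
  next
    case 2
    then have n: "c + 1 \<le> rowlen lam (r + 1)" by (intro c_le) simp
    show ?thesis
      by (rule sum.reindex_bij_witness[of _ s s])
        (use 2 n c_ge col_s in \<open>auto simp: col_swap_apply transpose_def split: if_splits\<close>)
  next
    case 3
    then have rh: "r < h" using depth(2)[of \<sigma>] by simp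
    have n: "c + 1 \<le> rowlen lam (r + 1)" using rh by (intro c_le) simp
    have "balanced \<sigma> c (?d - 1)" using 3 r by (intro depth(3)) simp
    moreover have "?d - 1 = r" using 3 by simp
    ultimately have bal: "balanced \<sigma> c r" by simp
    have split: "(\<Sum>i\<in>{1..rowlen lam (r + 1)}. f i) = f c + f (c + 1) + (\<Sum>i\<in>{1..rowlen lam (r + 1)} - {c} - {c + 1}. f i)" for f :: "nat \<Rightarrow> nat"
      using n c_ge by (subst sum.remove[of _ c], simp, simp, subst sum.remove[of _ "c + 1"]) auto
    have "(\<Sum>i\<in>{1..rowlen lam (r + 1)} - {c} - {c + 1}. ?T r ?\<tau> i) = (\<Sum>i\<in>{1..rowlen lam (r + 1)} - {c} - {c + 1}. ?T r \<sigma> i)"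
      by (rule sum.cong) (auto simp: col_swap_top)
    moreover have "?T r ?\<tau> c + ?T r ?\<tau> (c + 1) = ?T r \<sigma> c + ?T r \<sigma> (c + 1)"
    proof -
      have t: "?\<tau> (r + 1, c) = \<sigma> (r + 1, c + 1)" "?\<tau> (r + 1, c + 1) = \<sigma> (r + 1, c)"
        "?\<tau> (r, c) = \<sigma> (r, c)" "?\<tau> (r, c + 1) = \<sigma> (r, c + 1)"
        using 3 by (auto simp: col_swap_apply)
      show ?thesis unfolding t col_c using bal unfolding balanced_def
        by (cases "Ind (\<sigma> (r + 1, c)) (\<sigma> (r, c))"; cases "Ind (\<sigma> (r + 1, c)) (\<sigma> (r, c + 1))";
            cases "Ind (\<sigma> (r + 1, c + 1)) (\<sigma> (r, c))"; cases "Ind (\<sigma> (r + 1, c + 1)) (\<sigma> (r, c + 1))"; simp)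
    qed
    ultimately show ?thesis unfolding split by simp
  next
    case 4
    then show ?thesis by (intro sum.cong) (auto simp: col_swap_apply)
  qed
qed

lemma npos_col_swap: "npos lam (col_swap h c \<sigma>) = npos lam \<sigma>"
  unfolding npos_def by (rule card_col_swap[of "\<lambda>_ x. 0 < x"])

lemma nneg_col_swap: "nneg lam (col_swap h c \<sigma>) = nneg lam \<sigma>"
  unfolding nneg_def by (rule card_col_swap[of "\<lambda>_ x. x < 0"])

lemma has_content_col_swap: "has_content lam (col_swap h c \<sigma>) \<alpha> \<longleftrightarrow> has_content lam \<sigma> \<alpha>"
  unfolding has_content_def using card_col_swap[of "\<lambda>_ x. nat \<bar>x\<bar> = _" \<sigma>] by simp

end

section \<open>Signed words\<close>

text \<open>The Gaussian binomial coefficient in \<open>t\<close>, given by a Pascal recursion and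
  so without division; \<open>gbinom_pascal\<close> is the mirror recursion.\<close>

fun gbinom :: "'r::comm_ring_1 \<Rightarrow> nat \<Rightarrow> nat \<Rightarrow> 'r" where
  "gbinom t n 0 = 1"
| "gbinom t 0 (Suc k) = 0"
| "gbinom t (Suc n) (Suc k) = gbinom t n k + t ^ Suc k * gbinom t n (Suc k)"

lemma gbinom_eq_0: "n < k \<Longrightarrow> gbinom t n k = 0"
  by (induction t n k rule: gbinom.induct) auto

lemma gbinom_pascal: "k \<le> n \<Longrightarrow> gbinom t (Suc n) (Suc k) = gbinom t n (Suc k) + t ^ (n - k) * gbinom t n k"
proof (induction n arbitrary: k)
  case (Suc n)
  show ?case
  proof (cases k)
    case 0
    have "gbinom t (Suc n) (Suc 0) = gbinom t n (Suc 0) + t ^ n" using Suc.IH[of 0] by simp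
    then show ?thesis using 0 by (simp add: algebra_simps)
  next
    case (Suc l)
    show ?thesis
    proof (cases "l = n")
      case True
      then show ?thesis using Suc by (simp add: gbinom_eq_0)
    next
      case False
      then have l: "Suc l \<le> n" using Suc.prems Suc by simp
      have e: "t ^ (n - l) = t * t ^ (n - Suc l)" using l by (simp add: Suc_diff_Suc flip: power_Suc)
      have "gbinom t (Suc (Suc n)) (Suc (Suc l)) = gbinom t (Suc n) (Suc l) + t ^ Suc (Suc l) * gbinom t (Suc n) (Suc (Suc l))"
        by (rule gbinom.simps(3))
      also have "gbinom t (Suc n) (Suc l) = gbinom t n (Suc l) + t ^ (n - l) * gbinom t n l" using Suc.IH[of l] l by simp
      also have "gbinom t (Suc n) (Suc (Suc l)) = gbinom t n (Suc (Suc l)) + t ^ (n - Suc l) * gbinom t n (Suc l)"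
        by (rule Suc.IH[OF l])
      finally have lhs: "gbinom t (Suc (Suc n)) (Suc (Suc l)) = gbinom t n (Suc l) + t ^ (n - l) * gbinom t n l +
        t ^ Suc (Suc l) * (gbinom t n (Suc (Suc l)) + t ^ (n - Suc l) * gbinom t n (Suc l))" .
      have rhs: "gbinom t (Suc n) (Suc (Suc l)) + t ^ (n - l) * gbinom t (Suc n) (Suc l) =
        gbinom t n (Suc l) + t ^ Suc (Suc l) * gbinom t n (Suc (Suc l)) + t ^ (n - l) * (gbinom t n l + t ^ Suc l * gbinom t n (Suc l))"
        by simp
      show ?thesis unfolding Suc diff_Suc_Suc lhs rhs by (simp add: e algebra_simps)
    qed
  qed
qed simp

text \<open>The factor picked up when a word is sorted into \<open>0\<dots>01\<dots>1\<close>, each \<open>- 1\<close> being moved to the end and changed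
  into \<open>1\<close> there.\<close>
fun word_wt :: "'r::comm_ring_1 \<Rightarrow> nat \<Rightarrow> int list \<Rightarrow> 'r" where
  "word_wt t p [] = 1"
| "word_wt t p (x # s) =
    (if x = 1 then t ^ count_list s 0 else if x = - 1 then - (t ^ p) else 1) * word_wt t (Suc p) s"

definition sign_words :: "nat \<Rightarrow> nat \<Rightarrow> int list set" where
  "sign_words n N = {s. length s = n \<and> set s \<subseteq> {-1, 0, 1} \<and> count_list s 0 = N}"

lemma finite_sign_words [simp]: "finite (sign_words n N)"
  by (rule finite_subset[OF _ finite_lists_length_eq[of "{-1, 0, 1}" n]]) (auto simp: sign_words_def)

text \<open>Split by the first letter: 0 has factor 1 and uses up one zero, 1 passes the N zeros
  behind it, and - 1 contributes - t^p.\<close>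

lemma sum_word_wt_Suc:
  "(\<Sum>s\<in>sign_words (Suc n) N. word_wt t p s) =
    (if N = 0 then 0 else \<Sum>s\<in>sign_words n (N - 1). word_wt t (Suc p) s) +
    (t ^ N - t ^ p) * (\<Sum>s\<in>sign_words n N. word_wt t (Suc p) s)"
proof -
  let ?A = "if N = 0 then {} else (#) 0 ` sign_words n (N - 1)"
  let ?B = "(#) 1 ` sign_words n N" and ?C = "(#) (- 1) ` sign_words n N"
  have "sign_words (Suc n) N = ?A \<union> ?B \<union> ?C"
  proof (intro set_eqI iffI)
    fix s assume s: "s \<in> sign_words (Suc n) N"
    then obtain x s' where xs: "s = x # s'" by (cases s) (auto simp: sign_words_def)
    then show "s \<in> ?A \<union> ?B \<union> ?C" using s by (auto simp: sign_words_def split: if_splits)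
  next
    fix s assume "s \<in> ?A \<union> ?B \<union> ?C"
    then show "s \<in> sign_words (Suc n) N" by (auto simp: sign_words_def split: if_splits)
  qed
  then have "(\<Sum>s\<in>sign_words (Suc n) N. word_wt t p s) = sum (word_wt t p) ?A + sum (word_wt t p) ?B + sum (word_wt t p) ?C"
    by (simp only:) (subst sum.union_disjoint, simp, simp, force, subst sum.union_disjoint, auto)
  also have "sum (word_wt t p) ?A = (if N = 0 then 0 else \<Sum>s\<in>sign_words n (N - 1). word_wt t (Suc p) s)"
    by (auto simp: sum.reindex)
  also have "sum (word_wt t p) ?B = (\<Sum>s\<in>sign_words n N. t ^ N * word_wt t (Suc p) s)"
    by (subst sum.reindex) (auto simp: sign_words_def intro!: sum.cong)
  also have "sum (word_wt t p) ?C = (\<Sum>s\<in>sign_words n N. - (t ^ p) * word_wt t (Suc p) s)"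
    by (subst sum.reindex) (auto intro!: sum.cong)
  finally show ?thesis by (simp add: sum_distrib_left sum_subtractf sum_negf algebra_simps)
qed

lemma sum_word_wt:
  "(\<Sum>s\<in>sign_words (N + k) N. word_wt t p s) = gbinom t (N + k) k * (\<Prod>j<k. 1 - t ^ (p + j))"
proof (induction "N + k" arbitrary: N k p)
  case 0
  then have "sign_words (N + k) N = {[]}" by (auto simp: sign_words_def)
  then show ?case using 0 by simp
next
  case (Suc n)
  show ?case
  proof (cases k)
    case 0
    then have N: "N = Suc n" using Suc by simp
    have e: "sign_words n (Suc n) = {}"
    proof -
      have "count_list s 0 \<le> length s" for s :: "int list" by (rule count_le_length)
      then show ?thesis by (auto simp: sign_words_def) (metis Suc_n_not_le_n)
    qed
    have "(\<Sum>s\<in>sign_words (Suc n) (Suc n). word_wt t p s) = (\<Sum>s\<in>sign_words n n. word_wt t (Suc p) s)"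
      unfolding sum_word_wt_Suc e by simp
    also have "\<dots> = 1" using Suc.hyps(1)[of n 0 "Suc p"] by simp
    finally show ?thesis using 0 N by simp
  next
    case (Suc l)
    have n: "n = N + l" using Suc \<open>Suc n = N + k\<close> by simp
    let ?P = "\<Prod>j<l. 1 - t ^ (Suc p + j)"
    have P: "(\<Prod>j<Suc l. 1 - t ^ (p + j)) = (1 - t ^ p) * ?P"
      by (subst prod.lessThan_Suc_shift) simp
    have P': "(\<Prod>j<Suc l. 1 - t ^ (Suc p + j)) = ?P * (1 - t ^ (Suc p + l))" by simp
    have B: "(\<Sum>s\<in>sign_words n N. word_wt t (Suc p) s) = gbinom t n l * ?P"
      using Suc.hyps(1)[of N l "Suc p"] n by simp
    have A: "(if N = 0 then 0 else \<Sum>s\<in>sign_words n (N - 1). word_wt t (Suc p) s) = gbinom t n (Suc l) * (?P * (1 - t ^ (Suc p + l)))"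
    proof (cases N)
      case 0
      then show ?thesis using n by (simp add: gbinom_eq_0)
    next
      case (Suc M)
      then have "n = M + Suc l" using n by simp
      then show ?thesis using Suc.hyps(1)[of M "Suc l" "Suc p"] Suc unfolding P' by simp
    qed
    have g1: "gbinom t (Suc n) (Suc l) = gbinom t n l + t ^ Suc l * gbinom t n (Suc l)" by simp
    have g2: "gbinom t (Suc n) (Suc l) = gbinom t n (Suc l) + t ^ N * gbinom t n l"
      using gbinom_pascal[of l n t] n by simp
    \<comment> \<open>The term with factor 1 is expanded by the mirror recursion and the one with
      t^p by the defining recursion; the result has the shape of the recursion for words.\<close>
    have "gbinom t (Suc n) (Suc l) * (1 - t ^ p) = gbinom t n (Suc l) + t ^ N * gbinom t n l - t ^ p * (gbinom t n l + t ^ Suc l * gbinom t n (Suc l))"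
      unfolding right_diff_distrib mult_1_right by (subst g2, subst g1) (simp add: mult.commute)
    also have "\<dots> = gbinom t n (Suc l) * (1 - t ^ (Suc p + l)) + (t ^ N - t ^ p) * gbinom t n l"
      by (simp add: algebra_simps power_add)
    finally have key: "gbinom t (Suc n) (Suc l) * (1 - t ^ p) = gbinom t n (Suc l) * (1 - t ^ (Suc p + l)) + (t ^ N - t ^ p) * gbinom t n l" .
    have "(\<Sum>s\<in>sign_words (Suc n) N. word_wt t p s) =
      gbinom t n (Suc l) * (?P * (1 - t ^ (Suc p + l))) + (t ^ N - t ^ p) * (gbinom t n l * ?P)"
      unfolding sum_word_wt_Suc A B ..
    also have "\<dots> = (gbinom t n (Suc l) * (1 - t ^ (Suc p + l)) + (t ^ N - t ^ p) * gbinom t n l) * ?P"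
      by (simp add: algebra_simps)
    also have "\<dots> = gbinom t (Suc n) (Suc l) * ((1 - t ^ p) * ?P)" unfolding key[symmetric] by (simp add: mult.assoc)
    finally show ?thesis unfolding P[symmetric] using \<open>Suc n = N + k\<close> Suc by simp
  qed
qed

text \<open>At position p = 0, and with at least one letter other than 0, the product contains the
  factor 1 - t^0.\<close>

lemma sum_word_wt_eq_0: "N < M \<Longrightarrow> (\<Sum>s\<in>sign_words M N. word_wt t 0 s) = 0"
proof -
  assume "N < M"
  then obtain l where M: "M = N + Suc l" using less_imp_Suc_add[of N M] by auto
  have "(\<Prod>j<Suc l. 1 - t ^ (0 + j)) = 0" by (subst prod.lessThan_Suc_shift) simp
  then show ?thesis unfolding M sum_word_wt by simp
qed

text \<open>The letters 1, 0, - 1 stand for a, the remaining letters, and - a, listed increasingly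
  in \<open><_2\<close>; \<open>swap\<close> exchanges an increasing adjacent pair. In
  \<open>flip\<close> the exponent M - 1 counts the columns to the left of the last one.\<close>

locale word_function =
  fixes Z :: "int list \<Rightarrow> 'r::idom" and t :: 'r and M :: nat
  assumes t: "t \<noteq> 0"
    and swap: "\<And>\<delta> x y \<eta>. length \<delta> + length \<eta> + 2 = M \<Longrightarrow> (x, y) \<in> {(1, 0), (0, - 1), (1, - 1)} \<Longrightarrow>
      Z (\<delta> @ [x, y] @ \<eta>) = t * Z (\<delta> @ [y, x] @ \<eta>)"
    and flip: "\<And>\<delta>. length \<delta> + 1 = M \<Longrightarrow> Z (\<delta> @ [- 1]) = - (t ^ (M - 1)) * Z (\<delta> @ [1])"
begin

lemma move: 
  assumes "(x, y) \<in> {(1, 0), (0, - 1), (1, - 1)}" "length \<delta> + length \<eta> + k + 1 = M"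
  shows "Z (\<delta> @ x # replicate k y @ \<eta>) = t ^ k * Z (\<delta> @ replicate k y @ x # \<eta>)"
    and "Z (\<delta> @ replicate k x @ y # \<eta>) = t ^ k * Z (\<delta> @ y # replicate k x @ \<eta>)"
  using assms(2)
proof (induction k arbitrary: \<delta>)
  case (Suc k)
  {
    case 1
    have "Z (\<delta> @ [x, y] @ (replicate k y @ \<eta>)) = t * Z (\<delta> @ [y, x] @ (replicate k y @ \<eta>))"
      using 1 by (intro swap assms) simp
    then show ?case using Suc.IH(1)[of "\<delta> @ [y]"] 1 by simp
  next
    case 2
    have "Z (\<delta> @ [x, y] @ (replicate k x @ \<eta>)) = t * Z (\<delta> @ [y, x] @ (replicate k x @ \<eta>))"
      using 2 by (intro swap assms) simp
    then show ?case using Suc.IH(2)[of "\<delta> @ [x]"] 2 by simp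
  }
qed simp_all

text \<open>Bringing - 1 to the end divides by t^(y + i), and changing it into 1 there contributes -
  t^(M - 1); the quotient is - t^\<open>length \<delta>\<close>, the source of the exponent
  \<open>p\<close> in \<open>word_wt\<close>. The identity is proved after multiplication by t^(y +
  i), which is then cancelled.\<close>

lemma move_negative:
  assumes "length \<delta> + 1 + y + i = M"
  shows "Z (\<delta> @ - 1 # replicate y 0 @ replicate i 1) = - (t ^ length \<delta>) * Z (\<delta> @ replicate y 0 @ replicate (Suc i) 1)"
proof -
  have a: "Z (\<delta> @ replicate y 0 @ - 1 # replicate i 1) = t ^ y * Z (\<delta> @ - 1 # replicate y 0 @ replicate i 1)"
    by (rule move(2)) (use assms in auto)
  have b: "Z ((\<delta> @ replicate y 0) @ replicate i 1 @ - 1 # []) = t ^ i * Z ((\<delta> @ replicate y 0) @ - 1 # replicate i 1 @ [])"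
    by (rule move(2)) (use assms in auto)
  have c: "Z ((\<delta> @ replicate y 0 @ replicate i 1) @ [- 1]) = - (t ^ (M - 1)) * Z ((\<delta> @ replicate y 0 @ replicate i 1) @ [1])"
    by (rule flip) (use assms in auto)
  have r: "replicate i (1::int) @ [1] = replicate (Suc i) 1" by (simp add: replicate_append_same)
  have M: "M - 1 = length \<delta> + (y + i)" using assms by simp
  have "t ^ (y + i) * Z (\<delta> @ - 1 # replicate y 0 @ replicate i 1) =
      t ^ (y + i) * (- (t ^ length \<delta>) * Z (\<delta> @ replicate y 0 @ replicate (Suc i) 1))"
  proof -
    have "t ^ (y + i) * Z (\<delta> @ - 1 # replicate y 0 @ replicate i 1) = t ^ i * Z (\<delta> @ replicate y 0 @ - 1 # replicate i 1)"
      unfolding a by (simp add: power_add mult_ac)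
    also have "\<dots> = Z (\<delta> @ replicate y 0 @ replicate i 1 @ [- 1])" using b by simp
    also have "\<dots> = - (t ^ (M - 1)) * Z (\<delta> @ replicate y 0 @ (replicate i 1 @ [1]))" using c by simp
    finally show ?thesis unfolding r M by (simp only: power_add mult_minus_left mult_minus_right mult_ac)
  qed
  moreover have "t ^ (y + i) \<noteq> 0" using t by simp
  ultimately show ?thesis by (metis mult_left_cancel)
qed

text \<open>The tail is sorted first, so a leading 1 only has to pass zeros and a leading - 1 is
  covered by \<open>move_negative\<close>.\<close>

lemma normal_form:
  assumes "set s \<subseteq> {-1, 0, 1}" "length \<delta> + length s = M"
  shows "Z (\<delta> @ s) = word_wt t (length \<delta>) s *
    Z (\<delta> @ replicate (count_list s 0) 0 @ replicate (length s - count_list s 0) 1)"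
  using assms
proof (induction s arbitrary: \<delta>)
  case (Cons x s)
  let ?y = "count_list s 0" and ?i = "length s - count_list s 0"
  have le: "?y \<le> length s" by (rule count_le_length)
  have IH: "Z (\<delta> @ x # s) = word_wt t (Suc (length \<delta>)) s * Z (\<delta> @ x # replicate ?y 0 @ replicate ?i 1)"
    using Cons.IH[of "\<delta> @ [x]"] Cons.prems by simp
  have len: "length \<delta> + 1 + ?y + ?i = M" using Cons.prems le by simp
  consider "x = 0" | "x = 1" | "x = - 1" using Cons.prems by auto
  then show ?case
  proof cases
    case 1
    then show ?thesis using IH by simp
  next
    case 2
    have "Z (\<delta> @ 1 # replicate ?y 0 @ replicate ?i 1) = t ^ ?y * Z (\<delta> @ replicate ?y 0 @ 1 # replicate ?i 1)"
      by (rule move(1)) (use len in auto)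
    moreover have "Suc (length s) - ?y = Suc ?i" using le by simp
    ultimately show ?thesis using IH 2 by (simp add: mult_ac)
  next
    case 3
    have "Suc (length s) - ?y = Suc ?i" using le by simp
    then show ?thesis using IH 3 move_negative[OF len] by (simp add: mult_ac)
  qed
qed simp

text \<open>Words with the same number N of zeros are multiples of one sorted word, and their
  factors sum to 0 by \<open>sum_word_wt_eq_0\<close>. Leaving out the all-zero word ensures N <
  M.\<close>

lemma sum_words_eq_0:
  "(\<Sum>s\<in>{s. length s = M \<and> set s \<subseteq> {-1, 0, 1} \<and> s \<noteq> replicate M 0}. Z s) = 0"
proof -
  let ?W = "{s. length s = M \<and> set s \<subseteq> {-1, 0, 1::int} \<and> s \<noteq> replicate M 0}"
  have fin: "finite ?W"
    by (rule finite_subset[OF _ finite_lists_length_eq[of "{-1, 0, 1}" M]]) auto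
  have all0: "s = replicate (length s) 0" if "count_list s 0 = length s" for s :: "int list"
    using that
  proof (induction s)
    case (Cons x s)
    have "count_list s 0 \<le> length s" by (rule count_le_length)
    then show ?case using Cons by (auto split: if_splits)
  qed simp
  have fib: "{s \<in> ?W. count_list s 0 = N} = sign_words M N" if "N < M" for N
  proof -
    have "count_list (replicate k (0::int)) 0 = k" for k by (induction k) auto
    then have "count_list (replicate M (0::int)) 0 = M" .
    then have "s \<noteq> replicate M 0" if "count_list s 0 = N" for s :: "int list" using that \<open>N < M\<close> by auto
    then show ?thesis by (auto simp: sign_words_def)
  qed
  have "(\<Sum>s\<in>?W. Z s) = (\<Sum>N\<in>{..<M}. \<Sum>s\<in>{s \<in> ?W. count_list s 0 = N}. Z s)"
  proof (rule sum.group[symmetric, OF fin])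
    show "(\<lambda>s. count_list s 0) ` ?W \<subseteq> {..<M}"
    proof
      fix N assume "N \<in> (\<lambda>s. count_list s 0) ` ?W"
      then obtain s :: "int list" where s: "length s = M" "s \<noteq> replicate M 0" "N = count_list s 0" by blast
      then have "N \<noteq> M" using all0[of s] by auto
      moreover have "N \<le> M" using s count_le_length[of s 0] by simp
      ultimately show "N \<in> {..<M}" by simp
    qed
  qed simp
  also have "\<dots> = (\<Sum>N\<in>{..<M}. 0)"
  proof (rule sum.cong[OF refl])
    fix N assume "N \<in> {..<M}"
    then have N: "N < M" by simp
    have "(\<Sum>s\<in>sign_words M N. Z s) = (\<Sum>s\<in>sign_words M N. word_wt t 0 s * Z (replicate N 0 @ replicate (M - N) 1))"
      by (rule sum.cong[OF refl]) (use normal_form[of _ "[]"] in \<open>auto simp: sign_words_def\<close>)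
    also have "\<dots> = 0" unfolding sum_distrib_right[symmetric] sum_word_wt_eq_0[OF N] by simp
    finally show "(\<Sum>s\<in>{s \<in> ?W. count_list s 0 = N}. Z s) = 0" unfolding fib[OF N] .
  qed
  finally show ?thesis by simp
qed

end

section \<open>Changing the sign of an extreme entry\<close>

text \<open>As first argument, a is below and - a above every letter of absolute value at least a,
  ties included; the convention for ties in \<open>Ind\<close> fits both signs.\<close>

lemma Ind_extreme:
  assumes "0 < a" "a \<le> \<bar>v\<bar>"
  shows "\<not> Ind a v" "Ind (- a) v"
  using assms by (auto simp: Ind_def less2_def)

lemma Ind_extreme_strict:
  assumes "0 < a" "a < \<bar>v\<bar>"
  shows "Ind v a" "\<not> Ind v (- a)"
  using assms by (auto simp: Ind_def less2_def)

text \<open>The entry at (r, i) is extreme in every comparison it takes part in. Ties in absolute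
  value can occur only against earlier cells, where (r, i) is the first argument of
  \<open>Ind\<close>.\<close>

locale sign_flip =
  fixes lam :: "nat list" and \<sigma> :: "nat \<times> nat \<Rightarrow> int" and a :: int and r i :: nat
  assumes lam: "is_partition lam" and a: "0 < a" and r: "1 < r" and cell: "(r, i) \<in> dg lam" and \<sigma>: "\<sigma> (r, i) = a"
    and ge: "\<And>u. u \<in> dg lam \<Longrightarrow> r \<le> fst u + 1 \<Longrightarrow> a \<le> \<bar>\<sigma> u\<bar>"
    and right: "\<And>j. (r, j) \<in> dg lam \<Longrightarrow> i < j \<Longrightarrow> a < \<bar>\<sigma> (r, j)\<bar>"
    and above: "\<And>j. (r + 1, j) \<in> dg lam \<Longrightarrow> a < \<bar>\<sigma> (r + 1, j)\<bar>"
begin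

abbreviation \<tau> where "\<tau> \<equiv> \<sigma>((r, i) := - a)"

lemma i: "1 \<le> i" "i \<le> rowlen lam r" using cell dg_iff[OF lam] by auto

lemma r_height: "r \<in> {1..height lam}" "r - 1 \<in> {1..height lam}"
  using cell r unfolding dg_eq_Sigma[OF lam] by auto

lemma nneg_flip: "nneg lam \<tau> = Suc (nneg lam \<sigma>)"
proof -
  have "{u \<in> dg lam. \<tau> u < 0} = insert (r, i) {u \<in> dg lam. \<sigma> u < 0}" using cell a by auto
  moreover have "(r, i) \<notin> {u \<in> dg lam. \<sigma> u < 0}" using \<sigma> a by simp
  ultimately show ?thesis using finite_dg[OF lam] by (simp add: nneg_def)
qed

lemma npos_flip: "npos lam \<sigma> = Suc (npos lam \<tau>)"
proof -
  have "{u \<in> dg lam. 0 < \<sigma> u} = insert (r, i) {u \<in> dg lam. 0 < \<tau> u}" using cell a \<sigma> by auto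
  moreover have "(r, i) \<notin> {u \<in> dg lam. 0 < \<tau> u}" using a by simp
  ultimately show ?thesis using finite_dg[OF lam] by (simp add: npos_def)
qed

lemma maj_flip: "maj lam \<tau> = Suc (maj lam \<sigma>)"
proof -
  let ?T = "\<lambda>\<sigma> s j. int (if Ind (\<sigma> (s + 1, j)) (\<sigma> (s, j)) then col lam j - s else 0)"
  let ?c = "int (col lam i)"
  have rc: "r \<le> col lam i" using cell by (simp add: dg_def)
  have trm: "?T \<tau> s j = ?T \<sigma> s j + (if s = r - 1 then if j = i then ?c - int (r - 1) else 0 else 0)
      - (if s = r then if j = i then ?c - int r else 0 else 0)"
    if s: "1 \<le> s" and j: "1 \<le> j" "j \<le> rowlen lam (s + 1)" for s j
  proof -
    have d: "(s, j) \<in> dg lam" "(s + 1, j) \<in> dg lam"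
      using s j rowlen_antimono[of s "s + 1" lam] dg_iff[OF lam] by auto
    consider "j = i" "s + 1 = r" | "j = i" "s = r" | "j \<noteq> i \<or> (s + 1 \<noteq> r \<and> s \<noteq> r)" by auto
    then show ?thesis
    proof cases
      case 1
      then have "a \<le> \<bar>\<sigma> (s, i)\<bar>" using d by (intro ge) auto
      then have "\<not> Ind a (\<sigma> (s, i))" "Ind (- a) (\<sigma> (s, i))" using Ind_extreme a by auto
      then show ?thesis using 1 rc \<sigma> by auto
    next
      case 2
      then have "a < \<bar>\<sigma> (s + 1, i)\<bar>" using d above by auto
      then have "Ind (\<sigma> (s + 1, i)) a" "\<not> Ind (\<sigma> (s + 1, i)) (- a)" using Ind_extreme_strict a by auto
      then show ?thesis using 2 rc \<sigma> r by auto
    next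
      case 3
      then show ?thesis using r by auto
    qed
  qed
  have "int (maj lam \<tau>) = (\<Sum>s\<in>{1..height lam}. \<Sum>j\<in>{1..rowlen lam (s + 1)}. ?T \<tau> s j)"
    unfolding maj_eq_sum_rows[OF lam] by simp
  also have "\<dots> = (\<Sum>s\<in>{1..height lam}. \<Sum>j\<in>{1..rowlen lam (s + 1)}. ?T \<sigma> s j +
     (if s = r - 1 then if j = i then ?c - int (r - 1) else 0 else 0) - (if s = r then if j = i then ?c - int r else 0 else 0))"
    by (intro sum.cong refl trm) auto
  also have "\<dots> = (\<Sum>s\<in>{1..height lam}. \<Sum>j\<in>{1..rowlen lam (s + 1)}. ?T \<sigma> s j)
     + (\<Sum>s\<in>{1..height lam}. if s = r - 1 then \<Sum>j\<in>{1..rowlen lam (s + 1)}. if j = i then ?c - int (r - 1) else 0 else 0)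
     - (\<Sum>s\<in>{1..height lam}. if s = r then \<Sum>j\<in>{1..rowlen lam (s + 1)}. if j = i then ?c - int r else 0 else 0)"
  proof -
    have "(\<Sum>j\<in>J. if P then f j else 0) = (if P then \<Sum>j\<in>J. f j else (0::int))" for J :: "nat set" and P f by simp
    then show ?thesis by (simp only: sum.distrib sum_subtractf)
  qed
  also have "(\<Sum>s\<in>{1..height lam}. if s = r - 1 then \<Sum>j\<in>{1..rowlen lam (s + 1)}. if j = i then ?c - int (r - 1) else 0 else 0)
     = ?c - int (r - 1)"
    using r_height(2) r i by (subst sum.delta) auto
  also have "(\<Sum>s\<in>{1..height lam}. if s = r then \<Sum>j\<in>{1..rowlen lam (s + 1)}. if j = i then ?c - int r else 0 else 0)
     = (if i \<le> rowlen lam (r + 1) then ?c - int r else 0)"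
    using r_height(1) i by (subst sum.delta) auto
  \<comment> \<open>If column \<open>i\<close> ends in row r, there is no cell above, and then
    \<open>?c - int r\<close> is 0; one formula covers both cases.\<close>
  also have "\<dots> = ?c - int r" using col_less_Suc_iff[OF lam cell] by auto
  also have "(\<Sum>s\<in>{1..height lam}. \<Sum>j\<in>{1..rowlen lam (s + 1)}. ?T \<sigma> s j) = int (maj lam \<sigma>)"
    unfolding maj_eq_sum_rows[OF lam] by simp
  finally show ?thesis using r by (simp add: fun_upd_def)
qed

text \<open>In a nondegenerate triple the changed comparisons compensate each other. In a degenerate
  one the letter 0 on top never changes its comparisons, so the triple gains 1 if the flipped cell
  is its right cell and loses 1 if it is its left cell. This happens only if column i ends in row r;
  then i - 1 - \<open>rowlen lam (r + 1)\<close> such columns stand to its left and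
  \<open>rowlen lam r\<close> - i to its right.\<close>

lemma quinv_flip:
  "int (quinv lam \<tau>) = int (quinv lam \<sigma>) +
    (if i \<le> rowlen lam (r + 1) then 0 else int (i - 1 - rowlen lam (r + 1)) - int (rowlen lam r - i))"
proof -
  let ?m = "rowlen lam (r + 1)" and ?n = "rowlen lam r"
  let ?e = "if i \<le> ?m then 0 else int (i - 1 - ?m) - int (?n - i)"
  let ?Q = "\<lambda>\<sigma> s. quinv_row (rowlen lam s) (upper lam \<sigma> s) (\<lambda>j. \<sigma> (s, j))"
  let ?I = "\<lambda>x y. of_bool (Ind x y) :: int"
  have row: "?Q \<tau> s = ?Q \<sigma> s + (if s = r then ?e else 0)" if s: "1 \<le> s" for s
  proof -
    consider "s + 1 = r" | "s = r" | "s + 1 \<noteq> r" "s \<noteq> r" by auto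
    then show ?thesis
    proof cases
      case 1
      have "qd (upper lam \<tau> s j) (\<tau> (s, j)) (\<tau> (s, k)) = qd (upper lam \<sigma> s j) (\<sigma> (s, j)) (\<sigma> (s, k))"
        if "(j, k) \<in> col_pairs (rowlen lam s)" for j k
      proof (cases "j = i")
        case True
        have "(s, j) \<in> dg lam" "(s, k) \<in> dg lam" using that s dg_iff[OF lam] by (auto simp: col_pairs_def)
        then have "a \<le> \<bar>\<sigma> (s, j)\<bar>" "a \<le> \<bar>\<sigma> (s, k)\<bar>" using 1 by (auto intro!: ge)
        then show ?thesis using True 1 i(2) \<sigma> a Ind_extreme[of a] by (auto simp: qd_def upper_def)
      next
        case False
        then show ?thesis using 1 by (auto simp: upper_def)
      qed
      then show ?thesis using 1 unfolding quinv_row_def by (auto intro!: sum.cong)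
    next
      case 2
      let ?u = "upper lam \<sigma> r" and ?v = "\<lambda>j. \<sigma> (r, j)"
      have up: "upper lam \<tau> r = ?u" by (auto simp: upper_def fun_eq_iff)
      have u0: "?u j = 0 \<or> a < \<bar>?u j\<bar>" "?u j = 0 \<longleftrightarrow> ?m < j" if "1 \<le> j" for j
      proof -
        have "a < \<bar>?u j\<bar>" if "j \<le> ?m"
          using that \<open>1 \<le> j\<close> above[of j] dg_iff[OF lam] r by (auto simp: upper_def)
        then show "?u j = 0 \<or> a < \<bar>?u j\<bar>" "?u j = 0 \<longleftrightarrow> ?m < j" using a by (force simp: upper_def)+
      qed
      have trm: "qd (?u j) (\<tau> (r, j)) (\<tau> (r, k)) = qd (?u j) (?v j) (?v k) +
          (if k = i then of_bool (?m < j) else 0) - (if j = i then of_bool (?m < i) else 0)"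
        if "(j, k) \<in> col_pairs ?n" for j k
      proof -
        have jk: "1 \<le> j" "j < k" "k \<le> ?n" using that by (auto simp: col_pairs_def)
        then have d: "(r, j) \<in> dg lam" "(r, k) \<in> dg lam" using r dg_iff[OF lam] by auto
        consider "k = i" "j \<noteq> i" | "j = i" "k \<noteq> i" | "j \<noteq> i" "k \<noteq> i" using jk by auto
        then show ?thesis
        proof cases
          case 1
          have "a \<le> \<bar>?v j\<bar>" using d by (intro ge) auto
          then have "\<not> Ind a (?v j)" "Ind (- a) (?v j)" using Ind_extreme a by auto
          moreover have "Ind (?u j) a \<longleftrightarrow> \<not> ?m < j" "\<not> Ind (?u j) (- a)"
            using u0[OF jk(1)] Ind_extreme_strict[OF a, of "?u j"] by auto
          ultimately show ?thesis using 1 \<sigma> by (simp add: qd_def)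
        next
          case 2
          have "a < \<bar>?v k\<bar>" using d jk 2 by (intro right) auto
          then have "Ind (?v k) a" "\<not> Ind (?v k) (- a)" using Ind_extreme_strict a by auto
          moreover have "Ind (?u j) a \<longleftrightarrow> \<not> ?m < j" "\<not> Ind (?u j) (- a)"
            using u0[OF jk(1)] Ind_extreme_strict[OF a, of "?u j"] by auto
          ultimately show ?thesis using 2 \<sigma> by (simp add: qd_def)
        next
          case 3
          then show ?thesis by simp
        qed
      qed
      have "?Q \<tau> r = (\<Sum>(j, k)\<in>col_pairs ?n. qd (?u j) (?v j) (?v k) +
          (if k = i then of_bool (?m < j) else 0) - (if j = i then of_bool (?m < i) else 0))"
        unfolding up quinv_row_def using trm by (intro sum.cong) auto
      also have "\<dots> = ?Q \<sigma> r + (\<Sum>(j, k)\<in>col_pairs ?n. if k = i then of_bool (?m < j) else 0)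
          - (\<Sum>(j, k)\<in>col_pairs ?n. if j = i then of_bool (?m < i) else 0)"
        unfolding quinv_row_def by (simp add: split_def sum.distrib sum_subtractf)
      also have "(\<Sum>(j, k)\<in>col_pairs ?n. if k = i then of_bool (?m < j) else (0::int)) = int (i - 1 - ?m)"
      proof -
        have "(\<Sum>(j, k)\<in>col_pairs ?n. if k = i then of_bool (?m < j) else (0::int)) =
          (\<Sum>k\<in>{1..?n}. if k = i then \<Sum>j\<in>{1..<k}. of_bool (?m < j) else (0::int))"
          unfolding sum_col_pairs' by (intro sum.cong refl) auto
        also have "\<dots> = (\<Sum>j\<in>{1..<i}. of_bool (?m < j))" using i by (subst sum.delta) auto
        also have "\<dots> = int (card ({1..<i} \<inter> {j. ?m < j}))" by simp
        also have "{1..<i} \<inter> {j. ?m < j} = {?m<..<i}" by auto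
        finally show ?thesis by simp
      qed
      also have "(\<Sum>(j, k)\<in>col_pairs ?n. if j = i then of_bool (?m < i) else (0::int)) = (if ?m < i then int (?n - i) else 0)"
      proof -
        have "(\<Sum>(j, k)\<in>col_pairs ?n. if j = i then of_bool (?m < i) else (0::int)) =
          (\<Sum>j\<in>{1..?n}. if j = i then \<Sum>k\<in>{j<..?n}. of_bool (?m < i) else (0::int))"
          unfolding sum_col_pairs by (intro sum.cong refl) auto
        also have "\<dots> = (\<Sum>k\<in>{i<..?n}. of_bool (?m < i))" using i by (subst sum.delta) auto
        finally show ?thesis by simp
      qed
      finally show ?thesis using 2 by (auto simp: fun_upd_def)
    next
      case 3
      have "upper lam \<tau> s = upper lam \<sigma> s" "(\<lambda>j. \<tau> (s, j)) = (\<lambda>j. \<sigma> (s, j))" using 3 by (auto simp: upper_def fun_eq_iff)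
      then show ?thesis using 3 by simp
    qed
  qed
  have "int (quinv lam \<tau>) = (\<Sum>s\<in>{1..height lam}. ?Q \<sigma> s + (if s = r then ?e else 0))"
    unfolding quinv_eq_sum_rows[OF lam] by (rule sum.cong[OF refl], rule row) simp
  also have "\<dots> = (\<Sum>s\<in>{1..height lam}. ?Q \<sigma> s) + ?e"
    unfolding sum.distrib using r_height(1) by (subst sum.delta) auto
  also have "(\<Sum>s\<in>{1..height lam}. ?Q \<sigma> s) = int (quinv lam \<sigma>)" by (rule quinv_eq_sum_rows[OF lam, symmetric])
  finally show ?thesis .
qed

end

section \<open>Cancellation of nontrivial fillings\<close>

definition super_wt :: "nat list \<Rightarrow> 'a::comm_ring_1 \<Rightarrow> 'a \<Rightarrow> (nat \<times> nat \<Rightarrow> int) \<Rightarrow> 'a" where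
  "super_wt lam q t \<sigma> = (-1) ^ nneg lam \<sigma> * q ^ (npos lam \<sigma> + maj lam \<sigma>) * t ^ quinv lam \<sigma>"

locale bad_class =
  fixes lam :: "nat list" and \<alpha> :: "nat \<Rightarrow> nat" and q t :: "'r::idom" and a r :: nat
  assumes lam: "is_partition lam" and a: "1 \<le> a" "a < r" and t: "t \<noteq> 0"
begin

text \<open>Membership of an admissible filling depends only on the absolute values in each row, so
  \<open>B\<close> is stable under sign changes and under permutations within rows. The members of
  \<open>B\<close> with a or - a in row \<open>r\<close> are those whose least violating value is a
  and whose highest row containing it is r.\<close>

definition B :: "(nat \<times> nat \<Rightarrow> int) set" where
  "B = {\<sigma>. (\<sigma> \<in> dg lam \<rightarrow>\<^sub>E {x. x \<noteq> 0} \<and> has_content lam \<sigma> \<alpha>) \<and>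
     (\<forall>u\<in>dg lam. (\<bar>\<sigma> u\<bar> < int (fst u) \<longrightarrow> int a \<le> \<bar>\<sigma> u\<bar>) \<and> (\<bar>\<sigma> u\<bar> = int a \<longrightarrow> fst u \<le> r))}"

abbreviation "m \<equiv> rowlen lam (r + 1)"
abbreviation "n \<equiv> rowlen lam r"
abbreviation "wt \<equiv> super_wt lam q t"

lemma row_r: "(r, j) \<in> dg lam \<longleftrightarrow> j \<in> {1..n}" using dg_iff[OF lam] a by auto

lemma finite_B: "finite B"
  by (rule finite_subset[OF _ finite_fillings[OF lam, of "{x. x \<noteq> 0}" \<alpha>]]) (auto simp: B_def)

text \<open>A violating entry has absolute value at least a by the definition of \<open>B\<close>,
  any other one at least its row number. As a < r, this covers row r - 1 too.\<close>

lemma B_ge: "\<sigma> \<in> B \<Longrightarrow> u \<in> dg lam \<Longrightarrow> a \<le> fst u \<Longrightarrow> int a \<le> \<bar>\<sigma> u\<bar>"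
  unfolding B_def by (cases "\<bar>\<sigma> u\<bar> < int (fst u)") auto

lemma B_gt: "\<sigma> \<in> B \<Longrightarrow> u \<in> dg lam \<Longrightarrow> r < fst u \<Longrightarrow> int a < \<bar>\<sigma> u\<bar>"
proof -
  assume s: "\<sigma> \<in> B" "u \<in> dg lam" "r < fst u"
  have "\<bar>\<sigma> u\<bar> \<noteq> int a" using s unfolding B_def by fastforce
  moreover have "int a \<le> \<bar>\<sigma> u\<bar>" using s a by (intro B_ge) auto
  ultimately show ?thesis by simp
qed

lemma B_abs:
  assumes "\<sigma> \<in> B" "\<tau> \<in> extensional (dg lam)" "\<And>u. u \<in> dg lam \<Longrightarrow> \<bar>\<tau> u\<bar> = \<bar>\<sigma> u\<bar>"
  shows "\<tau> \<in> B"
proof -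
  have "\<tau> u \<noteq> 0" if "u \<in> dg lam" for u
  proof -
    have "\<sigma> u \<noteq> 0" using assms(1) that by (auto simp: B_def)
    then show ?thesis using assms(3)[OF that] by auto
  qed
  moreover have "{u \<in> dg lam. nat \<bar>\<tau> u\<bar> = j} = {u \<in> dg lam. nat \<bar>\<sigma> u\<bar> = j}" for j using assms(3) by auto
  ultimately show ?thesis using assms by (auto simp: B_def has_content_def PiE_def)
qed

lemma flip_mem:
  assumes "\<sigma> \<in> B" "(r, i) \<in> dg lam" "\<bar>\<sigma> (r, i)\<bar> = \<bar>x\<bar>"
  shows "\<sigma>((r, i) := x) \<in> B"
proof (rule B_abs[OF assms(1)])
  have "\<sigma> \<in> extensional (dg lam)" using assms(1) by (auto simp: B_def PiE_def)
  then show "\<sigma>((r, i) := x) \<in> extensional (dg lam)" using assms(2) by (auto simp: extensional_def)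
qed (use assms in auto)

lemma flip:
  assumes "\<sigma> \<in> B" "(r, i) \<in> dg lam" "\<sigma> (r, i) = int a" "\<And>j. (r, j) \<in> dg lam \<Longrightarrow> i < j \<Longrightarrow> \<bar>\<sigma> (r, j)\<bar> \<noteq> int a"
  shows "i \<le> m \<Longrightarrow> wt (\<sigma>((r, i) := - int a)) = - wt \<sigma>"
    and "m < i \<Longrightarrow> i = n \<Longrightarrow> wt (\<sigma>((r, i) := - int a)) = - (t ^ (n - m - 1)) * wt \<sigma>"
proof -
  interpret sign_flip lam \<sigma> "int a" r i
  proof
    show "int a < \<bar>\<sigma> (r, j)\<bar>" if "(r, j) \<in> dg lam" "i < j" for j
      using B_ge[OF assms(1) that(1)] assms(4)[OF that] a by simp
    show "int a < \<bar>\<sigma> (r + 1, j)\<bar>" if "(r + 1, j) \<in> dg lam" for j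
      by (rule B_gt[OF assms(1) that]) simp
    show "int a \<le> \<bar>\<sigma> u\<bar>" if "u \<in> dg lam" "r \<le> fst u + 1" for u
      using that a by (intro B_ge[OF assms(1)]) auto
  qed (use lam a assms in auto)
  have e: "npos lam (\<sigma>((r, i) := - int a)) + maj lam (\<sigma>((r, i) := - int a)) = npos lam \<sigma> + maj lam \<sigma>"
    using npos_flip maj_flip by simp
  have w: "wt (\<sigma>((r, i) := - int a)) = - ((-1) ^ nneg lam \<sigma> * q ^ (npos lam \<sigma> + maj lam \<sigma>) * t ^ quinv lam (\<sigma>((r, i) := - int a)))"
    unfolding super_wt_def e nneg_flip by simp
  show "wt (\<sigma>((r, i) := - int a)) = - wt \<sigma>" if "i \<le> m"
  proof -
    have "quinv lam (\<sigma>((r, i) := - int a)) = quinv lam \<sigma>" using quinv_flip that by simp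
    then show ?thesis unfolding w by (simp add: super_wt_def)
  qed
  show "wt (\<sigma>((r, i) := - int a)) = - (t ^ (n - m - 1)) * wt \<sigma>" if "m < i" "i = n"
  proof -
    have "int (quinv lam (\<sigma>((r, i) := - int a))) = int (quinv lam \<sigma>) + int (i - 1 - m) - int (n - i)"
      using quinv_flip that by simp
    then have "quinv lam (\<sigma>((r, i) := - int a)) = quinv lam \<sigma> + (n - m - 1)" using that by linarith
    then show ?thesis unfolding w by (simp add: super_wt_def power_add mult_ac)
  qed
qed

text \<open>The rightmost entry of absolute value a stands in a column that continues above row r,
  so changing its sign negates the weight. Absolute values stay, hence so does its position
  \<open>K\<close>.\<close>

lemma sum_no_block:
  "(\<Sum>\<sigma>\<in>{\<sigma> \<in> B. (\<exists>j\<in>{1..n}. \<bar>\<sigma> (r, j)\<bar> = int a) \<and> (\<forall>j\<in>{m<..n}. \<bar>\<sigma> (r, j)\<bar> \<noteq> int a)}. wt \<sigma>) = 0"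
proof -
  define U where "U = {\<sigma> \<in> B. (\<exists>j\<in>{1..n}. \<bar>\<sigma> (r, j)\<bar> = int a) \<and> (\<forall>j\<in>{m<..n}. \<bar>\<sigma> (r, j)\<bar> \<noteq> int a)}"
  define K where "K \<sigma> = Max {j \<in> {1..n}. \<bar>\<sigma> (r, j)\<bar> = int a}" for \<sigma> :: "nat \<times> nat \<Rightarrow> int"
  have UB: "\<sigma> \<in> B" if "\<sigma> \<in> U" for \<sigma> using that by (simp add: U_def)
  have K: "(r, K \<sigma>) \<in> dg lam" "\<bar>\<sigma> (r, K \<sigma>)\<bar> = int a" "K \<sigma> \<le> m" if "\<sigma> \<in> U" for \<sigma>
  proof -
    have "{j \<in> {1..n}. \<bar>\<sigma> (r, j)\<bar> = int a} \<noteq> {}" using that by (auto simp: U_def)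
    then have "K \<sigma> \<in> {j \<in> {1..n}. \<bar>\<sigma> (r, j)\<bar> = int a}" unfolding K_def by (intro Max_in) auto
    then have k: "K \<sigma> \<in> {1..n}" "\<bar>\<sigma> (r, K \<sigma>)\<bar> = int a" by auto
    then show "(r, K \<sigma>) \<in> dg lam" "\<bar>\<sigma> (r, K \<sigma>)\<bar> = int a" using row_r by auto
    show "K \<sigma> \<le> m"
    proof (rule ccontr)
      assume "\<not> K \<sigma> \<le> m"
      then have "K \<sigma> \<in> {m<..n}" using k by simp
      moreover have "\<forall>j\<in>{m<..n}. \<bar>\<sigma> (r, j)\<bar> \<noteq> int a" using that by (simp add: U_def)
      ultimately show False using k by blast
    qed
  qed
  have Kmax: "\<bar>\<sigma> (r, j)\<bar> \<noteq> int a" if "(r, j) \<in> dg lam" "K \<sigma> < j" for \<sigma> j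
  proof
    assume "\<bar>\<sigma> (r, j)\<bar> = int a"
    then have "j \<le> K \<sigma>" unfolding K_def using that row_r by (intro Max_ge) auto
    then show False using that by simp
  qed
  have upd: "\<sigma>((r, K \<sigma>) := x) \<in> U" "K (\<sigma>((r, K \<sigma>) := x)) = K \<sigma>" if \<sigma>: "\<sigma> \<in> U" and x: "\<bar>x\<bar> = int a" for \<sigma> x
  proof -
    define k where "k = K \<sigma>"
    have ab: "\<bar>(\<sigma>((r, k) := x)) u\<bar> = \<bar>\<sigma> u\<bar>" for u using K(2)[OF \<sigma>] x by (auto simp: k_def)
    have "\<sigma>((r, k) := x) \<in> B"
      using UB[OF \<sigma>] K[OF \<sigma>] x by (intro flip_mem) (auto simp: k_def)
    then have "\<sigma>((r, k) := x) \<in> U" using \<sigma> unfolding U_def mem_Collect_eq ab by blast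
    then show "\<sigma>((r, K \<sigma>) := x) \<in> U" by (simp only: k_def)
    have "K (\<sigma>((r, k) := x)) = K \<sigma>" by (simp only: K_def ab)
    then show "K (\<sigma>((r, K \<sigma>) := x)) = K \<sigma>" by (simp only: k_def)
  qed
  let ?P = "{\<sigma> \<in> U. \<sigma> (r, K \<sigma>) = int a}" and ?N = "{\<sigma> \<in> U. \<sigma> (r, K \<sigma>) = - int a}"
  have finU: "finite U" unfolding U_def using finite_B by simp
  have "\<sigma> (r, K \<sigma>) = int a \<or> \<sigma> (r, K \<sigma>) = - int a" if "\<sigma> \<in> U" for \<sigma> using K(2)[OF that] by linarith
  then have "U = ?P \<union> ?N" by blast
  moreover have "?P \<inter> ?N = {}" using a by auto
  ultimately have "sum wt U = sum wt ?P + sum wt ?N" using finU by (metis (no_types, lifting) finite_Un sum.union_disjoint)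
  also have "sum wt ?N = (\<Sum>\<sigma>\<in>?P. - wt \<sigma>)"
  proof (rule sum.reindex_bij_witness[of _ "\<lambda>\<sigma>. \<sigma>((r, K \<sigma>) := - int a)" "\<lambda>\<sigma>. \<sigma>((r, K \<sigma>) := int a)"])
    fix \<sigma> assume \<sigma>: "\<sigma> \<in> ?N"
    define \<rho> where "\<rho> = \<sigma>((r, K \<sigma>) := int a)"
    have \<rho>: "\<rho> \<in> U" "K \<rho> = K \<sigma>" "\<rho> (r, K \<rho>) = int a" using upd[of \<sigma> "int a"] \<sigma> by (auto simp: \<rho>_def)
    have inv: "\<rho>((r, K \<rho>) := - int a) = \<sigma>" unfolding \<rho>(2) using \<sigma> by (auto simp: \<rho>_def)
    have "wt (\<rho>((r, K \<rho>) := - int a)) = - wt \<rho>"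
      by (rule flip(1)[OF UB[OF \<rho>(1)] K(1)[OF \<rho>(1)] \<rho>(3) Kmax[where \<sigma> = \<rho>] K(3)[OF \<rho>(1)]])
    then show "- wt (\<sigma>((r, K \<sigma>) := int a)) = wt \<sigma>" unfolding inv by (simp add: \<rho>_def)
    show "\<sigma>((r, K \<sigma>) := int a) \<in> ?P" using \<rho> by (simp add: \<rho>_def)
    show "(\<sigma>((r, K \<sigma>) := int a))((r, K (\<sigma>((r, K \<sigma>) := int a))) := - int a) = \<sigma>" using inv by (simp add: \<rho>_def)
  next
    fix \<sigma> assume \<sigma>: "\<sigma> \<in> ?P"
    define \<rho> where "\<rho> = \<sigma>((r, K \<sigma>) := - int a)"
    have \<rho>: "\<rho> \<in> U" "K \<rho> = K \<sigma>" using upd[of \<sigma> "- int a"] \<sigma> by (auto simp: \<rho>_def)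
    have v: "\<rho> (r, K \<rho>) = - int a" unfolding \<rho>(2) by (simp add: \<rho>_def)
    show "\<sigma>((r, K \<sigma>) := - int a) \<in> ?N" using \<rho> v by (simp add: \<rho>_def)
    have "\<rho>((r, K \<rho>) := int a) = \<sigma>" unfolding \<rho>(2) using \<sigma> by (auto simp: \<rho>_def)
    then show "(\<sigma>((r, K \<sigma>) := - int a))((r, K (\<sigma>((r, K \<sigma>) := - int a))) := int a) = \<sigma>" by (simp add: \<rho>_def)
  qed
  finally show ?thesis by (simp add: sum_negf U_def)
qed

definition kind :: "int \<Rightarrow> int" where
  "kind x = (if \<bar>x\<bar> = int a then sgn x else 0)"

text \<open>The columns m + 1 to n are those of height r; their top entries are recorded by 1 for a,
  - 1 for - a and 0 for any other letter.\<close>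

definition pat :: "(nat \<times> nat \<Rightarrow> int) \<Rightarrow> int list" where
  "pat \<sigma> = map (\<lambda>k. kind (\<sigma> (r, m + 1 + k))) [0..<n - m]"

definition Z :: "int list \<Rightarrow> 'r" where
  "Z \<epsilon> = (\<Sum>\<sigma>\<in>{\<sigma> \<in> B. pat \<sigma> = \<epsilon>}. wt \<sigma>)"

lemma kind_cases: "kind x = 1 \<longleftrightarrow> x = int a" "kind x = - 1 \<longleftrightarrow> x = - int a" "kind x = 0 \<longleftrightarrow> \<bar>x\<bar> \<noteq> int a"
  using a by (auto simp: kind_def sgn_if)

text \<open>In all three pairs the left letter is smaller in \<open><_2\<close> than the right one,
  so by \<open>quinv_col_swap\<close> exchanging the two columns lowers \<open>quinv\<close> by 1
  and keeps the other statistics.\<close>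

lemma Z_swap:
  assumes len: "length \<delta> + length \<eta> + 2 = n - m" and xy: "(x, y) \<in> {(1, 0), (0, - 1), (1, - 1)}"
  shows "Z (\<delta> @ [x, y] @ \<eta>) = t * Z (\<delta> @ [y, x] @ \<eta>)"
proof -
  define c where "c = m + 1 + length \<delta>"
  interpret equal_columns lam r c
    by unfold_locales (use lam a len in \<open>auto simp: c_def\<close>)
  let ?\<tau> = "col_swap r c"
  have pat_nth: "pat \<sigma> ! length \<delta> = kind (\<sigma> (r, c))" "pat \<sigma> ! (length \<delta> + 1) = kind (\<sigma> (r, c + 1))" for \<sigma>
    using len by (auto simp: pat_def c_def)
  have pat_swap: "pat (?\<tau> \<sigma>) = (pat \<sigma>)[length \<delta> := pat \<sigma> ! (length \<delta> + 1), length \<delta> + 1 := pat \<sigma> ! length \<delta>]" for \<sigma>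
  proof (rule nth_equalityI)
    fix k assume "k < length (pat (?\<tau> \<sigma>))"
    then have k: "k < n - m" by (simp add: pat_def)
    have pk: "pat \<rho> ! k = kind (\<rho> (r, m + 1 + k))" for \<rho> using k by (simp add: pat_def)
    have lp: "length (pat \<sigma>) = n - m" by (simp add: pat_def)
    consider "k = length \<delta>" | "k = length \<delta> + 1" | "m + 1 + k \<noteq> c" "m + 1 + k \<noteq> c + 1" by (auto simp: c_def)
    then show "pat (?\<tau> \<sigma>) ! k = (pat \<sigma>)[length \<delta> := pat \<sigma> ! (length \<delta> + 1), length \<delta> + 1 := pat \<sigma> ! length \<delta>] ! k"
    proof cases
      case 1
      then show ?thesis using k pat_nth[of \<sigma>] pat_nth[of "?\<tau> \<sigma>"] col_swap_top(1)[of \<sigma>] lp by simp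
    next
      case 2
      then show ?thesis using k pat_nth[of \<sigma>] pat_nth[of "?\<tau> \<sigma>"] col_swap_top(2)[of \<sigma>] lp by simp
    next
      case 3
      then have "k \<noteq> length \<delta>" "k \<noteq> length \<delta> + 1" by (auto simp: c_def)
      then show ?thesis using pk[of "?\<tau> \<sigma>"] pk[of \<sigma>] col_swap_top(3)[OF 3, of \<sigma> r] by simp
    qed
  qed (simp add: pat_def)
  have upd: "(\<delta> @ [u, v] @ \<eta>)[length \<delta> := v, length \<delta> + 1 := u] = \<delta> @ [v, u] @ \<eta>" for u v
    by (simp add: list_update_append)
  have nth: "(\<delta> @ [u, v] @ \<eta>) ! length \<delta> = u" "(\<delta> @ [u, v] @ \<eta>) ! (length \<delta> + 1) = v" for u v
    by (simp_all add: nth_append)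
  have sw: "pat (?\<tau> \<sigma>) = \<delta> @ [v, u] @ \<eta>" if "pat \<sigma> = \<delta> @ [u, v] @ \<eta>" for \<sigma> u v
    unfolding pat_swap that nth upd ..
  have mem: "?\<tau> \<sigma> \<in> B" if "\<sigma> \<in> B" for \<sigma>
  proof -
    have "\<sigma> \<in> extensional (dg lam)" "\<forall>u\<in>dg lam. \<sigma> u \<noteq> 0" using that by (auto simp: B_def PiE_def)
    then have "?\<tau> \<sigma> \<in> extensional (dg lam)" "\<forall>u\<in>dg lam. ?\<tau> \<sigma> u \<noteq> 0"
      using col_swap_extensional col_swap_rows[of "\<lambda>_ x. x \<noteq> 0" \<sigma>] by auto
    then have "?\<tau> \<sigma> \<in> dg lam \<rightarrow>\<^sub>E {x. x \<noteq> 0}" by (auto simp: PiE_def)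
    then show ?thesis using that has_content_col_swap[of \<sigma> \<alpha>]
        col_swap_rows[of "\<lambda>s x. (\<bar>x\<bar> < int s \<longrightarrow> int a \<le> \<bar>x\<bar>) \<and> (\<bar>x\<bar> = int a \<longrightarrow> s \<le> r)" \<sigma>]
      unfolding B_def by blast
  qed
  have w: "wt \<sigma> = t * wt (?\<tau> \<sigma>)" if \<sigma>: "\<sigma> \<in> B" and p: "pat \<sigma> = \<delta> @ [x, y] @ \<eta>" for \<sigma>
  proof -
    have d: "(r, c) \<in> dg lam" "(r, c + 1) \<in> dg lam" using row_r c_le[of r] c_ge by auto
    have ge: "int a \<le> \<bar>\<sigma> (r, c)\<bar>" "int a \<le> \<bar>\<sigma> (r, c + 1)\<bar>" using B_ge[OF \<sigma> d(1)] B_ge[OF \<sigma> d(2)] a by auto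
    have k: "kind (\<sigma> (r, c)) = x" "kind (\<sigma> (r, c + 1)) = y"
      using pat_nth[of \<sigma>] unfolding p nth by auto
    have "Ind (\<sigma> (r, c + 1)) (\<sigma> (r, c)) \<and> \<not> Ind (\<sigma> (r, c)) (\<sigma> (r, c + 1))"
    proof -
      consider "x = 1" "y = 0" | "x = 0" "y = - 1" | "x = 1" "y = - 1" using xy by auto
      then show ?thesis
      proof cases
        case 1
        then have "\<sigma> (r, c) = int a" "int a < \<bar>\<sigma> (r, c + 1)\<bar>" using k kind_cases ge by auto
        then show ?thesis using Ind_extreme(1)[of "int a" "\<sigma> (r, c + 1)"] Ind_extreme_strict(1)[of "int a" "\<sigma> (r, c + 1)"] a by auto
      next
        case 2
        then have "\<sigma> (r, c + 1) = - int a" "int a < \<bar>\<sigma> (r, c)\<bar>" using k kind_cases ge by auto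
        then show ?thesis using Ind_extreme(2)[of "int a" "\<sigma> (r, c)"] Ind_extreme_strict(2)[of "int a" "\<sigma> (r, c)"] a by auto
      next
        case 3
        then have "\<sigma> (r, c + 1) = - int a" "\<sigma> (r, c) = int a" using k kind_cases by auto
        then show ?thesis using Ind_extreme[of "int a" "int a"] Ind_extreme[of "int a" "- int a"] a by auto
      qed
    qed
    then have "quinv lam \<sigma> = Suc (quinv lam (?\<tau> \<sigma>))" using quinv_col_swap[of \<sigma>] by simp
    then show ?thesis by (simp add: super_wt_def maj_col_swap npos_col_swap nneg_col_swap mult_ac)
  qed
  have "Z (\<delta> @ [x, y] @ \<eta>) = (\<Sum>\<sigma>\<in>{\<sigma> \<in> B. pat \<sigma> = \<delta> @ [y, x] @ \<eta>}. t * wt \<sigma>)"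
    unfolding Z_def
    by (rule sum.reindex_bij_witness[of _ ?\<tau> ?\<tau>]) (use col_swap_col_swap mem sw w in auto)
  then show ?thesis by (simp add: Z_def sum_distrib_left)
qed

text \<open>The last column has n - m - 1 columns of height r on its left and none on its right,
  which gives the power of t for the sign change.\<close>

lemma Z_flip:
  assumes len: "length \<delta> + 1 = n - m"
  shows "Z (\<delta> @ [- 1]) = - (t ^ (n - m - 1)) * Z (\<delta> @ [1])"
proof -
  have mn: "m < n" using len by simp
  have last: "pat \<sigma> = \<delta> @ [x] \<longleftrightarrow> map (\<lambda>k. kind (\<sigma> (r, m + 1 + k))) [0..<length \<delta>] = \<delta> \<and> kind (\<sigma> (r, n)) = x" for \<sigma> x
  proof -
    have "[0..<n - m] = [0..<length \<delta>] @ [length \<delta>]" using len by (metis Suc_eq_plus1 upt_Suc_append zero_le)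
    moreover have "m + 1 + length \<delta> = n" using len by simp
    ultimately show ?thesis by (simp add: pat_def)
  qed
  have d: "(r, n) \<in> dg lam" using row_r mn by simp
  have other: "map (\<lambda>k. kind ((\<sigma>((r, n) := x)) (r, m + 1 + k))) [0..<length \<delta>] = map (\<lambda>k. kind (\<sigma> (r, m + 1 + k))) [0..<length \<delta>]" for \<sigma> x
    using len by auto
  have "Z (\<delta> @ [- 1]) = (\<Sum>\<sigma>\<in>{\<sigma> \<in> B. pat \<sigma> = \<delta> @ [1]}. - (t ^ (n - m - 1)) * wt \<sigma>)"
    unfolding Z_def
  proof (rule sum.reindex_bij_witness[of _ "\<lambda>\<sigma>. \<sigma>((r, n) := - int a)" "\<lambda>\<sigma>. \<sigma>((r, n) := int a)"])
    fix \<sigma> assume \<sigma>: "\<sigma> \<in> {\<sigma> \<in> B. pat \<sigma> = \<delta> @ [- 1]}"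
    then have v: "\<sigma> (r, n) = - int a" using last kind_cases by auto
    show inv: "\<sigma>((r, n) := int a, (r, n) := - int a) = \<sigma>" using v by auto
    have B: "\<sigma>((r, n) := int a) \<in> B" using \<sigma> v d by (intro flip_mem) auto
    have "pat (\<sigma>((r, n) := int a)) = \<delta> @ [1]"
      using \<sigma> unfolding last mem_Collect_eq other by (simp add: kind_cases)
    then show "\<sigma>((r, n) := int a) \<in> {\<sigma> \<in> B. pat \<sigma> = \<delta> @ [1]}" using B by simp
    have "wt ((\<sigma>((r, n) := int a))((r, n) := - int a)) = - (t ^ (n - m - 1)) * wt (\<sigma>((r, n) := int a))"
      by (rule flip(2)[OF B d]) (use row_r mn in auto)
    then show "- (t ^ (n - m - 1)) * wt (\<sigma>((r, n) := int a)) = wt \<sigma>" unfolding inv by simp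
  next
    fix \<sigma> assume \<sigma>: "\<sigma> \<in> {\<sigma> \<in> B. pat \<sigma> = \<delta> @ [1]}"
    then have v: "\<sigma> (r, n) = int a" using last kind_cases by auto
    show "\<sigma>((r, n) := - int a, (r, n) := int a) = \<sigma>" using v by auto
    have B: "\<sigma>((r, n) := - int a) \<in> B" using \<sigma> v d by (intro flip_mem) auto
    have "pat (\<sigma>((r, n) := - int a)) = \<delta> @ [- 1]"
      using \<sigma> unfolding last mem_Collect_eq other by (simp add: kind_cases)
    then show "\<sigma>((r, n) := - int a) \<in> {\<sigma> \<in> B. pat \<sigma> = \<delta> @ [- 1]}" using B by simp
  qed
  then show ?thesis by (simp add: Z_def sum_distrib_left)
qed

lemma pat_eq_zero_iff: "pat \<sigma> = replicate (n - m) 0 \<longleftrightarrow> (\<forall>j\<in>{m<..n}. \<bar>\<sigma> (r, j)\<bar> \<noteq> int a)"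
proof -
  have "pat \<sigma> = replicate (n - m) 0 \<longleftrightarrow> (\<forall>k<n - m. kind (\<sigma> (r, m + 1 + k)) = 0)"
    by (auto simp: pat_def list_eq_iff_nth_eq)
  also have "\<dots> \<longleftrightarrow> (\<forall>j\<in>{m<..n}. \<bar>\<sigma> (r, j)\<bar> \<noteq> int a)"
  proof (intro iffI ballI allI impI)
    fix j assume h: "\<forall>k<n - m. kind (\<sigma> (r, m + 1 + k)) = 0" and j: "j \<in> {m<..n}"
    then have "j - m - 1 < n - m" "m + 1 + (j - m - 1) = j" by auto
    then have "kind (\<sigma> (r, j)) = 0" using h by metis
    then show "\<bar>\<sigma> (r, j)\<bar> \<noteq> int a" by (simp add: kind_cases)
  next
    fix k assume h: "\<forall>j\<in>{m<..n}. \<bar>\<sigma> (r, j)\<bar> \<noteq> int a" and k: "k < n - m"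
    then have "m + 1 + k \<in> {m<..n}" by auto
    then show "kind (\<sigma> (r, m + 1 + k)) = 0" using h unfolding kind_cases by blast
  qed
  finally show ?thesis .
qed

lemma sum_block: "(\<Sum>\<sigma>\<in>{\<sigma> \<in> B. pat \<sigma> \<noteq> replicate (n - m) 0}. wt \<sigma>) = 0"
proof -
  interpret word_function Z t "n - m"
    by unfold_locales (use t Z_swap Z_flip in auto)
  let ?W = "{s. length s = n - m \<and> set s \<subseteq> {-1, 0, 1::int} \<and> s \<noteq> replicate (n - m) 0}"
  let ?S = "{\<sigma> \<in> B. pat \<sigma> \<noteq> replicate (n - m) 0}"
  have fin: "finite ?W"
    by (rule finite_subset[OF _ finite_lists_length_eq[of "{-1, 0, 1}" "n - m"]]) auto
  have "kind x \<in> {-1, 0, 1}" for x by (auto simp: kind_def sgn_if)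
  then have "set (pat \<sigma>) \<subseteq> {-1, 0, 1}" for \<sigma> unfolding pat_def set_map by blast
  moreover have "length (pat \<sigma>) = n - m" for \<sigma> by (simp add: pat_def)
  ultimately have "pat ` ?S \<subseteq> ?W" by (intro image_subsetI CollectI conjI) simp_all
  then have "(\<Sum>\<sigma>\<in>?S. wt \<sigma>) = (\<Sum>s\<in>?W. \<Sum>\<sigma>\<in>{\<sigma> \<in> ?S. pat \<sigma> = s}. wt \<sigma>)"
    using finite_B fin by (intro sum.group[symmetric]) auto
  also have "\<dots> = (\<Sum>s\<in>?W. Z s)"
    unfolding Z_def by (intro sum.cong refl) auto
  also have "\<dots> = 0" by (rule sum_words_eq_0)
  finally show ?thesis .
qed

lemma sum_bad: "(\<Sum>\<sigma>\<in>{\<sigma> \<in> B. \<exists>j\<in>{1..n}. \<bar>\<sigma> (r, j)\<bar> = int a}. wt \<sigma>) = 0"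
proof -
  let ?A = "{\<sigma> \<in> B. (\<exists>j\<in>{1..n}. \<bar>\<sigma> (r, j)\<bar> = int a) \<and> (\<forall>j\<in>{m<..n}. \<bar>\<sigma> (r, j)\<bar> \<noteq> int a)}"
  let ?C = "{\<sigma> \<in> B. pat \<sigma> \<noteq> replicate (n - m) 0}"
  have sub: "j \<in> {1..n}" if "j \<in> {m<..n}" for j using that by auto
  have "{\<sigma> \<in> B. \<exists>j\<in>{1..n}. \<bar>\<sigma> (r, j)\<bar> = int a} = ?A \<union> ?C"
    unfolding pat_eq_zero_iff using sub by blast
  moreover have "?A \<inter> ?C = {}" unfolding pat_eq_zero_iff by blast
  ultimately have "(\<Sum>\<sigma>\<in>{\<sigma> \<in> B. \<exists>j\<in>{1..n}. \<bar>\<sigma> (r, j)\<bar> = int a}. wt \<sigma>) = sum wt ?A + sum wt ?C"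
    using finite_B by (simp only:) (rule sum.union_disjoint, auto)
  then show ?thesis using sum_no_block sum_block by simp
qed

end

lemma sum_nontrivial_idom:
  fixes q t :: "'r::idom"
  assumes lam: "is_partition lam" and t: "t \<noteq> 0"
  shows "(\<Sum>\<sigma>\<in>{\<sigma>. (\<sigma> \<in> dg lam \<rightarrow>\<^sub>E {x. x \<noteq> 0} \<and> has_content lam \<sigma> \<alpha>) \<and> \<not> Phi_trivial lam \<sigma>}. super_wt lam q t \<sigma>) = 0"
proof -
  let ?N = "{\<sigma>. (\<sigma> \<in> dg lam \<rightarrow>\<^sub>E {x. x \<noteq> 0} \<and> has_content lam \<sigma> \<alpha>) \<and> \<not> Phi_trivial lam \<sigma>}"
  let ?D = "\<lambda>\<sigma>. {u \<in> dg lam. \<bar>\<sigma> u\<bar> < int (fst u)}"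
  let ?a = "\<lambda>\<sigma>. Min ((\<lambda>u. nat \<bar>\<sigma> u\<bar>) ` ?D \<sigma>)"
  let ?r = "\<lambda>\<sigma>. Max (fst ` {u \<in> dg lam. \<bar>\<sigma> u\<bar> = int (?a \<sigma>)})"
  let ?g = "\<lambda>\<sigma>. (?a \<sigma>, ?r \<sigma>)"
  have fin: "finite (dg lam)" by (rule finite_dg[OF lam])
  have finN: "finite ?N"
    by (rule finite_subset[OF _ finite_fillings[OF lam, of "{x. x \<noteq> 0}" \<alpha>]]) auto
  have ge: "?a \<sigma> \<le> nat \<bar>\<sigma> u\<bar>" if "u \<in> ?D \<sigma>" for \<sigma> u using that fin by (intro Min_le) auto
  have le: "fst u \<le> ?r \<sigma>" if "u \<in> dg lam" "\<bar>\<sigma> u\<bar> = int (?a \<sigma>)" for \<sigma> u using that fin by (intro Max_ge) auto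
  have props: "1 \<le> ?a \<sigma>" "?a \<sigma> < ?r \<sigma>" "\<exists>u\<in>dg lam. fst u = ?r \<sigma> \<and> \<bar>\<sigma> u\<bar> = int (?a \<sigma>)" if \<sigma>: "\<sigma> \<in> ?N" for \<sigma>
  proof -
    have "?D \<sigma> \<noteq> {}" using \<sigma> by (auto simp: Phi_trivial_def not_le)
    then have "?a \<sigma> \<in> (\<lambda>u. nat \<bar>\<sigma> u\<bar>) ` ?D \<sigma>" using fin by (intro Min_in) auto
    then obtain u where u: "u \<in> ?D \<sigma>" "?a \<sigma> = nat \<bar>\<sigma> u\<bar>" by (elim imageE)
    have "\<sigma> u \<noteq> 0" using u \<sigma> by auto
    then show "1 \<le> ?a \<sigma>" unfolding u(2) by linarith
    have ua: "\<bar>\<sigma> u\<bar> = int (?a \<sigma>)" unfolding u(2) by simp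
    have "int (?a \<sigma>) < int (fst u)" using u(1) ua by simp
    then show "?a \<sigma> < ?r \<sigma>" using le[of u \<sigma>] u(1) ua by (simp only: mem_Collect_eq) linarith
    have "?r \<sigma> \<in> fst ` {u \<in> dg lam. \<bar>\<sigma> u\<bar> = int (?a \<sigma>)}" using fin u(1) ua by (intro Max_in) auto
    then obtain v where "v \<in> {u \<in> dg lam. \<bar>\<sigma> u\<bar> = int (?a \<sigma>)}" "?r \<sigma> = fst v" by (elim imageE)
    then show "\<exists>u\<in>dg lam. fst u = ?r \<sigma> \<and> \<bar>\<sigma> u\<bar> = int (?a \<sigma>)" by (intro bexI[of _ v]) simp_all
  qed
  have "(\<Sum>\<sigma>\<in>?N. super_wt lam q t \<sigma>) = (\<Sum>x\<in>?g ` ?N. \<Sum>\<sigma>\<in>{\<sigma> \<in> ?N. ?g \<sigma> = x}. super_wt lam q t \<sigma>)"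
    using finN by (intro sum.group[symmetric]) auto
  also have "\<dots> = 0"
  proof (rule sum.neutral, rule ballI)
    fix x assume "x \<in> ?g ` ?N"
    then obtain \<rho> where \<rho>: "\<rho> \<in> ?N" "x = ?g \<rho>" by (elim imageE)
    define a where "a = ?a \<rho>"
    define r where "r = ?r \<rho>"
    interpret bad_class lam \<alpha> q t a r
      by unfold_locales (use lam t props[OF \<rho>(1)] in \<open>simp_all add: a_def r_def\<close>)
    \<comment> \<open>In \<open>B\<close> no violating entry is below a in absolute value. An entry
      a or - a in row r > a is itself violating, so the minimum is attained and the highest row is
      r.\<close>
    have "{\<sigma> \<in> ?N. ?g \<sigma> = (a, r)} = {\<sigma> \<in> B. \<exists>j\<in>{1..rowlen lam r}. \<bar>\<sigma> (r, j)\<bar> = int a}"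
    proof (intro set_eqI iffI)
      fix \<sigma> assume "\<sigma> \<in> {\<sigma> \<in> ?N. ?g \<sigma> = (a, r)}"
      then have \<sigma>: "\<sigma> \<in> ?N" and eq: "?g \<sigma> = (a, r)" by blast+
      have ar: "?a \<sigma> = a" "?r \<sigma> = r"
        using arg_cong[OF eq, of fst] arg_cong[OF eq, of snd] unfolding fst_conv snd_conv .
      have ar': "Max (fst ` {u \<in> dg lam. \<bar>\<sigma> u\<bar> = int a}) = r" using ar(2) unfolding ar(1) .
      have "int a \<le> \<bar>\<sigma> u\<bar>" if "u \<in> dg lam" "\<bar>\<sigma> u\<bar> < int (fst u)" for u
        using ge[of u \<sigma>] that unfolding ar by simp
      moreover have "fst u \<le> r" if "u \<in> dg lam" "\<bar>\<sigma> u\<bar> = int a" for u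
        using le[of u \<sigma>] that unfolding ar(1) ar' by simp
      ultimately have "\<sigma> \<in> B" using \<sigma> unfolding B_def by blast
      moreover obtain u where u: "u \<in> dg lam" "fst u = r" "\<bar>\<sigma> u\<bar> = int a"
        using props(3)[OF \<sigma>] unfolding ar(1) ar' by blast
      then have "(r, snd u) \<in> dg lam" "\<bar>\<sigma> (r, snd u)\<bar> = int a" by auto
      ultimately show "\<sigma> \<in> {\<sigma> \<in> B. \<exists>j\<in>{1..rowlen lam r}. \<bar>\<sigma> (r, j)\<bar> = int a}" using row_r by blast
    next
      fix \<sigma> assume "\<sigma> \<in> {\<sigma> \<in> B. \<exists>j\<in>{1..rowlen lam r}. \<bar>\<sigma> (r, j)\<bar> = int a}"
      then obtain j where B: "\<sigma> \<in> B" and j: "(r, j) \<in> dg lam" "\<bar>\<sigma> (r, j)\<bar> = int a" using row_r by blast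
      have D: "(r, j) \<in> ?D \<sigma>" using j a by simp
      have nt: "\<not> Phi_trivial lam \<sigma>"
      proof
        assume "Phi_trivial lam \<sigma>"
        then have "int r \<le> \<bar>\<sigma> (r, j)\<bar>" using j(1) unfolding Phi_trivial_def by fastforce
        then show False using j(2) a by simp
      qed
      have "?a \<sigma> = a"
      proof (rule Min_eqI)
        show "finite ((\<lambda>u. nat \<bar>\<sigma> u\<bar>) ` ?D \<sigma>)" using fin by simp
        show "a \<in> (\<lambda>u. nat \<bar>\<sigma> u\<bar>) ` ?D \<sigma>" using D j by (intro image_eqI[of _ _ "(r, j)"]) auto
        fix y assume "y \<in> (\<lambda>u. nat \<bar>\<sigma> u\<bar>) ` ?D \<sigma>"
        then obtain u where u: "u \<in> ?D \<sigma>" "y = nat \<bar>\<sigma> u\<bar>" by (elim imageE)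
        then have "int a \<le> \<bar>\<sigma> u\<bar>" using B unfolding B_def by blast
        then show "a \<le> y" unfolding u(2) by linarith
      qed
      moreover have "?r \<sigma> = r"
        unfolding \<open>?a \<sigma> = a\<close>
      proof (rule Max_eqI)
        show "finite (fst ` {u \<in> dg lam. \<bar>\<sigma> u\<bar> = int a})" using fin by simp
        show "r \<in> fst ` {u \<in> dg lam. \<bar>\<sigma> u\<bar> = int a}" using j by (intro image_eqI[of _ _ "(r, j)"]) auto
        fix y assume "y \<in> fst ` {u \<in> dg lam. \<bar>\<sigma> u\<bar> = int a}"
        then obtain u where "u \<in> {u \<in> dg lam. \<bar>\<sigma> u\<bar> = int a}" "y = fst u" by (elim imageE)
        then show "y \<le> r" using B unfolding B_def by blast
      qed
      ultimately show "\<sigma> \<in> {\<sigma> \<in> ?N. ?g \<sigma> = (a, r)}" using B nt unfolding B_def by blast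
    qed
    then show "(\<Sum>\<sigma>\<in>{\<sigma> \<in> ?N. ?g \<sigma> = x}. super_wt lam q t \<sigma>) = 0"
    proof -
      have "x = (a, r)" unfolding \<rho>(2) a_def r_def ..
      then show ?thesis using \<open>{\<sigma> \<in> ?N. ?g \<sigma> = (a, r)} = _\<close> sum_bad by (simp only:)
    qed
  qed
  finally show ?thesis .
qed

lemma super_coeff_eq_full_coeff_idom:
  fixes q t :: "'r::idom"
  assumes lam: "is_partition lam" and t: "t \<noteq> 0"
  shows "super_coeff lam q t \<alpha> = full_coeff lam q t \<alpha>"
proof -
  let ?A = "{\<sigma>. \<sigma> \<in> dg lam \<rightarrow>\<^sub>E {x. x \<noteq> 0} \<and> has_content lam \<sigma> \<alpha>}"
  let ?T = "{\<sigma>. \<sigma> \<in> dg lam \<rightarrow>\<^sub>E {a. a \<noteq> 0} \<and> Phi_trivial lam \<sigma> \<and> has_content lam \<sigma> \<alpha>}"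
  let ?N = "{\<sigma>. (\<sigma> \<in> dg lam \<rightarrow>\<^sub>E {x. x \<noteq> 0} \<and> has_content lam \<sigma> \<alpha>) \<and> \<not> Phi_trivial lam \<sigma>}"
  have fin: "finite ?A" by (rule finite_fillings[OF lam])
  have "?A = ?T \<union> ?N" "?T \<inter> ?N = {}" by auto
  moreover have "finite ?T" "finite ?N" by (rule finite_subset[OF _ fin], blast)+
  ultimately have "sum (super_wt lam q t) ?A = sum (super_wt lam q t) ?T + sum (super_wt lam q t) ?N"
    by (simp only:) (rule sum.union_disjoint)
  then show ?thesis
    unfolding sum_nontrivial_idom[OF assms] by (simp add: full_coeff_def super_coeff_def super_wt_def)
qed

text \<open>Both coefficients are polynomial in t: the identity holds with the indeterminate, which
  is nonzero, in place of t, and evaluation gives every t, including 0.\<close>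

lemma super_coeff_eq_full_coeff:
  fixes q t :: "'r::idom"
  assumes "is_partition lam"
  shows "super_coeff lam q t = full_coeff lam q t"
proof
  fix \<alpha>
  have "super_coeff lam q t \<alpha> = poly (super_coeff lam [:q:] [:0, 1:] \<alpha>) t"
    by (simp add: super_coeff_def poly_sum)
  moreover have "full_coeff lam q t \<alpha> = poly (full_coeff lam [:q:] [:0, 1:] \<alpha>) t"
    by (simp add: full_coeff_def poly_sum)
  ultimately show "super_coeff lam q t \<alpha> = full_coeff lam q t \<alpha>"
    using super_coeff_eq_full_coeff_idom[OF assms, of "[:0, 1:] :: 'r poly"] by simp
qed

section \<open>Dominance and the main theorem\<close>

lemma sum_list_take_conj_part:
  assumes lam: "is_partition lam"
  shows "sum_list (take k (conj_part lam)) = card {u \<in> dg lam. fst u \<le> k}"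
proof -
  let ?H = "height lam"
  have "conj_part lam = map (rowlen lam) [1..<?H + 1]"
    by (simp add: conj_part_def rowlen_def height_def)
  moreover have "take k [1..<?H + 1] = [1..<min k ?H + 1]"
    by (cases "k \<le> ?H") (simp_all add: take_upt min_def del: upt_Suc)
  ultimately have "sum_list (take k (conj_part lam)) = (\<Sum>r\<in>{1..min k ?H}. rowlen lam r)"
    by (simp add: take_map interv_sum_list_conv_sum_set_nat atLeastLessThanSuc_atLeastAtMost del: upt_Suc)
  also have "\<dots> = card (Sigma {1..min k ?H} (\<lambda>r. {1..rowlen lam r}))" by simp
  also have "Sigma {1..min k ?H} (\<lambda>r. {1..rowlen lam r}) = {u \<in> dg lam. fst u \<le> k}"
    unfolding dg_eq_Sigma[OF lam] by auto
  finally show ?thesis .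
qed

lemma sum_list_take_part_exp: "sum_list (take k mu) = (\<Sum>j\<in>{1..k}. part_exp mu j)"
proof -
  have "sum_list (take k mu) = (\<Sum>i\<in>{..<min k (length mu)}. mu ! i)"
    by (simp add: sum_list_sum_nth atLeast0LessThan min.commute)
  also have "\<dots> = (\<Sum>j\<in>{1..min k (length mu)}. part_exp mu j)"
    by (rule sum.reindex_bij_witness[of _ "\<lambda>j. j - 1" Suc]) (auto simp: part_exp_def)
  also have "\<dots> = (\<Sum>j\<in>{1..k}. part_exp mu j)"
    by (rule sum.mono_neutral_left) (auto simp: part_exp_def)
  finally show ?thesis .
qed

text \<open>A nonzero coefficient supplies a trivial filling of content mu. The sum of the first k
  parts of mu counts its cells with absolute value at most k, and
  \<open>sum_list_take_conj_part\<close> counts the cells of the first k rows.\<close>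

lemma super_coeff_part_exp_dominated:
  assumes lam: "is_partition lam" and mu: "mu \<in> partitions_of (sum_list lam)"
    and nz: "super_coeff lam q t (part_exp mu) \<noteq> 0"
  shows "dominated mu (conj_part lam)"
proof -
  have fin: "finite (dg lam)" by (rule finite_dg[OF lam])
  have "{\<sigma>. \<sigma> \<in> dg lam \<rightarrow>\<^sub>E {a. a \<noteq> 0} \<and> Phi_trivial lam \<sigma> \<and> has_content lam \<sigma> (part_exp mu)} \<noteq> {}"
    using nz unfolding super_coeff_def by (metis (no_types, lifting) sum.empty)
  then obtain \<sigma> where triv: "Phi_trivial lam \<sigma>" and cont: "has_content lam \<sigma> (part_exp mu)" by blast
  \<comment> \<open>The bound is large enough for \<open>take\<close> to return the whole list and
    for the condition on rows to hold for every cell.\<close>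
  have "sum_list (conj_part lam) = sum_list (take (max (height lam) (length (conj_part lam))) (conj_part lam))" by simp
  also have "\<dots> = card (dg lam)"
  proof -
    have "{u \<in> dg lam. fst u \<le> max (height lam) (length (conj_part lam))} = dg lam"
      using dg_eq_Sigma[OF lam] by auto
    then show ?thesis unfolding sum_list_take_conj_part[OF lam] by simp
  qed
  finally have "sum_list mu = sum_list (conj_part lam)"
    using mu card_dg[OF lam] by (simp add: partitions_of_def)
  moreover have "sum_list (take k mu) \<le> sum_list (take k (conj_part lam))" for k
  proof -
    have "sum_list (take k mu) = (\<Sum>j\<in>{1..k}. card {u \<in> dg lam. nat \<bar>\<sigma> u\<bar> = j})"
      unfolding sum_list_take_part_exp using cont by (simp add: has_content_def)
    also have "\<dots> = card (\<Union>j\<in>{1..k}. {u \<in> dg lam. nat \<bar>\<sigma> u\<bar> = j})"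
      by (rule card_UN_disjoint[symmetric]) (use fin in auto)
    also have "\<dots> \<le> card {u \<in> dg lam. fst u \<le> k}"
    proof (rule card_mono)
      show "(\<Union>j\<in>{1..k}. {u \<in> dg lam. nat \<bar>\<sigma> u\<bar> = j}) \<subseteq> {u \<in> dg lam. fst u \<le> k}"
      proof
        fix u assume "u \<in> (\<Union>j\<in>{1..k}. {u \<in> dg lam. nat \<bar>\<sigma> u\<bar> = j})"
        then have u: "u \<in> dg lam" "nat \<bar>\<sigma> u\<bar> \<le> k" by auto
        then have "int (fst u) \<le> \<bar>\<sigma> u\<bar>" using triv by (simp add: Phi_trivial_def)
        then show "u \<in> {u \<in> dg lam. fst u \<le> k}" using u by simp
      qed
    qed (use fin in simp)
    finally show ?thesis unfolding sum_list_take_conj_part[OF lam] .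
  qed
  ultimately show ?thesis by (simp add: dominated_def)
qed

text \<open>The plethysm acts on expansions in power sums: the first clause provides one for
  C_lambda, the second speaks of every such expansion. The field of rational functions in q and t is
  one instance of the type \<open>'a\<close>.\<close>

theorem mainTheorem8:
  fixes lam :: "nat list" and q t :: "'a::field_char_0"
  assumes "is_partition lam"
  shows "(\<exists>c. C_coeff lam q t = pcomb (sum_list lam) c)
    \<and> (\<forall>c. C_coeff lam q t = pcomb (sum_list lam) c \<longrightarrow>
           pleth_qm1 q (sum_list lam) c = super_coeff lam q t)
    \<and> (\<exists>d. super_coeff lam q t =
           (\<lambda>\<alpha>. \<Sum>mu\<in>{mu. mu \<in> partitions_of (sum_list lam) \<and> dominated mu (conj_part lam)}.
                  d mu * mono_coeff mu \<alpha>))"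
proof (intro conjI)
  let ?n = "sum_list lam"
  show ex: "\<exists>c. C_coeff lam q t = pcomb ?n c"
    by (rule symmetric_pcomb_ex[OF symmetric_C_coeff[OF assms]])
  show pleth: "\<forall>c. C_coeff lam q t = pcomb ?n c \<longrightarrow> pleth_qm1 q ?n c = super_coeff lam q t"
    using pleth_eq_full_coeff[OF assms] super_coeff_eq_full_coeff[OF assms] by metis
  obtain c where c: "super_coeff lam q t = pleth_qm1 q ?n c" using ex pleth by metis
  \<comment> \<open>The plethysm only rescales the coefficients of the power sums, so
    \<open>super_coeff\<close> is symmetric, which its definition by trivial fillings does not
    show.\<close>
  have "pleth_qm1 q ?n c = pcomb ?n (\<lambda>mu. c mu * prod_list (map (\<lambda>m. q ^ m - 1) mu))"
    by (simp add: pleth_qm1_def pcomb_def fun_eq_iff)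
  then have sym: "symmetric ?n (super_coeff lam q t)" unfolding c by (simp add: symmetric_pcomb)
  show "\<exists>d. super_coeff lam q t =
      (\<lambda>\<alpha>. \<Sum>mu\<in>{mu. mu \<in> partitions_of ?n \<and> dominated mu (conj_part lam)}. d mu * mono_coeff mu \<alpha>)"
  proof (intro exI ext)
    fix \<alpha>
    \<comment> \<open>This fixes the witness: \<open>d mu\<close> is the coefficient of x^mu, which
      vanishes unless mu is dominated by the conjugate.\<close>
    have "super_coeff lam q t \<alpha> = (\<Sum>mu\<in>partitions_of ?n. super_coeff lam q t (part_exp mu) * mono_coeff mu \<alpha>)"
      by (rule symmetric_mono_expansion[OF sym])
    also have "\<dots> = (\<Sum>mu\<in>{mu. mu \<in> partitions_of ?n \<and> dominated mu (conj_part lam)}.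
        super_coeff lam q t (part_exp mu) * mono_coeff mu \<alpha>)"
    proof (rule sum.mono_neutral_right[OF finite_partitions_of])
      show "\<forall>mu\<in>partitions_of ?n - {mu. mu \<in> partitions_of ?n \<and> dominated mu (conj_part lam)}.
          super_coeff lam q t (part_exp mu) * mono_coeff mu \<alpha> = 0"
        using super_coeff_part_exp_dominated[OF assms] by fastforce
    qed auto
    finally show "super_coeff lam q t \<alpha> = (\<Sum>mu\<in>{mu. mu \<in> partitions_of ?n \<and> dominated mu (conj_part lam)}.
        super_coeff lam q t (part_exp mu) * mono_coeff mu \<alpha>)" .
  qed
qed

end
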